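(* Let $\Phi$ be a field with $\frac12,\sqrt{-1}\in\Phi$ (that is, of characteristic other than $2$ and containing a square root of $-1$), and let $L_\Phi$ be the Lorentz type algebra over $\Phi$. Then the algebraic group $\mathbf{Aut}(L_\Phi)$ is isomorphic to $\mathbf{PGL}_2^2\rtimes\mathbf Z_2$.
   Context: For a commutative unital ring $R$, the Lorentz type algebra $L_R$ is the Lie $R$-algebra which is free as an $R$-module with basis $b_1,\dots,b_6$ and whose (alternating) bracket is given by $[b_1,b_2]=b_4$, $[b_1,b_3]=b_5$, $[b_1,b_4]=b_2$, $[b_1,b_5]=b_3$, $[b_1,b_6]=0$, $[b_2,b_3]=b_6$, $[b_2,b_4]=-b_1$, $[b_2,b_5]=0$, $[b_2,b_6]=b_3$, $[b_3,b_4]=0$, $[b_3,b_5]=-b_1$, $[b_3,b_6]=-b_2$, $[b_4,b_5]=-b_6$, $[b_4,b_6]=b_5$, $[b_5,b_6]=-b_4$. Affine group schemes over $\Phi$ are regarded as functors from commutative associative unital $\Phi$-algebras to groups. $\mathbf{Aut}(L_\Phi)$ is the affine group scheme $R\mapsto\mathrm{Aut}_R(L_R)$ (automorphisms of the Lie $R$-algebra $L_R=L_\Phi\otimes_\Phi R$). $\mathbf{PGL}_2$ denotes the affine group scheme defined, for every commutative associative unital $\Phi$-algebra $R$, by $\mathbf{PGL}_2(R):=\mathbf{GL}_2(R)/\mathbf G_m(R)$, where $\mathbf{GL}_2$ is the general linear group scheme and $\mathbf G_m(R):=R^\times$; and $\mathbf{PGL}_2^2=\mathbf{PGL}_2\times\mathbf{PGL}_2$.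 $\mathbf Z_2$ is the finite constant group scheme represented by the Hopf algebra $\Phi\times\Phi$ (componentwise product), i.e. $\mathbf Z_2(R)=\mathrm{Hom}_\Phi(\Phi\times\Phi,R)$; it is isomorphic to $R\mapsto\mathrm{Aut}_R(R\times R)$ ($R$-algebra automorphisms, componentwise product). In the semidirect product, $\alpha\in\mathrm{Aut}_R(R\times R)$ acts on $\mathbf{PGL}_2(R)^2$ by applying $\alpha$ to the entries of a pair of matrices $(p,q)$ regarded as a single matrix with entries in $R\times R$.
   Formalization: PGL_2 is taken as the Zariski sheaf associated with R ↦ GL_2(R)/R^×, because that functor itself is not an affine group scheme (it fails when Pic(R) has 2-torsion); the isomorphism is natural on Φ-algebras carried by an arbitrary fixed set. *)

theory Defs
  imports "HOL-Algebra.Algebra"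
begin

section \<open>Group functors on commutative algebras\<close>

text \<open>
  Commutative associative unital algebras over \<open>F\<close> are the \<open>R\<close> with \<^term>\<open>algebra F R\<close>; the
  zero algebra is included. A group functor consists of the groups of points and the maps
  \<open>trans G R S h\<close> from the points over \<open>R\<close> to the points over \<open>S\<close> induced by \<open>h\<close>. Its test
  algebras have their carriers in an arbitrary type \<open>'r\<close>. If \<open>'r\<close> is infinite and at least as
  large as \<open>F\<close>, all finitely generated algebras occur up to isomorphism, hence so do the
  coordinate algebras of affine group schemes of finite type.
\<close>

definition alg_hom ::
  "('k, 'm) ring_scheme \<Rightarrow> ('k, 'a) module \<Rightarrow> ('k, 'b) module \<Rightarrow> ('a \<Rightarrow> 'b) set" where
  "alg_hom F A B =
     {h \<in> ring_hom A B. \<forall>c\<in>carrier F. \<forall>x\<in>carrier A. h (c \<odot>\<^bsub>A\<^esub> x) = c \<odot>\<^bsub>B\<^esub> h x}"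

record ('k, 'r, 'g) group_functor =
  points :: "('k, 'r) module \<Rightarrow> 'g monoid"
  trans :: "('k, 'r) module \<Rightarrow> ('k, 'r) module \<Rightarrow> ('r \<Rightarrow> 'r) \<Rightarrow> 'g \<Rightarrow> 'g"

definition iso_group_functors ::
  "('k, 'm) ring_scheme \<Rightarrow> ('k, 'r, 'g) group_functor \<Rightarrow> ('k, 'r, 'h) group_functor \<Rightarrow> bool" where
  "iso_group_functors F G H \<longleftrightarrow>
     (\<exists>\<eta>. (\<forall>R. algebra F R \<longrightarrow> \<eta> R \<in> iso (points G R) (points H R)) \<and>
          (\<forall>R S h. algebra F R \<longrightarrow> algebra F S \<longrightarrow> h \<in> alg_hom F R S \<longrightarrow>
             (\<forall>x\<in>carrier (points G R). \<eta> S (trans G R S h x) = trans H R S h (\<eta> R x))))"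

definition prod_functor ::
  "('k, 'r, 'g) group_functor \<Rightarrow> ('k, 'r, 'h) group_functor \<Rightarrow> ('k, 'r, 'g \<times> 'h) group_functor" where
  "prod_functor G H =
     \<lparr>points = (\<lambda>R. points G R \<times>\<times> points H R),
      trans = (\<lambda>R S h (x, y). (trans G R S h x, trans H R S h y))\<rparr>"

definition semidirect ::
  "('g, 'm) monoid_scheme \<Rightarrow> ('h, 'n) monoid_scheme \<Rightarrow> ('h \<Rightarrow> 'g \<Rightarrow> 'g) \<Rightarrow> ('g \<times> 'h) monoid" where
  "semidirect N H act =
     \<lparr>carrier = carrier N \<times> carrier H,
      monoid.mult = (\<lambda>(x, a) (y, b). (x \<otimes>\<^bsub>N\<^esub> act a y, a \<otimes>\<^bsub>H\<^esub> b)),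
      one = (\<one>\<^bsub>N\<^esub>, \<one>\<^bsub>H\<^esub>)\<rparr>"

definition semidirect_functor ::
  "('k, 'r, 'g) group_functor \<Rightarrow> ('k, 'r, 'h) group_functor \<Rightarrow>
     (('k, 'r) module \<Rightarrow> 'h \<Rightarrow> 'g \<Rightarrow> 'g) \<Rightarrow> ('k, 'r, 'g \<times> 'h) group_functor" where
  "semidirect_functor N H act =
     \<lparr>points = (\<lambda>R. semidirect (points N R) (points H R) (act R)),
      trans = (\<lambda>R S h (x, a). (trans N R S h x, trans H R S h a))\<rparr>"


section \<open>The Lorentz type algebra and its automorphism group scheme\<close>

text \<open>An entry \<open>((i, j), (c, l))\<close> stands for \<open>[b\<^sub>i, b\<^sub>j] = c b\<^sub>l\<close>; pairs \<open>i < j\<close> that are not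
  listed have bracket zero.\<close>

definition lorentz_table :: "((nat \<times> nat) \<times> (int \<times> nat)) list" where
  "lorentz_table =
    [((1,2), (1,4)), ((1,3), (1,5)), ((1,4), (1,2)), ((1,5), (1,3)),
     ((2,3), (1,6)), ((2,4), (-1,1)), ((2,6), (1,3)),
     ((3,5), (-1,1)), ((3,6), (-1,2)),
     ((4,5), (-1,6)), ((4,6), (1,5)),
     ((5,6), (-1,4))]"

text \<open>The coefficient of \<open>b\<^sub>k\<close> in \<open>[b\<^sub>i, b\<^sub>j]\<close>:\<close>

definition lorentz_coeff :: "nat \<Rightarrow> nat \<Rightarrow> nat \<Rightarrow> int" where
  "lorentz_coeff i j k =
     (case map_of lorentz_table (i, j) of
        Some (c, l) \<Rightarrow> if k = l then c else 0
      | None \<Rightarrow>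
          (case map_of lorentz_table (j, i) of
             Some (c, l) \<Rightarrow> if k = l then - c else 0
           | None \<Rightarrow> 0))"

text \<open>Elements are coordinate vectors with respect to \<open>b\<^sub>1, \<dots>, b\<^sub>6\<close>. The Lie bracket is the
  multiplication of the record; the field \<open>one\<close> is meaningless.\<close>

definition lorentz_alg :: "('r, 'm) ring_scheme \<Rightarrow> ('r, nat \<Rightarrow> 'r) module" where
  "lorentz_alg R =
     \<lparr>carrier = {1..6} \<rightarrow>\<^sub>E carrier R,
      monoid.mult = (\<lambda>x y. \<lambda>k\<in>{1..6}. \<Oplus>\<^bsub>R\<^esub>i\<in>{1..6}. \<Oplus>\<^bsub>R\<^esub>j\<in>{1..6}.
                add_pow R (lorentz_coeff i j k) (x i \<otimes>\<^bsub>R\<^esub> y j)),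
      one = undefined,
      ring.zero = (\<lambda>k\<in>{1..6}. \<zero>\<^bsub>R\<^esub>),
      ring.add = (\<lambda>x y. \<lambda>k\<in>{1..6}. x k \<oplus>\<^bsub>R\<^esub> y k),
      smult = (\<lambda>a x. \<lambda>k\<in>{1..6}. a \<otimes>\<^bsub>R\<^esub> x k)\<rparr>"

definition lorentz_basis :: "('r, 'm) ring_scheme \<Rightarrow> nat \<Rightarrow> nat \<Rightarrow> 'r" where
  "lorentz_basis R j = (\<lambda>k\<in>{1..6}. if k = j then \<one>\<^bsub>R\<^esub> else \<zero>\<^bsub>R\<^esub>)"

definition lie_aut :: "('r, 'm) ring_scheme \<Rightarrow> ('r, 'l) module \<Rightarrow> ('l \<Rightarrow> 'l) monoid" where
  "lie_aut R L = (BijGroup (carrier L))\<lparr>carrier :=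
     {f \<in> Bij (carrier L).
        (\<forall>x\<in>carrier L. \<forall>y\<in>carrier L. f (x \<oplus>\<^bsub>L\<^esub> y) = f x \<oplus>\<^bsub>L\<^esub> f y) \<and>
        (\<forall>a\<in>carrier R. \<forall>x\<in>carrier L. f (a \<odot>\<^bsub>L\<^esub> x) = a \<odot>\<^bsub>L\<^esub> f x) \<and>
        (\<forall>x\<in>carrier L. \<forall>y\<in>carrier L. f (x \<otimes>\<^bsub>L\<^esub> y) = f x \<otimes>\<^bsub>L\<^esub> f y)}\<rparr>"

text \<open>Base change along \<open>h : R \<rightarrow> S\<close> is the \<open>S\<close>-linear extension of \<open>f\<close> to \<open>L\<^sub>S = L\<^sub>R \<otimes>\<^sub>R S\<close>.\<close>

definition Aut_lorentz :: "('k, 'r, (nat \<Rightarrow> 'r) \<Rightarrow> (nat \<Rightarrow> 'r)) group_functor" where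
  "Aut_lorentz =
     \<lparr>points = (\<lambda>R. lie_aut R (lorentz_alg R)),
      trans = (\<lambda>R S h f. \<lambda>x\<in>carrier (lorentz_alg S). \<lambda>i\<in>{1..6}.
                 \<Oplus>\<^bsub>S\<^esub>j\<in>{1..6}. x j \<otimes>\<^bsub>S\<^esub> h (f (lorentz_basis R j) i))\<rparr>"


section \<open>The groups \<open>GL\<^sub>2(R)/R\<^sup>\<times>\<close>\<close>

datatype 'a mat2 = Mat2 'a 'a 'a 'a

fun mat2_mult :: "('a, 'm) ring_scheme \<Rightarrow> 'a mat2 \<Rightarrow> 'a mat2 \<Rightarrow> 'a mat2" where
  "mat2_mult R (Mat2 a b c d) (Mat2 a' b' c' d') =
     Mat2 (a \<otimes>\<^bsub>R\<^esub> a' \<oplus>\<^bsub>R\<^esub> b \<otimes>\<^bsub>R\<^esub> c') (a \<otimes>\<^bsub>R\<^esub> b' \<oplus>\<^bsub>R\<^esub> b \<otimes>\<^bsub>R\<^esub> d')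
          (c \<otimes>\<^bsub>R\<^esub> a' \<oplus>\<^bsub>R\<^esub> d \<otimes>\<^bsub>R\<^esub> c') (c \<otimes>\<^bsub>R\<^esub> b' \<oplus>\<^bsub>R\<^esub> d \<otimes>\<^bsub>R\<^esub> d')"

definition mat2_monoid :: "('a, 'm) ring_scheme \<Rightarrow> 'a mat2 monoid" where
  "mat2_monoid R =
     \<lparr>carrier = {A. set_mat2 A \<subseteq> carrier R},
      monoid.mult = mat2_mult R,
      one = Mat2 \<one>\<^bsub>R\<^esub> \<zero>\<^bsub>R\<^esub> \<zero>\<^bsub>R\<^esub> \<one>\<^bsub>R\<^esub>\<rparr>"

definition GL2 :: "('a, 'm) ring_scheme \<Rightarrow> 'a mat2 monoid" where
  "GL2 R = units_of (mat2_monoid R)"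

definition scalar_units :: "('a, 'm) ring_scheme \<Rightarrow> 'a mat2 set" where
  "scalar_units R = (\<lambda>u. Mat2 u \<zero>\<^bsub>R\<^esub> \<zero>\<^bsub>R\<^esub> u) ` Units R"

definition GL2_mod_Gm :: "('a, 'm) ring_scheme \<Rightarrow> 'a mat2 set monoid" where
  "GL2_mod_Gm R = GL2 R Mod scalar_units R"

text \<open>The map induced by a ring homomorphism \<open>h\<close> into \<open>S\<close>, sending the coset of \<open>g\<close> to the coset of \<open>h(g)\<close>:\<close>

definition GL2_mod_Gm_map ::
  "('b, 'm) ring_scheme \<Rightarrow> ('a \<Rightarrow> 'b) \<Rightarrow> 'a mat2 set \<Rightarrow> 'b mat2 set" where
  "GL2_mod_Gm_map S h C = scalar_units S <#>\<^bsub>GL2 S\<^esub> (map_mat2 h ` C)"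


section \<open>Localization of commutative rings\<close>

definition fraction ::
  "('a, 'm) ring_scheme \<Rightarrow> 'a set \<Rightarrow> 'a \<Rightarrow> 'a \<Rightarrow> ('a \<times> 'a) set" where
  "fraction R M a s = {(b, t). b \<in> carrier R \<and> t \<in> M \<and>
     (\<exists>u\<in>M. u \<otimes>\<^bsub>R\<^esub> (a \<otimes>\<^bsub>R\<^esub> t) = u \<otimes>\<^bsub>R\<^esub> (b \<otimes>\<^bsub>R\<^esub> s))}"

definition localization :: "('a, 'm) ring_scheme \<Rightarrow> 'a set \<Rightarrow> ('a \<times> 'a) set ring" where
  "localization R M =
     \<lparr>carrier = {fraction R M a s | a s. a \<in> carrier R \<and> s \<in> M},
      monoid.mult = (\<lambda>A B. \<Union>(a, s)\<in>A. \<Union>(b, t)\<in>B. fraction R M (a \<otimes>\<^bsub>R\<^esub> b) (s \<otimes>\<^bsub>R\<^esub> t)),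
      one = fraction R M \<one>\<^bsub>R\<^esub> \<one>\<^bsub>R\<^esub>,
      ring.zero = fraction R M \<zero>\<^bsub>R\<^esub> \<one>\<^bsub>R\<^esub>,
      ring.add = (\<lambda>A B. \<Union>(a, s)\<in>A. \<Union>(b, t)\<in>B.
               fraction R M (a \<otimes>\<^bsub>R\<^esub> t \<oplus>\<^bsub>R\<^esub> b \<otimes>\<^bsub>R\<^esub> s) (s \<otimes>\<^bsub>R\<^esub> t))\<rparr>"

text \<open>\<open>a/s \<mapsto> h(a)/h(s)\<close>, into the localization of \<open>S\<close> at \<open>N\<close>:\<close>

definition localization_map ::
  "('b, 'm) ring_scheme \<Rightarrow> 'b set \<Rightarrow> ('a \<Rightarrow> 'b) \<Rightarrow> ('a \<times> 'a) set \<Rightarrow> ('b \<times> 'b) set" where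
  "localization_map S N h A = (\<Union>(a, s)\<in>A. fraction S N (h a) (h s))"

definition Spec :: "('a, 'm) ring_scheme \<Rightarrow> 'a set set" where
  "Spec R = {p. primeideal p R}"

abbreviation local_ring_at :: "('a, 'm) ring_scheme \<Rightarrow> 'a set \<Rightarrow> ('a \<times> 'a) set ring" where
  "local_ring_at R p \<equiv> localization R (carrier R - p)"

definition away :: "('a, 'm) ring_scheme \<Rightarrow> 'a \<Rightarrow> 'a set" where
  "away R f = {f [^]\<^bsub>R\<^esub> (n::nat) | n. True}"


section \<open>The group scheme \<open>PGL\<^sub>2\<close>\<close>

text \<open>
  The functor \<open>R \<mapsto> GL\<^sub>2(R)/R\<^sup>\<times>\<close> is only a presheaf and is not representable: if \<open>I\<close> is an invertible
  ideal of a Dedekind domain \<open>R\<close> that is not principal while \<open>I\<^sup>2\<close> is, then \<open>I \<oplus> I \<cong> R\<^sup>2\<close> gives a matrix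
  over the field of fractions that is locally on \<open>R\<close>, but not globally, a scalar multiple of an
  invertible matrix. As usual for quotients of affine group schemes, the affine group scheme
  \<open>GL\<^sub>2/G\<^sub>m\<close> is the sheaf associated with this presheaf. The Zariski topology suffices, because
  \<open>G\<^sub>m\<close>-torsors are Zariski locally trivial.
  The points over \<open>R\<close> are the global sections, over the spectrum of \<open>R\<close>, of the sheafification
  of \<open>D(f) \<mapsto> GL\<^sub>2(R\<^sub>f)/R\<^sub>f\<^sup>\<times>\<close>: families of germs in \<open>GL\<^sub>2(R\<^sub>p)/R\<^sub>p\<^sup>\<times>\<close> which around every prime come
  from some \<open>GL\<^sub>2(R\<^sub>f)/R\<^sub>f\<^sup>\<times>\<close>. If \<open>R\<close> is a local ring this is \<open>GL\<^sub>2(R)/R\<^sup>\<times>\<close>.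
\<close>

definition PGL2_points :: "('a, 'm) ring_scheme \<Rightarrow> ('a set \<Rightarrow> ('a \<times> 'a) set mat2 set) monoid" where
  "PGL2_points R =
     \<lparr>carrier = {\<sigma> \<in> (\<Pi>\<^sub>E p\<in>Spec R. carrier (GL2_mod_Gm (local_ring_at R p))).
        \<forall>p\<in>Spec R. \<exists>f\<in>carrier R - p.
          \<exists>C\<in>carrier (GL2_mod_Gm (localization R (away R f))).
            \<forall>q\<in>Spec R. f \<notin> q \<longrightarrow>
              \<sigma> q = GL2_mod_Gm_map (local_ring_at R q)
                      (localization_map R (carrier R - q) (\<lambda>x. x)) C},
      monoid.mult = (\<lambda>\<sigma> \<tau>. \<lambda>p\<in>Spec R. \<sigma> p \<otimes>\<^bsub>GL2_mod_Gm (local_ring_at R p)\<^esub> \<tau> p),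
      one = (\<lambda>p\<in>Spec R. \<one>\<^bsub>GL2_mod_Gm (local_ring_at R p)\<^esub>)\<rparr>"

definition PGL2 :: "('k, 'r, 'r set \<Rightarrow> ('r \<times> 'r) set mat2 set) group_functor" where
  "PGL2 =
     \<lparr>points = (\<lambda>R. PGL2_points R),
      trans = (\<lambda>R S h \<sigma>. \<lambda>q\<in>Spec S.
                 GL2_mod_Gm_map (local_ring_at S q) (localization_map S (carrier S - q) h)
                   (\<sigma> {x \<in> carrier R. h x \<in> q}))\<rparr>"


section \<open>The constant group scheme \<open>Z\<^sub>2\<close> and its action on \<open>PGL\<^sub>2 \<times> PGL\<^sub>2\<close>\<close>

definition split_alg :: "('k, 'm) ring_scheme \<Rightarrow> ('k, 'k \<times> 'k) module" where
  "split_alg F = ring.extend (RDirProd F F)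
     \<lparr>smult = (\<lambda>c (u, v). (c \<otimes>\<^bsub>F\<^esub> u, c \<otimes>\<^bsub>F\<^esub> v))\<rparr>"

text \<open>
  \<open>F \<times> F\<close> is the Hopf algebra of functions on \<open>{0, 1}\<close>, the group of order two, with comultiplication
  \<open>(\<Delta> x)(i, j) = x (i + j)\<close>. Hence the product of \<open>\<chi>\<close> and \<open>\<psi>\<close> maps \<open>x = (u, v)\<close> to
  \<open>\<chi> (1, 0) \<psi> (u, v) + \<chi> (0, 1) \<psi> (v, u)\<close>, and the neutral element is the counit \<open>x \<mapsto> x 0\<close>.
\<close>

definition Z2 :: "('k, 'm) ring_scheme \<Rightarrow> ('k, 'r, 'k \<times> 'k \<Rightarrow> 'r) group_functor" where
  "Z2 F =
     \<lparr>points = (\<lambda>R.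
        \<lparr>carrier = alg_hom F (split_alg F) R \<inter> extensional (carrier (split_alg F)),
         monoid.mult = (\<lambda>\<chi> \<psi>. \<lambda>(u, v)\<in>carrier (split_alg F).
                   \<chi> (\<one>\<^bsub>F\<^esub>, \<zero>\<^bsub>F\<^esub>) \<otimes>\<^bsub>R\<^esub> \<psi> (u, v) \<oplus>\<^bsub>R\<^esub> \<chi> (\<zero>\<^bsub>F\<^esub>, \<one>\<^bsub>F\<^esub>) \<otimes>\<^bsub>R\<^esub> \<psi> (v, u)),
         one = (\<lambda>(u, v)\<in>carrier (split_alg F). u \<odot>\<^bsub>R\<^esub> \<one>\<^bsub>R\<^esub>)\<rparr>),
      trans = (\<lambda>R S h \<chi>. compose (carrier (split_alg F)) h \<chi>)\<rparr>"

text \<open>The \<open>R\<close>-algebra automorphism of \<open>R \<times> R\<close> corresponding to \<open>\<chi>\<close>. It is the identity if \<open>\<chi>\<close> is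
  the neutral element and interchanges the factors where \<open>\<chi> (0, 1) = 1\<close>.\<close>

definition prod_aut ::
  "('k, 'm) ring_scheme \<Rightarrow> ('a, 'n) ring_scheme \<Rightarrow> ('k \<times> 'k \<Rightarrow> 'a) \<Rightarrow> 'a \<times> 'a \<Rightarrow> 'a \<times> 'a" where
  "prod_aut F R \<chi> = (\<lambda>(a, b).
     (\<chi> (\<one>\<^bsub>F\<^esub>, \<zero>\<^bsub>F\<^esub>) \<otimes>\<^bsub>R\<^esub> a \<oplus>\<^bsub>R\<^esub> \<chi> (\<zero>\<^bsub>F\<^esub>, \<one>\<^bsub>F\<^esub>) \<otimes>\<^bsub>R\<^esub> b,
      \<chi> (\<zero>\<^bsub>F\<^esub>, \<one>\<^bsub>F\<^esub>) \<otimes>\<^bsub>R\<^esub> a \<oplus>\<^bsub>R\<^esub> \<chi> (\<one>\<^bsub>F\<^esub>, \<zero>\<^bsub>F\<^esub>) \<otimes>\<^bsub>R\<^esub> b))"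

fun mat2_zip :: "'a mat2 \<Rightarrow> 'b mat2 \<Rightarrow> ('a \<times> 'b) mat2" where
  "mat2_zip (Mat2 a b c d) (Mat2 a' b' c' d') = Mat2 (a, a') (b, b') (c, c') (d, d')"

definition mat2_pair_act :: "('a \<times> 'a \<Rightarrow> 'a \<times> 'a) \<Rightarrow> 'a mat2 \<times> 'a mat2 \<Rightarrow> 'a mat2 \<times> 'a mat2" where
  "mat2_pair_act \<alpha> = (\<lambda>(p, q).
     let m = map_mat2 \<alpha> (mat2_zip p q) in (map_mat2 fst m, map_mat2 snd m))"

text \<open>On a pair of cosets, \<open>\<alpha>\<close> acts through representatives; on a pair of sections of \<open>PGL\<^sub>2\<close> it acts
  germ by germ, where \<open>\<chi>\<close> is composed with \<open>R \<rightarrow> R\<^sub>p\<close>.\<close>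

definition coset_pair_act ::
  "('a \<times> 'a \<Rightarrow> 'a \<times> 'a) \<Rightarrow> 'a mat2 set \<times> 'a mat2 set \<Rightarrow> 'a mat2 set \<times> 'a mat2 set" where
  "coset_pair_act \<alpha> = (\<lambda>(C, D).
     (fst ` mat2_pair_act \<alpha> ` (C \<times> D), snd ` mat2_pair_act \<alpha> ` (C \<times> D)))"

definition Z2_act ::
  "('k, 'm) ring_scheme \<Rightarrow> ('k, 'r) module \<Rightarrow> ('k \<times> 'k \<Rightarrow> 'r) \<Rightarrow>
     ('r set \<Rightarrow> ('r \<times> 'r) set mat2 set) \<times> ('r set \<Rightarrow> ('r \<times> 'r) set mat2 set) \<Rightarrow>
     ('r set \<Rightarrow> ('r \<times> 'r) set mat2 set) \<times> ('r set \<Rightarrow> ('r \<times> 'r) set mat2 set)" where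
  "Z2_act F R \<chi> = (\<lambda>(\<sigma>, \<tau>).
     let act = (\<lambda>p. coset_pair_act
                  (prod_aut F (local_ring_at R p)
                     (\<lambda>x. fraction R (carrier R - p) (\<chi> x) \<one>\<^bsub>R\<^esub>))
                  (\<sigma> p, \<tau> p))
     in (\<lambda>p\<in>Spec R. fst (act p), \<lambda>p\<in>Spec R. snd (act p)))"

definition PGL2sq_Z2 ::
  "('k, 'm) ring_scheme \<Rightarrow>
     ('k, 'r, (('r set \<Rightarrow> ('r \<times> 'r) set mat2 set) \<times> ('r set \<Rightarrow> ('r \<times> 'r) set mat2 set)) \<times>
              ('k \<times> 'k \<Rightarrow> 'r)) group_functor" where
  "PGL2sq_Z2 F = semidirect_functor (prod_functor PGL2 PGL2) (Z2 F) (Z2_act F)"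

end

theory Submission
  imports Defs
begin

text \<open>
  Over a ring \<open>R\<close> containing \<open>i\<close> with \<open>i\<^sup>2 = -1\<close> and \<open>1/2\<close>, the coordinates
  \<open>-(x\<^sub>4 + j x\<^sub>3, x\<^sub>5 - j x\<^sub>2, x\<^sub>6 + j x\<^sub>1)\<close> for \<open>j = i\<close> and \<open>j = -i\<close> identify the Lorentz type algebra
  with two copies of \<open>R\<^sup>3\<close> under the cross product. The identity
  \<open>u \<times> (v \<times> w) = (u \<cdot> w) v - (u \<cdot> v) w\<close> shows that every automorphism is an interchange of the two
  copies, controlled by an idempotent of \<open>R\<close>, followed by a pair of oriented orthonormal frames.
  In terms of Pauli matrices such a frame is an automorphism of the ring of \<open>2 \<times> 2\<close>
  matrices. Averaging over the quaternion group shows that it is inner wherever \<open>2 (1 + w\<^sub>3)\<close> or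
  \<open>2 (1 - w\<^sub>3)\<close> is a unit, hence locally on \<open>Spec R\<close>, and the conjugating matrix is unique up to a
  unit: frames give sections of \<open>PGL\<^sub>2\<close>. Conversely the entries of the frames belonging to the germs
  of a section glue to elements of \<open>R\<close>.
\<close>

section \<open>Localization\<close>

text \<open>Neither group can be written directly in terms of the other: an automorphism need not be
  conjugation by matrices over \<open>R\<close>, and a section of \<open>PGL2\<close> need not be
  represented by one matrix over \<open>R\<close>. Both are therefore compared with triples
  \<open>(U, V, e)\<close> of two frames and an idempotent, which are given by polynomial equations
  over \<open>R\<close>. A frame is a point of SO_3. The passage to \<open>PGL2\<close> assigns to
  it, at each prime, the set of all matrices that implement it by conjugation. This set is a full
  coset of the scalars, so no representative is chosen, and compatibility with localization and base
  change can be checked on any single member. The idempotent is there because the spectrum may be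
  disconnected: an automorphism can interchange the two copies over one open and closed part and
  preserve them over the rest. The element 1/2 separates the two copies and lets the averages be
  invertible; the square root of -1 also puts the quaternions into matrix form. Both are chosen in
  \<Phi>, so that one choice serves all algebras, and this makes the isomorphism natural.\<close>

locale mult_set = cring R + submonoid M R for M and R (structure)
begin

lemma in_carrier: "s \<in> M \<Longrightarrow> s \<in> carrier R"
  using subset by blast

lemma mult_in [simp]: "s \<in> M \<Longrightarrow> t \<in> M \<Longrightarrow> s \<otimes> t \<in> M"
  by (rule m_closed)

lemma one_in [simp]: "\<one> \<in> M"
  by (rule one_closed)

lemma mem_fraction_iff:
  "(b, t) \<in> fraction R M a s \<longleftrightarrow>
     b \<in> carrier R \<and> t \<in> M \<and> (\<exists>u\<in>M. u \<otimes> (a \<otimes> t) = u \<otimes> (b \<otimes> s))"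
  by (simp add: fraction_def)

lemma mem_fraction_self [simp]: "a \<in> carrier R \<Longrightarrow> s \<in> M \<Longrightarrow> (a, s) \<in> fraction R M a s"
  by (auto simp: mem_fraction_iff)

lemma mem_fraction_trans:
  assumes "(b, t) \<in> fraction R M a s" "(c, r) \<in> fraction R M b t"
    and [simp]: "a \<in> carrier R" "s \<in> M"
  shows "(c, r) \<in> fraction R M a s"
proof -
  obtain u v where u: "u \<in> M" "u \<otimes> (a \<otimes> t) = u \<otimes> (b \<otimes> s)"
    and v: "v \<in> M" "v \<otimes> (b \<otimes> r) = v \<otimes> (c \<otimes> t)"
    and [simp]: "b \<in> carrier R" "t \<in> M" "c \<in> carrier R" "r \<in> M"
    using assms by (auto simp: mem_fraction_iff)
  note [simp] = in_carrier[OF \<open>s \<in> M\<close>] in_carrier[OF \<open>t \<in> M\<close>] in_carrier[OF \<open>r \<in> M\<close>]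
    in_carrier[OF u(1)] in_carrier[OF v(1)]
  \<comment> \<open>Denominators may be zero divisors, so the middle denominator \<open>t\<close>
    cannot be cancelled. It is absorbed into the multiplier, which becomes
    \<open>u v t\<close>.\<close>
  have "u \<otimes> v \<otimes> t \<otimes> (a \<otimes> r) = v \<otimes> r \<otimes> (u \<otimes> (a \<otimes> t))"
    using u(1) v(1) by (simp add: m_ac)
  also have "\<dots> = u \<otimes> s \<otimes> (v \<otimes> (b \<otimes> r))"
    using u v(1) by (simp add: m_ac)
  also have "\<dots> = u \<otimes> v \<otimes> t \<otimes> (c \<otimes> s)"
    using u(1) v by (simp add: m_ac)
  finally show ?thesis
    using u v by (auto simp: mem_fraction_iff intro!: bexI[of _ "u \<otimes> v \<otimes> t"])
qed

lemma mem_fraction_sym: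
  assumes "(b, t) \<in> fraction R M a s" "a \<in> carrier R" "s \<in> M"
  shows "(a, s) \<in> fraction R M b t"
  using assms by (force simp: mem_fraction_iff)

lemma fraction_eq_mem_iff:
  assumes "a \<in> carrier R" "s \<in> M" "b \<in> carrier R" "t \<in> M"
  shows "fraction R M a s = fraction R M b t \<longleftrightarrow> (b, t) \<in> fraction R M a s"
proof
  assume bt: "(b, t) \<in> fraction R M a s"
  have "(c, r) \<in> fraction R M a s \<longleftrightarrow> (c, r) \<in> fraction R M b t" for c r
    using mem_fraction_trans[OF bt] mem_fraction_trans[OF mem_fraction_sym[OF bt]] assms by blast
  then show "fraction R M a s = fraction R M b t"
    by auto
qed (use assms in auto)

lemma fraction_eq_iff:
  assumes "a \<in> carrier R" "s \<in> M" "b \<in> carrier R" "t \<in> M"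
  shows "fraction R M a s = fraction R M b t \<longleftrightarrow> (\<exists>u\<in>M. u \<otimes> (a \<otimes> t) = u \<otimes> (b \<otimes> s))"
  using assms by (simp add: fraction_eq_mem_iff mem_fraction_iff)

text \<open>The equation stands first so that an identity already computed fixes the multiplier
  \<open>u\<close>. This form serves where two fractions agree only after multiplication by a
  power.\<close>

lemma fraction_eqI':
  assumes "u \<otimes> (a \<otimes> t) = u \<otimes> (b \<otimes> s)"
    and "u \<in> M" "a \<in> carrier R" "s \<in> M" "b \<in> carrier R" "t \<in> M"
  shows "fraction R M a s = fraction R M b t"
  using assms fraction_eq_iff by blast

lemma fraction_eqI:
  assumes "a \<in> carrier R" "s \<in> M" "b \<in> carrier R" "t \<in> M" "a \<otimes> t = b \<otimes> s"
  shows "fraction R M a s = fraction R M b t"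
  using assms by (auto simp: fraction_eq_iff)

lemma mem_fraction_eq:
  assumes "(b, t) \<in> fraction R M a s" "a \<in> carrier R" "s \<in> M"
  shows "b \<in> carrier R" "t \<in> M" "fraction R M b t = fraction R M a s"
proof -
  show "b \<in> carrier R" "t \<in> M"
    using assms(1) by (auto simp: mem_fraction_iff)
  then show "fraction R M b t = fraction R M a s"
    using assms by (simp add: fraction_eq_mem_iff[symmetric])
qed

section \<open>The ring structure on the localization\<close>

abbreviation "L \<equiv> localization R M"

lemma carrier_loc: "carrier L = {fraction R M a s | a s. a \<in> carrier R \<and> s \<in> M}"
  by (simp add: localization_def)

lemma fraction_closed [simp]: "a \<in> carrier R \<Longrightarrow> s \<in> M \<Longrightarrow> fraction R M a s \<in> carrier L"
  by (auto simp: carrier_loc)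

lemma loc_cases:
  assumes "x \<in> carrier L"
  obtains a s where "a \<in> carrier R" "s \<in> M" "s \<in> carrier R" "x = fraction R M a s"
  using assms in_carrier by (auto simp: carrier_loc)

lemma one_loc: "\<one>\<^bsub>L\<^esub> = fraction R M \<one> \<one>"
  by (simp add: localization_def)

lemma zero_loc: "\<zero>\<^bsub>L\<^esub> = fraction R M \<zero> \<one>"
  by (simp add: localization_def)

lemma mult_loc: "A \<otimes>\<^bsub>L\<^esub> B = (\<Union>(a, s)\<in>A. \<Union>(b, t)\<in>B. fraction R M (a \<otimes> b) (s \<otimes> t))"
  by (simp add: localization_def)

lemma add_loc:
  "A \<oplus>\<^bsub>L\<^esub> B = (\<Union>(a, s)\<in>A. \<Union>(b, t)\<in>B. fraction R M (a \<otimes> t \<oplus> b \<otimes> s) (s \<otimes> t))"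
  by (simp add: localization_def)

text \<open>The operations of \<open>localization\<close> are unions over all representatives. Since
  classes are nonempty, such a union collapses to one value once the result does not depend on the
  representatives.\<close>

lemma UN_fraction_const:
  assumes "a \<in> carrier R" "s \<in> M" "b \<in> carrier R" "t \<in> M"
    and "\<And>a' s' b' t'. (a', s') \<in> fraction R M a s \<Longrightarrow> (b', t') \<in> fraction R M b t \<Longrightarrow>
           F a' s' b' t' = C"
  shows "(\<Union>(a, s)\<in>fraction R M a s. \<Union>(b, t)\<in>fraction R M b t. F a s b t) = C"
  using assms(5) mem_fraction_self[OF assms(1,2)] mem_fraction_self[OF assms(3,4)]
  by (auto split: prod.splits) blast+

lemma fraction_mult:
  assumes [simp]: "a \<in> carrier R" "s \<in> M" "b \<in> carrier R" "t \<in> M"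
  shows "fraction R M a s \<otimes>\<^bsub>L\<^esub> fraction R M b t = fraction R M (a \<otimes> b) (s \<otimes> t)"
proof -
  have "fraction R M (a' \<otimes> b') (s' \<otimes> t') = fraction R M (a \<otimes> b) (s \<otimes> t)"
    if 1: "(a', s') \<in> fraction R M a s" and 2: "(b', t') \<in> fraction R M b t" for a' s' b' t'
  proof -
    note [simp] = mem_fraction_eq(1,2)[OF 1] mem_fraction_eq(1,2)[OF 2]
      mem_fraction_eq(2)[OF 1, THEN in_carrier] mem_fraction_eq(2)[OF 2, THEN in_carrier]
      assms(2,4)[THEN in_carrier]
    obtain u v where u [simp]: "u \<in> M" and ue: "u \<otimes> (a \<otimes> s') = u \<otimes> (a' \<otimes> s)"
      and v [simp]: "v \<in> M" and ve: "v \<otimes> (b \<otimes> t') = v \<otimes> (b' \<otimes> t)"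
      using 1 2 by (auto simp: mem_fraction_iff)
    note [simp] = in_carrier[OF u] in_carrier[OF v]
    have "u \<otimes> v \<otimes> (a' \<otimes> b' \<otimes> (s \<otimes> t)) = (u \<otimes> (a' \<otimes> s)) \<otimes> (v \<otimes> (b' \<otimes> t))"
      by (simp add: m_ac)
    also have "\<dots> = u \<otimes> v \<otimes> (a \<otimes> b \<otimes> (s' \<otimes> t'))"
      unfolding ue[symmetric] ve[symmetric] by (simp add: m_ac)
    finally show ?thesis
      by (rule fraction_eqI') simp_all
  qed
  then show ?thesis
    unfolding mult_loc by - (rule UN_fraction_const[OF assms])
qed

lemma fraction_add:
  assumes [simp]: "a \<in> carrier R" "s \<in> M" "b \<in> carrier R" "t \<in> M"
  shows "fraction R M a s \<oplus>\<^bsub>L\<^esub> fraction R M b t = fraction R M (a \<otimes> t \<oplus> b \<otimes> s) (s \<otimes> t)"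
proof -
  have "fraction R M (a' \<otimes> t' \<oplus> b' \<otimes> s') (s' \<otimes> t') = fraction R M (a \<otimes> t \<oplus> b \<otimes> s) (s \<otimes> t)"
    if 1: "(a', s') \<in> fraction R M a s" and 2: "(b', t') \<in> fraction R M b t" for a' s' b' t'
  proof -
    note [simp] = mem_fraction_eq(1,2)[OF 1] mem_fraction_eq(1,2)[OF 2]
      mem_fraction_eq(2)[OF 1, THEN in_carrier] mem_fraction_eq(2)[OF 2, THEN in_carrier]
      assms(2,4)[THEN in_carrier]
    obtain u v where u [simp]: "u \<in> M" and ue: "u \<otimes> (a \<otimes> s') = u \<otimes> (a' \<otimes> s)"
      and v [simp]: "v \<in> M" and ve: "v \<otimes> (b \<otimes> t') = v \<otimes> (b' \<otimes> t)"
      using 1 2 by (auto simp: mem_fraction_iff)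
    note [simp] = in_carrier[OF u] in_carrier[OF v]
    have "u \<otimes> v \<otimes> ((a' \<otimes> t' \<oplus> b' \<otimes> s') \<otimes> (s \<otimes> t)) =
        (u \<otimes> (a' \<otimes> s)) \<otimes> (v \<otimes> t \<otimes> t') \<oplus> (v \<otimes> (b' \<otimes> t)) \<otimes> (u \<otimes> s \<otimes> s')"
      by (simp add: m_ac r_distr l_distr)
    also have "\<dots> = u \<otimes> v \<otimes> ((a \<otimes> t \<oplus> b \<otimes> s) \<otimes> (s' \<otimes> t'))"
      unfolding ue[symmetric] ve[symmetric] by (simp add: m_ac r_distr l_distr)
    finally show ?thesis
      by (rule fraction_eqI') simp_all
  qed
  then show ?thesis
    unfolding add_loc by - (rule UN_fraction_const[OF assms])
qed

lemma cring_loc: "cring L"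
proof (rule cringI)
  show "abelian_group L"
  proof (rule abelian_groupI)
    fix x y z assume "x \<in> carrier L" "y \<in> carrier L" "z \<in> carrier L"
    then obtain a s b t c r where [simp]: "a \<in> carrier R" "s \<in> M" "s \<in> carrier R"
        "b \<in> carrier R" "t \<in> M" "t \<in> carrier R"
        "c \<in> carrier R" "r \<in> M" "r \<in> carrier R"
      and "x = fraction R M a s" "y = fraction R M b t" "z = fraction R M c r"
      by (metis loc_cases)
    then show "x \<oplus>\<^bsub>L\<^esub> y \<oplus>\<^bsub>L\<^esub> z = x \<oplus>\<^bsub>L\<^esub> (y \<oplus>\<^bsub>L\<^esub> z)"
      by (simp add: fraction_add m_ac a_ac l_distr r_distr)
  next
    fix x y assume "x \<in> carrier L" "y \<in> carrier L"
    then obtain a s b t where [simp]: "a \<in> carrier R" "s \<in> M" "s \<in> carrier R"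
        "b \<in> carrier R" "t \<in> M" "t \<in> carrier R"
      and "x = fraction R M a s" "y = fraction R M b t"
      by (metis loc_cases)
    then show "x \<oplus>\<^bsub>L\<^esub> y = y \<oplus>\<^bsub>L\<^esub> x" "x \<oplus>\<^bsub>L\<^esub> y \<in> carrier L"
      by (simp_all add: fraction_add m_ac a_ac)
  next
    fix x assume "x \<in> carrier L"
    then obtain a s where x: "a \<in> carrier R" "s \<in> M" "s \<in> carrier R" "x = fraction R M a s"
      by (rule loc_cases)
    then show "\<zero>\<^bsub>L\<^esub> \<oplus>\<^bsub>L\<^esub> x = x"
      by (simp add: zero_loc fraction_add)
    have "fraction R M (\<ominus> a) s \<oplus>\<^bsub>L\<^esub> x = \<zero>\<^bsub>L\<^esub>"
      using x by (simp add: fraction_add zero_loc l_minus l_neg) (rule fraction_eqI, simp_all)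
    then show "\<exists>y\<in>carrier L. y \<oplus>\<^bsub>L\<^esub> x = \<zero>\<^bsub>L\<^esub>"
      using x by (intro bexI[of _ "fraction R M (\<ominus> a) s"]) auto
  qed (simp add: zero_loc)
  show "comm_monoid L"
  proof (rule comm_monoidI)
    fix x y z assume "x \<in> carrier L" "y \<in> carrier L" "z \<in> carrier L"
    then obtain a s b t c r where [simp]: "a \<in> carrier R" "s \<in> M" "s \<in> carrier R"
        "b \<in> carrier R" "t \<in> M" "t \<in> carrier R"
        "c \<in> carrier R" "r \<in> M" "r \<in> carrier R"
      and "x = fraction R M a s" "y = fraction R M b t" "z = fraction R M c r"
      by (metis loc_cases)
    then show "x \<otimes>\<^bsub>L\<^esub> y \<otimes>\<^bsub>L\<^esub> z = x \<otimes>\<^bsub>L\<^esub> (y \<otimes>\<^bsub>L\<^esub> z)"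
      by (simp add: fraction_mult m_ac)
  next
    fix x y assume "x \<in> carrier L" "y \<in> carrier L"
    then obtain a s b t where [simp]: "a \<in> carrier R" "s \<in> M" "s \<in> carrier R"
        "b \<in> carrier R" "t \<in> M" "t \<in> carrier R"
      and "x = fraction R M a s" "y = fraction R M b t"
      by (metis loc_cases)
    then show "x \<otimes>\<^bsub>L\<^esub> y = y \<otimes>\<^bsub>L\<^esub> x" "x \<otimes>\<^bsub>L\<^esub> y \<in> carrier L"
      by (simp_all add: fraction_mult m_ac)
  next
    fix x assume "x \<in> carrier L"
    then show "\<one>\<^bsub>L\<^esub> \<otimes>\<^bsub>L\<^esub> x = x"
      by (rule loc_cases) (simp add: fraction_mult one_loc)
  qed (simp add: one_loc)
  fix x y z assume "x \<in> carrier L" "y \<in> carrier L" "z \<in> carrier L"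
  then obtain a s b t c r where car: "a \<in> carrier R" "s \<in> M" "s \<in> carrier R"
        "b \<in> carrier R" "t \<in> M" "t \<in> carrier R"
        "c \<in> carrier R" "r \<in> M" "r \<in> carrier R"
    and xyz: "x = fraction R M a s" "y = fraction R M b t" "z = fraction R M c r"
    by (metis loc_cases)
  \<comment> \<open>The two sides of the distributive law come with the denominators
    \<open>s t r\<close> and \<open>s r t r\<close>. Unlike associativity, the law therefore does
    not hold for numerators and denominators separately and is checked after
    cross-multiplication.\<close>
  have "(a \<otimes> t \<oplus> b \<otimes> s) \<otimes> c \<otimes> (s \<otimes> r \<otimes> (t \<otimes> r)) =
      (a \<otimes> c \<otimes> (t \<otimes> r) \<oplus> b \<otimes> c \<otimes> (s \<otimes> r)) \<otimes> (s \<otimes> t \<otimes> r)"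
    using car by algebra
  then show "(x \<oplus>\<^bsub>L\<^esub> y) \<otimes>\<^bsub>L\<^esub> z = x \<otimes>\<^bsub>L\<^esub> z \<oplus>\<^bsub>L\<^esub> y \<otimes>\<^bsub>L\<^esub> z"
    using car unfolding xyz by (simp add: fraction_add fraction_mult) (rule fraction_eqI, simp_all)
qed

abbreviation to_loc :: "'a \<Rightarrow> ('a \<times> 'a) set" where
  "to_loc a \<equiv> fraction R M a \<one>"

lemma to_loc_hom: "to_loc \<in> ring_hom R L"
  by (rule ring_hom_memI) (simp_all add: fraction_mult fraction_add one_loc)

lemma to_loc_eq_iff:
  "a \<in> carrier R \<Longrightarrow> b \<in> carrier R \<Longrightarrow> to_loc a = to_loc b \<longleftrightarrow> (\<exists>u\<in>M. u \<otimes> a = u \<otimes> b)"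
  by (simp add: fraction_eq_iff in_carrier)

lemma to_loc_Units:
  assumes [simp]: "s \<in> M" shows "to_loc s \<in> Units L"
proof -
  note [simp] = in_carrier[OF assms]
  have "fraction R M \<one> s \<otimes>\<^bsub>L\<^esub> to_loc s = \<one>\<^bsub>L\<^esub>" "to_loc s \<otimes>\<^bsub>L\<^esub> fraction R M \<one> s = \<one>\<^bsub>L\<^esub>"
    by (simp_all add: fraction_mult one_loc) (rule fraction_eqI, simp_all)+
  then show ?thesis by (auto simp: Units_def intro!: bexI[of _ "fraction R M \<one> s"])
qed

end

section \<open>Functoriality of localization\<close>

lemma localization_map_fraction:
  assumes "mult_set M R" "mult_set N S" "h \<in> ring_hom R S" "h ` M \<subseteq> N"
    and a: "a \<in> carrier R" "s \<in> M"
  shows "localization_map S N h (fraction R M a s) = fraction S N (h a) (h s)"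
proof -
  interpret R: mult_set M R by fact
  interpret S: mult_set N S by fact
  interpret h: ring_hom_cring R S h
    using assms(3) by unfold_locales
  have "fraction S N (h b) (h t) = fraction S N (h a) (h s)"
    if bt: "(b, t) \<in> fraction R M a s" for b t
  proof -
    note [simp] = R.mem_fraction_eq(1,2)[OF bt a] a R.in_carrier S.in_carrier
    obtain u where u: "u \<in> M" "u \<otimes>\<^bsub>R\<^esub> (a \<otimes>\<^bsub>R\<^esub> t) = u \<otimes>\<^bsub>R\<^esub> (b \<otimes>\<^bsub>R\<^esub> s)"
      using bt by (auto simp: R.mem_fraction_iff)
    have "h u \<otimes>\<^bsub>S\<^esub> (h b \<otimes>\<^bsub>S\<^esub> h s) = h u \<otimes>\<^bsub>S\<^esub> (h a \<otimes>\<^bsub>S\<^esub> h t)"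
      using arg_cong[OF u(2), of h] u(1) by simp
    with assms(4) u(1) show ?thesis
      by (auto simp: S.fraction_eq_iff image_subset_iff)
  qed
  then show ?thesis
    unfolding localization_map_def
    by (intro UN_constant_eq[OF R.mem_fraction_self[OF a]]) (auto simp only: split: prod.split)
qed

lemma localization_map_hom:
  assumes "mult_set M R" "mult_set N S" "h \<in> ring_hom R S" "h ` M \<subseteq> N"
  shows "localization_map S N h \<in> ring_hom (localization R M) (localization S N)"
proof -
  interpret R: mult_set M R by fact
  interpret S: mult_set N S by fact
  interpret h: ring_hom_cring R S h
    using assms(3) by unfold_locales
  note [simp] = localization_map_fraction[OF assms]
  note [simp] = R.in_carrier
  have [simp]: "h s \<in> N" if "s \<in> M" for s using that assms(4) by auto
  show ?thesis
  proof (rule ring_hom_memI)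
    fix x y assume "x \<in> carrier R.L" "y \<in> carrier R.L"
    then obtain a s b t where [simp]: "a \<in> carrier R" "s \<in> M" "s \<in> carrier R"
        "b \<in> carrier R" "t \<in> M" "t \<in> carrier R"
      and "x = fraction R M a s" "y = fraction R M b t"
      by (metis R.loc_cases)
    then show "localization_map S N h (x \<otimes>\<^bsub>R.L\<^esub> y) = localization_map S N h x \<otimes>\<^bsub>S.L\<^esub> localization_map S N h y"
      "localization_map S N h (x \<oplus>\<^bsub>R.L\<^esub> y) = localization_map S N h x \<oplus>\<^bsub>S.L\<^esub> localization_map S N h y"
      "localization_map S N h x \<in> carrier S.L"
      by (simp_all add: R.fraction_mult R.fraction_add S.fraction_mult S.fraction_add)
  qed (simp add: R.one_loc S.one_loc)
qed

section \<open>Sections of the structure sheaf\<close>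

text \<open>An ideal that is maximal among those containing \<open>I\<close> and avoiding
  \<open>M\<close> is prime. For \<open>M = {\<one>}\<close> this yields primes above a proper
  ideal, for the powers of \<open>f\<close> it yields primes at which \<open>f\<close> does not
  vanish.\<close>

lemma (in mult_set) exists_prime_avoiding:
  assumes I: "ideal I R" "I \<inter> M = {}"
  obtains p where "primeideal p R" "I \<subseteq> p" "p \<inter> M = {}"
proof -
  let ?A = "{J. ideal J R \<and> I \<subseteq> J \<and> J \<inter> M = {}}"
  have "\<exists>p\<in>?A. \<forall>J\<in>?A. p \<subseteq> J \<longrightarrow> J = p"
  proof (rule subset_Zorn_nonempty)
    show "?A \<noteq> {}" using I by blast
  next
    fix C assume C: "C \<noteq> {}" "subset.chain ?A C"
    then have CA: "\<And>J. J \<in> C \<Longrightarrow> ideal J R \<and> I \<subseteq> J \<and> J \<inter> M = {}"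
      by (auto simp: subset.chain_def)
    \<comment> \<open>Comparability of the members of the chain enters here: two elements of the
      union lie in a common member, as closure under addition requires.\<close>
    have two: "\<exists>J\<in>C. x \<in> J \<and> y \<in> J" if xy: "x \<in> \<Union>C" "y \<in> \<Union>C" for x y
    proof -
      obtain J K where XY: "J \<in> C" "x \<in> J" "K \<in> C" "y \<in> K"
        using xy by blast
      then have "J \<subseteq> K \<or> K \<subseteq> J"
        using C(2) by (simp add: subset_chain_def)
      then show ?thesis
        using XY by blast
    qed
    have "ideal (\<Union>C) R"
    proof (rule idealI[OF ring_axioms])
      show "subgroup (\<Union>C) (add_monoid R)"
      proof (rule subgroup.intro, goal_cases)
        case 1
        then show ?case
          using CA by (auto dest!: ideal.Icarr)
      next
        case (2 x y)
        then obtain J where J: "J \<in> C" "x \<in> J" "y \<in> J"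
          using two by blast
        interpret J: ideal J R using CA J(1) by blast
        show ?case
          using J J.a_closed by auto
      next
        case 3
        obtain J where J: "J \<in> C"
          using C(1) by blast
        interpret J: ideal J R using CA J by blast
        show ?case
          using J J.zero_closed by (auto intro!: bexI[of _ J])
      next
        case (4 x)
        then obtain J where J: "J \<in> C" "x \<in> J"
          by blast
        interpret J: ideal J R using CA J(1) by blast
        show ?case
          using J J.a_inv_closed by (auto simp: a_inv_def)
      qed
    next
      fix a x assume "a \<in> \<Union>C" "x \<in> carrier R"
      then obtain J where J: "J \<in> C" "a \<in> J"
        by blast
      interpret J: ideal J R using CA J(1) by blast
      show "x \<otimes> a \<in> \<Union>C" "a \<otimes> x \<in> \<Union>C"
        using J.I_l_closed[OF J(2) \<open>x \<in> carrier R\<close>] J.I_r_closed[OF J(2) \<open>x \<in> carrier R\<close>] J(1)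
        by blast+
    qed
    then show "\<Union>C \<in> ?A"
      using C(1) CA by blast
  qed
  then obtain p where p: "ideal p R" "I \<subseteq> p" "p \<inter> M = {}"
    and max: "\<And>J. ideal J R \<Longrightarrow> I \<subseteq> J \<Longrightarrow> J \<inter> M = {} \<Longrightarrow> p \<subseteq> J \<Longrightarrow> J = p"
    by auto
  interpret p: ideal p R by fact
  \<comment> \<open>This is maximality of \<open>p\<close>: adjoining an element outside
    \<open>p\<close> produces an ideal that meets \<open>M\<close>.\<close>
  have meets: "\<exists>x\<in>p. \<exists>r\<in>carrier R. x \<oplus> r \<otimes> a \<in> M" if a: "a \<in> carrier R" "a \<notin> p" for a
  proof -
    let ?J = "set_add R p (PIdl a)"
    have "\<zero> \<in> PIdl a"
      by (rule additive_subgroup.zero_closed[OF ideal.axioms(1)[OF cgenideal_ideal[OF a(1)]]])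
    then have "x \<oplus> \<zero> \<in> ?J" if "x \<in> p" for x
      using that unfolding set_add_def' by blast
    then have sub: "p \<subseteq> ?J"
      using p.Icarr by (metis r_zero subsetI)
    have "\<zero> \<oplus> a \<in> ?J"
      using p.zero_closed cgenideal_self[OF a(1)] unfolding set_add_def' by blast
    then have "a \<in> ?J"
      using a(1) by simp
    with a(2) max[of ?J] sub p(2) have "?J \<inter> M \<noteq> {}"
      using add_ideals[OF p(1) cgenideal_ideal[OF a(1)]] by blast
    then show ?thesis
      by (auto simp: set_add_def' cgenideal_def)
  qed
  have "primeideal p R"
  proof (rule primeidealI[OF p(1) cring_axioms])
    show "carrier R \<noteq> p"
      using p(3) one_in one_closed by blast
    fix a b assume a [simp]: "a \<in> carrier R" and b [simp]: "b \<in> carrier R" and ab: "a \<otimes> b \<in> p"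
    show "a \<in> p \<or> b \<in> p"
    proof (rule ccontr)
      assume "\<not> (a \<in> p \<or> b \<in> p)"
      then obtain x r y s where x: "x \<in> p" and y: "y \<in> p" and [simp]: "r \<in> carrier R" "s \<in> carrier R"
        and M: "x \<oplus> r \<otimes> a \<in> M" "y \<oplus> s \<otimes> b \<in> M"
        using meets a b by meson
      note [simp] = p.Icarr[OF x] p.Icarr[OF y]
      \<comment> \<open>Three of the four terms have a factor \<open>x\<close> or \<open>y\<close>
        in \<open>p\<close>, the fourth has the factor \<open>a b\<close>, which is in
        \<open>p\<close> by assumption.\<close>
      have "(x \<oplus> r \<otimes> a) \<otimes> (y \<oplus> s \<otimes> b) = x \<otimes> (y \<oplus> s \<otimes> b) \<oplus> (r \<otimes> a \<otimes> y \<oplus> r \<otimes> s \<otimes> (a \<otimes> b))"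
        by (simp add: l_distr r_distr m_ac a_ac)
      moreover have "\<dots> \<in> p"
        by (rule p.a_closed[OF p.I_r_closed[OF x] p.a_closed[OF p.I_l_closed[OF y] p.I_l_closed[OF ab]]])
          simp_all
      moreover have "(x \<oplus> r \<otimes> a) \<otimes> (y \<oplus> s \<otimes> b) \<in> M"
        using M by simp
      ultimately show False
        using p(3) by auto
    qed
  qed
  with p that show thesis by blast
qed

section \<open>Germs, vanishing and gluing\<close>

abbreviation germ :: "('a, 'm) ring_scheme \<Rightarrow> 'a set \<Rightarrow> 'a \<Rightarrow> ('a \<times> 'a) set" where
  "germ R p a \<equiv> fraction R (carrier R - p) a \<one>\<^bsub>R\<^esub>"

context cring
begin

lemma mult_set_prime: "p \<in> Spec R \<Longrightarrow> mult_set (carrier R - p) R"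
proof -
  assume "p \<in> Spec R"
  then interpret p: primeideal p R by (simp add: Spec_def)
  have "\<one> \<notin> p"
    using p.one_imp_carrier p.I_notcarr by auto
  then show "mult_set (carrier R - p) R"
    by unfold_locales (use p.I_prime in auto)
qed

lemma mult_set_away: "f \<in> carrier R \<Longrightarrow> mult_set (away R f) R"
  by unfold_locales (auto simp: away_def nat_pow_mult intro: exI[of _ 0] nat_pow_0[symmetric])

lemma Spec_pow:
  assumes "p \<in> Spec R" "f \<in> carrier R" "f \<notin> p"
  shows "f [^] (n::nat) \<notin> p"
proof -
  interpret mult_set "carrier R - p" R by (rule mult_set_prime) fact
  have "f [^] n \<in> carrier R - p"
    by (induction n) (use assms mult_in[of _ f] one_in in auto)
  then show ?thesis by blast
qed

lemma Spec_mult: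
  assumes "p \<in> Spec R" "f \<in> carrier R" "g \<in> carrier R"
  shows "f \<otimes> g \<in> p \<longleftrightarrow> f \<in> p \<or> g \<in> p"
proof -
  interpret primeideal p R using assms(1) by (simp add: Spec_def)
  show ?thesis using assms I_prime I_l_closed I_r_closed by blast
qed

lemma Spec_add:
  assumes "p \<in> Spec R" "f \<in> p" "g \<in> p"
  shows "f \<oplus> g \<in> p"
proof -
  interpret primeideal p R using assms(1) by (simp add: Spec_def)
  show ?thesis using assms by simp
qed

lemma Spec_one: "p \<in> Spec R \<Longrightarrow> \<one> \<notin> p"
  using mult_set.one_in[OF mult_set_prime] by blast

text \<open>If no power of \<open>f\<close> killed \<open>a\<close>, some prime above the
  annihilator of \<open>a\<close> would avoid all powers of \<open>f\<close>. There the germ of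
  \<open>a\<close> is nonzero, because no element outside the prime annihilates
  \<open>a\<close>.\<close>

lemma zero_if_germs_zero:
  assumes [simp]: "a \<in> carrier R" and f: "f \<in> carrier R"
    and germs: "\<And>p. p \<in> Spec R \<Longrightarrow> f \<notin> p \<Longrightarrow> germ R p a = germ R p \<zero>"
  shows "\<exists>n::nat. f [^] n \<otimes> a = \<zero>"
proof (rule ccontr)
  assume no: "\<not> ?thesis"
  interpret mult_set "away R f" R by (rule mult_set_away) fact
  let ?I = "{r \<in> carrier R. r \<otimes> a = \<zero>}"
  have I: "ideal ?I R"
  proof (rule idealI[OF ring_axioms])
    show "subgroup ?I (add_monoid R)"
      by (rule subgroup.intro) (auto simp: l_distr l_minus simp flip: a_inv_def)
    fix r x assume r: "r \<in> ?I" and x: "x \<in> carrier R"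
    then have "x \<otimes> r \<otimes> a = \<zero>"
      by (simp add: m_assoc)
    then show "x \<otimes> r \<in> ?I" "r \<otimes> x \<in> ?I"
      using r x by (simp_all add: m_comm[of r x])
  qed
  moreover have "?I \<inter> away R f = {}"
    using no by (auto simp: away_def)
  ultimately obtain p where p: "primeideal p R" "?I \<subseteq> p" "p \<inter> away R f = {}"
    by (rule exists_prime_avoiding)
  have "f \<in> away R f"
    using f by (auto simp: away_def intro!: exI[of _ 1])
  with p(1,3) germs have "germ R p a = germ R p \<zero>"
    by (auto simp: Spec_def)
  then obtain u where "u \<in> carrier R - p" "u \<otimes> a = u \<otimes> \<zero>"
    using mult_set.to_loc_eq_iff[OF mult_set_prime, of p a \<zero>] p(1) by (auto simp: Spec_def)
  with p(2) show False by auto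
qed

text \<open>The germs over the open set of \<open>f\<close> see only the localization at
  \<open>f\<close>, hence the power of \<open>f\<close> in the conclusion. For
  \<open>f = \<one>\<close> it disappears, which gives \<open>germs_inject\<close>.\<close>

lemma eq_if_germs_eq:
  assumes "a \<in> carrier R" "b \<in> carrier R" and f: "f \<in> carrier R"
    and germs: "\<And>p. p \<in> Spec R \<Longrightarrow> f \<notin> p \<Longrightarrow> germ R p a = germ R p b"
  shows "\<exists>n::nat. f [^] n \<otimes> a = f [^] n \<otimes> b"
proof -
  have "germ R p (a \<ominus> b) = germ R p \<zero>" if p: "p \<in> Spec R" "f \<notin> p" for p
  proof -
    interpret mult_set "carrier R - p" R by (rule mult_set_prime) fact
    obtain u where u: "u \<in> carrier R - p" "u \<otimes> a = u \<otimes> b"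
      using germs[OF p] assms(1,2) to_loc_eq_iff by auto
    then have "u \<otimes> (a \<ominus> b) = u \<otimes> \<zero>"
      using assms(1,2) by (simp add: minus_eq r_distr r_minus r_neg)
    then show ?thesis
      using u(1) assms(1,2) by (subst to_loc_eq_iff) auto
  qed
  then obtain n :: nat where "f [^] n \<otimes> (a \<ominus> b) = \<zero>"
    using zero_if_germs_zero[of "a \<ominus> b" f] assms by auto
  then have "f [^] n \<otimes> a = f [^] n \<otimes> b"
    using assms(1,2) f by (simp add: minus_eq r_distr r_minus) (simp flip: minus_eq)
  then show ?thesis ..
qed

lemma germs_inject:
  assumes "a \<in> carrier R" "b \<in> carrier R" "\<And>p. p \<in> Spec R \<Longrightarrow> germ R p a = germ R p b"
  shows "a = b"
  using eq_if_germs_eq[of a b \<one>] assms by auto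

text \<open>Every monomial of degree \<open>m + n\<close> in \<open>f\<close> and \<open>g\<close>
  is divisible by \<open>f^m\<close> or by \<open>g^n\<close>. The induction splits off one factor
  \<open>f + g\<close> and uses the exponents \<open>(m - 1, n)\<close> for its summand
  \<open>f\<close> and \<open>(m, n - 1)\<close> for its summand \<open>g\<close>.\<close>

lemma power_of_sum:
  assumes [simp]: "f \<in> carrier R" "g \<in> carrier R"
  shows "\<exists>u\<in>carrier R. \<exists>v\<in>carrier R.
    (f \<oplus> g) [^] (m + n) = u \<otimes> f [^] (m::nat) \<oplus> v \<otimes> g [^] (n::nat)"
proof (induction "m + n" arbitrary: m n)
  case 0
  then show ?case by (intro bexI[of _ \<one>] bexI[of _ \<zero>]) auto
next
  case (Suc k)
  show ?case
  proof (cases "m = 0 \<or> n = 0")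
    case True
    then show ?thesis
    proof
      assume "m = 0"
      then show ?thesis
        by (intro bexI[of _ "(f \<oplus> g) [^] n"] bexI[of _ \<zero>]) auto
    next
      assume "n = 0"
      then show ?thesis
        by (intro bexI[of _ \<zero>] bexI[of _ "(f \<oplus> g) [^] m"]) auto
    qed
  next
    case False
    then obtain m' n' where mn: "m = Suc m'" "n = Suc n'"
      by (auto simp: gr0_conv_Suc)
    obtain u v where uv [simp]: "u \<in> carrier R" "v \<in> carrier R"
      and 1: "(f \<oplus> g) [^] (m' + n) = u \<otimes> f [^] m' \<oplus> v \<otimes> g [^] n"
      using Suc.hyps(1)[of m' n] Suc.hyps(2) mn by auto
    obtain u' v' where uv' [simp]: "u' \<in> carrier R" "v' \<in> carrier R"
      and 2: "(f \<oplus> g) [^] (m + n') = u' \<otimes> f [^] m \<oplus> v' \<otimes> g [^] n'"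
      using Suc.hyps(1)[of m n'] Suc.hyps(2) mn by auto
    have k: "m' + n = k" "m + n' = k" "m + n = Suc k"
      using Suc.hyps(2) mn by auto
    have "(f \<oplus> g) [^] (m + n) = f \<otimes> (f \<oplus> g) [^] k \<oplus> g \<otimes> (f \<oplus> g) [^] k"
      unfolding k(3) nat_pow_Suc by (subst m_comm) (simp_all add: l_distr)
    also have "\<dots> = f \<otimes> (u \<otimes> f [^] m' \<oplus> v \<otimes> g [^] n) \<oplus> g \<otimes> (u' \<otimes> f [^] m \<oplus> v' \<otimes> g [^] n')"
      using 1 2 unfolding k by simp
    also have "\<dots> = (u \<otimes> (f [^] m' \<otimes> f) \<oplus> f \<otimes> (v \<otimes> g [^] n)) \<oplus>
        (g \<otimes> (u' \<otimes> f [^] m) \<oplus> v' \<otimes> (g [^] n' \<otimes> g))"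
      by (simp add: r_distr m_ac)
    also have "\<dots> = (u \<oplus> g \<otimes> u') \<otimes> f [^] m \<oplus> (f \<otimes> v \<oplus> v') \<otimes> g [^] n"
      unfolding mn nat_pow_Suc[symmetric] by (simp add: l_distr m_assoc a_ac)
    finally show ?thesis
      by (intro bexI[of _ "u \<oplus> g \<otimes> u'"] bexI[of _ "f \<otimes> v \<oplus> v'"]) auto
  qed
qed

text \<open>The elements \<open>r\<close> over whose open set the section is a single fraction with
  a power of \<open>r\<close> as denominator form an ideal. No prime contains it, since the local
  condition at a prime supplies an element outside that prime; so it contains \<open>\<one>\<close>.
  This takes the place of a finite cover with a partition of unity.\<close>

lemma sections_glue:
  assumes local: "\<And>p. p \<in> Spec R \<Longrightarrow> \<exists>f\<in>carrier R - p. \<exists>c\<in>carrier (localization R (away R f)).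
      \<forall>q\<in>Spec R. f \<notin> q \<longrightarrow> s q = localization_map R (carrier R - q) (\<lambda>x. x) c"
  shows "\<exists>a\<in>carrier R. \<forall>p\<in>Spec R. s p = germ R p a"
proof -
  \<comment> \<open>The denominator is a power of \<open>r\<close> itself, so that the case
    \<open>r = \<one>\<close> ends in an element of the ring.\<close>
  define good where "good r a k \<longleftrightarrow> a \<in> carrier R \<and>
      (\<forall>q\<in>Spec R. r \<notin> q \<longrightarrow> s q = fraction R (carrier R - q) a (r [^] k))" for r a and k :: nat
  let ?J = "{r \<in> carrier R. \<exists>a k. good r a k}"
  have mult: "r \<otimes> t \<in> ?J" if r: "r \<in> ?J" and t: "t \<in> carrier R" for r t
  proof -
    obtain a k where "good r a k"
      using r by blast
    then have ak: "a \<in> carrier R" "r \<in> carrier R"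
      and sq: "\<And>q. q \<in> Spec R \<Longrightarrow> r \<notin> q \<Longrightarrow> s q = fraction R (carrier R - q) a (r [^] k)"
      using r unfolding good_def by blast+
    have "s q = fraction R (carrier R - q) (a \<otimes> t [^] k) ((r \<otimes> t) [^] k)"
      if q: "q \<in> Spec R" and nq: "r \<otimes> t \<notin> q" for q
    proof -
      interpret mult_set "carrier R - q" R by (rule mult_set_prime) fact
      have r: "r \<notin> q"
        using Spec_mult[OF q] nq ak t by blast
      have "r [^] k \<in> carrier R - q" "(r \<otimes> t) [^] k \<in> carrier R - q"
        using Spec_pow[OF q _ r] Spec_pow[OF q _ nq] ak t by auto
      moreover have "a \<otimes> (r \<otimes> t) [^] k = a \<otimes> t [^] k \<otimes> r [^] k"
        using ak t by (simp add: nat_pow_distrib m_ac)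
      ultimately show ?thesis
        unfolding sq[OF q r] using ak t by (intro fraction_eqI) auto
    qed
    then have "good (r \<otimes> t) (a \<otimes> t [^] k) k"
      using ak t by (auto simp: good_def)
    then show ?thesis
      using ak t by auto
  qed
  \<comment> \<open>The open set of \<open>f + g\<close> is covered by those of \<open>f\<close> and
    \<open>g\<close>, and over it the two fractions have to be merged into one.\<close>
  have add: "f \<oplus> g \<in> ?J" if f: "f \<in> ?J" and g: "g \<in> ?J" for f g
  proof -
    obtain a k where "good f a k"
      using f by blast
    then have a [simp]: "a \<in> carrier R" "f \<in> carrier R"
      and sf: "\<And>q. q \<in> Spec R \<Longrightarrow> f \<notin> q \<Longrightarrow> s q = fraction R (carrier R - q) a (f [^] k)"
      using f unfolding good_def by blast+
    obtain b l where "good g b l"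
      using g by blast
    then have b [simp]: "b \<in> carrier R" "g \<in> carrier R"
      and sg: "\<And>q. q \<in> Spec R \<Longrightarrow> g \<notin> q \<Longrightarrow> s q = fraction R (carrier R - q) b (g [^] l)"
      using g unfolding good_def by blast+
    have "germ R q (a \<otimes> g [^] l) = germ R q (b \<otimes> f [^] k)" if q: "q \<in> Spec R" "f \<otimes> g \<notin> q" for q
    proof -
      interpret mult_set "carrier R - q" R by (rule mult_set_prime) fact
      have fg: "f \<notin> q" "g \<notin> q" "f [^] k \<in> carrier R - q" "g [^] l \<in> carrier R - q"
        using Spec_pow[OF q(1)] Spec_mult[OF q(1)] q(2) by auto
      have "fraction R (carrier R - q) a (f [^] k) = fraction R (carrier R - q) b (g [^] l)"
        using sf[OF q(1)] sg[OF q(1)] fg by simp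
      then obtain u where "u \<in> carrier R - q" "u \<otimes> (a \<otimes> g [^] l) = u \<otimes> (b \<otimes> f [^] k)"
        using fraction_eq_iff fg by auto
      then show ?thesis
        by (subst to_loc_eq_iff) auto
    qed
    then obtain M :: nat where M: "(f \<otimes> g) [^] M \<otimes> (a \<otimes> g [^] l) = (f \<otimes> g) [^] M \<otimes> (b \<otimes> f [^] k)"
      using eq_if_germs_eq[of "a \<otimes> g [^] l" "b \<otimes> f [^] k" "f \<otimes> g"] by auto
    \<comment> \<open>Expanding the two fractions by the \<open>M\<close>-th powers of
      \<open>f\<close> and of \<open>g\<close> turns their agreement over the open set of
      \<open>f g\<close> into the exact identity \<open>G a' = F b'\<close> in the ring.\<close>
    define a' F b' G where defs: "a' = f [^] M \<otimes> a" "F = f [^] (M + k)" "b' = g [^] M \<otimes> b" "G = g [^] (M + l)"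
    have [simp]: "a' \<in> carrier R" "F \<in> carrier R" "b' \<in> carrier R" "G \<in> carrier R"
      by (simp_all add: defs)
    have FG: "G \<otimes> a' = F \<otimes> b'"
      using M by (simp add: defs nat_pow_mult[symmetric] nat_pow_distrib m_ac)
    obtain u v where uv [simp]: "u \<in> carrier R" "v \<in> carrier R"
      and pow: "(f \<oplus> g) [^] (M + k + (M + l)) = u \<otimes> F \<oplus> v \<otimes> G"
      using power_of_sum[of f g "M + k" "M + l"] by (auto simp: defs)
    let ?N = "M + k + (M + l)"
    \<comment> \<open>The common denominator is \<open>(f + g)^N = u F + v G\<close>. By
      \<open>FG\<close>, \<open>F c = a' (u F + v G)\<close> and
      \<open>G c = b' (u F + v G)\<close>, so \<open>c\<close> is the numerator for both
      fractions.\<close>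
    let ?c = "u \<otimes> a' \<oplus> v \<otimes> b'"
    have cf: "f [^] M \<otimes> (a \<otimes> (f \<oplus> g) [^] ?N) = f [^] M \<otimes> (?c \<otimes> f [^] k)"
    proof -
      have "f [^] M \<otimes> (a \<otimes> (f \<oplus> g) [^] ?N) = a' \<otimes> (u \<otimes> F \<oplus> v \<otimes> G)"
        unfolding pow by (simp add: defs(1) m_assoc)
      also have "\<dots> = u \<otimes> (F \<otimes> a') \<oplus> v \<otimes> (G \<otimes> a')"
        by (simp add: r_distr m_ac)
      also have "\<dots> = F \<otimes> ?c"
        unfolding FG by (simp add: r_distr m_ac)
      also have "\<dots> = f [^] M \<otimes> (?c \<otimes> f [^] k)"
        by (simp add: defs(2) nat_pow_mult[symmetric] m_ac)
      finally show ?thesis .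
    qed
    have cg: "g [^] M \<otimes> (b \<otimes> (f \<oplus> g) [^] ?N) = g [^] M \<otimes> (?c \<otimes> g [^] l)"
    proof -
      have "g [^] M \<otimes> (b \<otimes> (f \<oplus> g) [^] ?N) = b' \<otimes> (u \<otimes> F \<oplus> v \<otimes> G)"
        unfolding pow by (simp add: defs(3) m_assoc)
      also have "\<dots> = u \<otimes> (F \<otimes> b') \<oplus> v \<otimes> (G \<otimes> b')"
        by (simp add: r_distr m_ac)
      also have "\<dots> = G \<otimes> ?c"
        unfolding FG[symmetric] by (simp add: r_distr m_ac)
      also have "\<dots> = g [^] M \<otimes> (?c \<otimes> g [^] l)"
        by (simp add: defs(4) nat_pow_mult[symmetric] m_ac)
      finally show ?thesis .
    qed
    have "s q = fraction R (carrier R - q) ?c ((f \<oplus> g) [^] ?N)"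
      if q: "q \<in> Spec R" and nq: "f \<oplus> g \<notin> q" for q
    proof -
      interpret mult_set "carrier R - q" R by (rule mult_set_prime) fact
      have N: "(f \<oplus> g) [^] ?N \<in> carrier R - q"
        using Spec_pow[OF q _ nq] by auto
      consider "f \<notin> q" | "g \<notin> q"
        using Spec_add[OF q] nq by blast
      then show ?thesis
      proof cases
        case 1
        then have "f [^] n \<in> carrier R - q" for n :: nat
          using Spec_pow[OF q] by simp
        then show ?thesis
          unfolding sf[OF q 1] using N by (intro fraction_eqI'[OF cf]) auto
      next
        case 2
        then have "g [^] n \<in> carrier R - q" for n :: nat
          using Spec_pow[OF q] by simp
        then show ?thesis
          unfolding sg[OF q 2] using N by (intro fraction_eqI'[OF cg]) auto
      qed
    qed
    then have "good (f \<oplus> g) ?c ?N"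
      by (auto simp: good_def)
    then show ?thesis by auto
  qed
  have J: "ideal ?J R"
  proof (rule idealI[OF ring_axioms])
    show "subgroup ?J (add_monoid R)"
    proof (rule subgroup.intro, goal_cases)
      case 1 then show ?case by auto
    next
      case (2 x y) then show ?case using add[of x y] by simp
    next
      case 3
      \<comment> \<open>Every prime contains \<open>\<zero>\<close>, so the condition is vacuous and
        any numerator would do.\<close>
      have "good \<zero> \<zero> 0"
        using additive_subgroup.zero_closed[OF ideal.axioms(1)[OF primeideal.axioms(1)]]
        by (auto simp: good_def Spec_def)
      then show ?case by auto
    next
      case (4 x)
      then show ?case using mult[of x "\<ominus> \<one>"] by (auto simp: r_minus simp flip: a_inv_def)
    qed
    fix a x assume "a \<in> ?J" "x \<in> carrier R"
    then show "a \<otimes> x \<in> ?J" "x \<otimes> a \<in> ?J"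
      using mult[of a x] by (auto simp: m_comm)
  qed
  have "\<one> \<in> ?J"
  proof (rule ccontr)
    assume no: "\<one> \<notin> ?J"
    \<comment> \<open>For an ideal, avoiding the multiplicative set \<open>{\<one>}\<close> means
      being proper.\<close>
    interpret one: mult_set "{\<one>}" R by unfold_locales auto
    have "?J \<inter> {\<one>} = {}"
      using no by blast
    then obtain p where p: "primeideal p R" "?J \<subseteq> p" "p \<inter> {\<one>} = {}"
      by (rule one.exists_prime_avoiding[OF J])
    then have "p \<in> Spec R"
      by (simp add: Spec_def)
    then obtain f c where f: "f \<in> carrier R" "f \<notin> p" and c: "c \<in> carrier (localization R (away R f))"
      and "\<forall>q\<in>Spec R. f \<notin> q \<longrightarrow> s q = localization_map R (carrier R - q) (\<lambda>x. x) c"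
      using local by blast
    then have sq: "\<And>q. q \<in> Spec R \<Longrightarrow> f \<notin> q \<Longrightarrow> s q = localization_map R (carrier R - q) (\<lambda>x. x) c"
      by blast
    interpret away: mult_set "away R f" R by (rule mult_set_away) fact
    obtain a n where a: "a \<in> carrier R" "c = fraction R (away R f) a (f [^] (n::nat))"
      using c by (rule away.loc_cases) (auto simp: away_def)
    have "s q = fraction R (carrier R - q) a (f [^] n)" if q: "q \<in> Spec R" "f \<notin> q" for q
    proof -
      have "away R f \<subseteq> carrier R - q"
        using Spec_pow[OF q(1) f(1) q(2)] f(1) by (auto simp: away_def)
      then show ?thesis
        using sq[OF q] a f(1)
          localization_map_fraction[OF mult_set_away[OF f(1)] mult_set_prime[OF q(1)], of "\<lambda>x. x" a "f [^] n"]
        by (auto simp: ring_hom_def away_def)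
    qed
    then have "good f a n"
      using a by (auto simp: good_def)
    with f p(2) show False by auto
  qed
  then obtain a k where "good \<one> a k"
    by blast
  then show ?thesis
    using Spec_one by (auto simp: good_def)
qed

end

section \<open>Vectors and cross products\<close>

datatype 'a vec3 = Vec3 (vfst: 'a) (vsnd: 'a) (vthd: 'a)

definition vec3s :: "('a, 'm) ring_scheme \<Rightarrow> 'a vec3 set" where
  "vec3s R = {v. set_vec3 v \<subseteq> carrier R}"

lemma Vec3_in_vec3s [simp]:
  "Vec3 a b c \<in> vec3s R \<longleftrightarrow> a \<in> carrier R \<and> b \<in> carrier R \<and> c \<in> carrier R"
  by (auto simp: vec3s_def)

fun vadd :: "('a, 'm) ring_scheme \<Rightarrow> 'a vec3 \<Rightarrow> 'a vec3 \<Rightarrow> 'a vec3" where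
  "vadd R (Vec3 a b c) (Vec3 a' b' c') = Vec3 (a \<oplus>\<^bsub>R\<^esub> a') (b \<oplus>\<^bsub>R\<^esub> b') (c \<oplus>\<^bsub>R\<^esub> c')"

fun smul :: "('a, 'm) ring_scheme \<Rightarrow> 'a \<Rightarrow> 'a vec3 \<Rightarrow> 'a vec3" where
  "smul R r (Vec3 a b c) = Vec3 (r \<otimes>\<^bsub>R\<^esub> a) (r \<otimes>\<^bsub>R\<^esub> b) (r \<otimes>\<^bsub>R\<^esub> c)"

definition vzero :: "('a, 'm) ring_scheme \<Rightarrow> 'a vec3" where
  "vzero R = Vec3 \<zero>\<^bsub>R\<^esub> \<zero>\<^bsub>R\<^esub> \<zero>\<^bsub>R\<^esub>"

fun cross :: "('a, 'm) ring_scheme \<Rightarrow> 'a vec3 \<Rightarrow> 'a vec3 \<Rightarrow> 'a vec3" where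
  "cross R (Vec3 a b c) (Vec3 a' b' c') =
     Vec3 (b \<otimes>\<^bsub>R\<^esub> c' \<ominus>\<^bsub>R\<^esub> c \<otimes>\<^bsub>R\<^esub> b') (c \<otimes>\<^bsub>R\<^esub> a' \<ominus>\<^bsub>R\<^esub> a \<otimes>\<^bsub>R\<^esub> c') (a \<otimes>\<^bsub>R\<^esub> b' \<ominus>\<^bsub>R\<^esub> b \<otimes>\<^bsub>R\<^esub> a')"

fun dot :: "('a, 'm) ring_scheme \<Rightarrow> 'a vec3 \<Rightarrow> 'a vec3 \<Rightarrow> 'a" where
  "dot R (Vec3 a b c) (Vec3 a' b' c') = a \<otimes>\<^bsub>R\<^esub> a' \<oplus>\<^bsub>R\<^esub> b \<otimes>\<^bsub>R\<^esub> b' \<oplus>\<^bsub>R\<^esub> c \<otimes>\<^bsub>R\<^esub> c'"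

text \<open>The matrix with columns \<open>u\<close>, \<open>v\<close>, \<open>w\<close> applied to
  a coordinate vector.\<close>

fun lcomb :: "('a, 'm) ring_scheme \<Rightarrow> 'a vec3 vec3 \<Rightarrow> 'a vec3 \<Rightarrow> 'a vec3" where
  "lcomb R (Vec3 u v w) (Vec3 a b c) = vadd R (vadd R (smul R a u) (smul R b v)) (smul R c w)"

definition e1 :: "('a, 'm) ring_scheme \<Rightarrow> 'a vec3" where "e1 R = Vec3 \<one>\<^bsub>R\<^esub> \<zero>\<^bsub>R\<^esub> \<zero>\<^bsub>R\<^esub>"
definition e2 :: "('a, 'm) ring_scheme \<Rightarrow> 'a vec3" where "e2 R = Vec3 \<zero>\<^bsub>R\<^esub> \<one>\<^bsub>R\<^esub> \<zero>\<^bsub>R\<^esub>"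
definition e3 :: "('a, 'm) ring_scheme \<Rightarrow> 'a vec3" where "e3 R = Vec3 \<zero>\<^bsub>R\<^esub> \<zero>\<^bsub>R\<^esub> \<one>\<^bsub>R\<^esub>"

text \<open>These are the relations of the standard basis, hence also those of its image under any
  homomorphism of cross products. The zero triple satisfies them too.\<close>

definition cross_triple :: "('a, 'm) ring_scheme \<Rightarrow> 'a vec3 \<Rightarrow> 'a vec3 \<Rightarrow> 'a vec3 \<Rightarrow> bool" where
  "cross_triple R u v w \<longleftrightarrow> u \<in> vec3s R \<and> v \<in> vec3s R \<and> w \<in> vec3s R \<and>
     cross R u v = w \<and> cross R v w = u \<and> cross R w u = v"

text \<open>Orthogonality and equality of the three norms follow from the cyclic relations.
  Prescribing one norm therefore leaves exactly the oriented orthonormal bases, stored as the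
  columns of a matrix in SO_3.\<close>

definition frames :: "('a, 'm) ring_scheme \<Rightarrow> 'a vec3 vec3 set" where
  "frames R = {Vec3 u v w | u v w. cross_triple R u v w \<and> dot R u u = \<one>\<^bsub>R\<^esub>}"

context cring
begin

lemma vec3_closed [simp]:
  "u \<in> vec3s R \<Longrightarrow> v \<in> vec3s R \<Longrightarrow> vadd R u v \<in> vec3s R"
  "r \<in> carrier R \<Longrightarrow> v \<in> vec3s R \<Longrightarrow> smul R r v \<in> vec3s R"
  "u \<in> vec3s R \<Longrightarrow> v \<in> vec3s R \<Longrightarrow> cross R u v \<in> vec3s R"
  "u \<in> vec3s R \<Longrightarrow> v \<in> vec3s R \<Longrightarrow> dot R u v \<in> carrier R"
  "vzero R \<in> vec3s R" "e1 R \<in> vec3s R" "e2 R \<in> vec3s R" "e3 R \<in> vec3s R"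
  by (cases u; cases v; auto simp: vzero_def e1_def e2_def e3_def)+

lemma vadd_comm:
  assumes "u \<in> vec3s R" "v \<in> vec3s R"
  shows "vadd R u v = vadd R v u"
  using assms by (cases u; cases v) (simp add: a_comm)

lemma vadd_assoc:
  assumes "u \<in> vec3s R" "v \<in> vec3s R" "w \<in> vec3s R"
  shows "vadd R (vadd R u v) w = vadd R u (vadd R v w)"
  using assms by (cases u; cases v; cases w) (simp add: a_assoc)

lemma vadd_lcomm:
  assumes "u \<in> vec3s R" "v \<in> vec3s R" "w \<in> vec3s R"
  shows "vadd R u (vadd R v w) = vadd R v (vadd R u w)"
  using assms by (cases u; cases v; cases w) (simp add: a_lcomm)

lemmas vadd_ac = vadd_assoc vadd_comm vadd_lcomm

lemma vadd_zero [simp]: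
  assumes "v \<in> vec3s R"
  shows "vadd R v (vzero R) = v" "vadd R (vzero R) v = v"
  using assms by (cases v; simp add: vzero_def)+

lemma smul_simps [simp]:
  assumes "v \<in> vec3s R"
  shows "smul R \<one> v = v" "smul R \<zero> v = vzero R"
  using assms by (cases v; simp add: vzero_def)+

lemma smul_vzero [simp]: "r \<in> carrier R \<Longrightarrow> smul R r (vzero R) = vzero R"
  by (simp add: vzero_def)

lemma smul_smul:
  assumes "r \<in> carrier R" "s \<in> carrier R" "v \<in> vec3s R"
  shows "smul R r (smul R s v) = smul R (r \<otimes> s) v"
  using assms by (cases v) (simp add: m_assoc)

lemma smul_add:
  assumes "r \<in> carrier R" "u \<in> vec3s R" "v \<in> vec3s R"
  shows "smul R r (vadd R u v) = vadd R (smul R r u) (smul R r v)"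
  using assms by (cases u; cases v) (simp add: r_distr)

lemma add_smul:
  assumes "r \<in> carrier R" "s \<in> carrier R" "v \<in> vec3s R"
  shows "smul R (r \<oplus> s) v = vadd R (smul R r v) (smul R s v)"
  using assms by (cases v) (simp add: l_distr)

lemma cross_add:
  assumes "u \<in> vec3s R" "v \<in> vec3s R" "w \<in> vec3s R"
  shows "cross R (vadd R u v) w = vadd R (cross R u w) (cross R v w)"
    and "cross R w (vadd R u v) = vadd R (cross R w u) (cross R w v)"
  using assms by (cases u; cases v; cases w; clarsimp; intro conjI; algebra)+

lemma cross_smul:
  assumes "r \<in> carrier R" "u \<in> vec3s R" "v \<in> vec3s R"
  shows "cross R (smul R r u) v = smul R r (cross R u v)"
    and "cross R u (smul R r v) = smul R r (cross R u v)"
  using assms by (cases u; cases v; clarsimp; intro conjI; algebra)+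

lemma cross_self:
  assumes "u \<in> vec3s R" shows "cross R u u = vzero R"
  using assms by (cases u; clarsimp simp: vzero_def; intro conjI; algebra)

lemma cross_anticomm:
  assumes "u \<in> vec3s R" "v \<in> vec3s R" shows "cross R v u = smul R (\<ominus> \<one>) (cross R u v)"
  using assms by (cases u; cases v) (simp add: l_minus minus_eq minus_add a_ac m_ac)

lemma cross_vzero [simp]:
  assumes "u \<in> vec3s R" shows "cross R u (vzero R) = vzero R" "cross R (vzero R) u = vzero R"
  using assms by (cases u; clarsimp simp: vzero_def minus_eq)+

lemma dot_comm: "u \<in> vec3s R \<Longrightarrow> v \<in> vec3s R \<Longrightarrow> dot R u v = dot R v u"
  by (cases u; cases v) (simp add: m_comm)

lemma dot_add:
  assumes "u \<in> vec3s R" "v \<in> vec3s R" "w \<in> vec3s R"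
  shows "dot R (vadd R u v) w = dot R u w \<oplus> dot R v w"
    and "dot R w (vadd R u v) = dot R w u \<oplus> dot R w v"
  using assms by (cases u; cases v; cases w; clarsimp; algebra)+

lemma dot_smul:
  assumes "r \<in> carrier R" "u \<in> vec3s R" "v \<in> vec3s R"
  shows "dot R (smul R r u) v = r \<otimes> dot R u v"
    and "dot R u (smul R r v) = r \<otimes> dot R u v"
  using assms by (cases u; cases v; clarsimp; algebra)+

lemma dot_vzero [simp]:
  assumes "u \<in> vec3s R" shows "dot R u (vzero R) = \<zero>" "dot R (vzero R) u = \<zero>"
  using assms by (cases u; clarsimp simp: vzero_def)+

lemma triple_product:
  assumes "u \<in> vec3s R" "v \<in> vec3s R" "w \<in> vec3s R"
  shows "dot R u (cross R v w) = dot R (cross R u v) w"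
  using assms by (cases u; cases v; cases w; clarsimp; algebra)

lemma dot_cross_self:
  assumes "u \<in> vec3s R" "v \<in> vec3s R" shows "dot R u (cross R u v) = \<zero>"
  using assms by (simp add: triple_product cross_self)

text \<open>Grassmann's identity with the subtracted term moved to the left, so that only sums of
  vectors occur.\<close>

lemma cross_cross:
  assumes "u \<in> vec3s R" "v \<in> vec3s R" "w \<in> vec3s R"
  shows "vadd R (cross R u (cross R v w)) (smul R (dot R u v) w) = smul R (dot R u w) v"
  using assms by (cases u; cases v; cases w; clarsimp; intro conjI; algebra)

lemma cross_triple_basis: "cross_triple R (e1 R) (e2 R) (e3 R)"
  by (simp add: cross_triple_def e1_def e2_def e3_def minus_eq)

lemma cross_triple_rotate: "cross_triple R u v w \<Longrightarrow> cross_triple R v w u"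
  by (simp add: cross_triple_def)

section \<open>Triples with cyclic cross products\<close>

context
  fixes u v w
  assumes t: "cross_triple R u v w"
begin

lemma cross_triple_closed: "u \<in> vec3s R" "v \<in> vec3s R" "w \<in> vec3s R"
  using t by (simp_all add: cross_triple_def)

lemma cross_triple_orthogonal: "dot R u v = \<zero>" "dot R u w = \<zero>"
proof -
  note [simp] = cross_triple_closed
  have "dot R u v = dot R (cross R w u) u"
    using t by (simp add: cross_triple_def dot_comm)
  then show "dot R u v = \<zero>"
    by (simp add: triple_product[symmetric] cross_self)
  show "dot R u w = \<zero>"
    using t dot_cross_self[of u v] by (simp add: cross_triple_def)
qed

lemma cross_triple_norm: "dot R v v = dot R u u"
proof -
  note [simp] = cross_triple_closed
  have "dot R v v = dot R v (cross R w u)"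
    using t by (simp add: cross_triple_def)
  also have "\<dots> = dot R (cross R v w) u"
    by (simp add: triple_product)
  finally show ?thesis
    using t by (simp add: cross_triple_def)
qed

text \<open>On the one hand \<open>v \<times> (u \<times> v) = v \<times> w = u\<close>. On the
  other hand Grassmann's identity evaluates the left side as \<open>|v|^2 u\<close>, because
  \<open>v\<close> is orthogonal to \<open>u\<close>, and \<open>|v|^2 = |u|^2\<close>.\<close>

lemma cross_triple_fixed: "smul R (dot R u u) u = u"
proof -
  note [simp] = cross_triple_closed
  have "vadd R (cross R v (cross R u v)) (smul R (dot R v u) v) = smul R (dot R v v) u"
    by (rule cross_cross) simp_all
  then show ?thesis
    using t cross_triple_orthogonal by (simp add: cross_triple_def cross_triple_norm dot_comm)
qed

text \<open>Pair the preceding relation with \<open>u\<close>. Over a connected ring a triple is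
  thus zero or a frame; in general this idempotent records where it is which.\<close>

lemma cross_triple_idem: "dot R u u \<otimes> dot R u u = dot R u u"
proof -
  note [simp] = cross_triple_closed
  have "dot R u u \<otimes> dot R u u = dot R (smul R (dot R u u) u) u"
    by (subst dot_smul) simp_all
  then show ?thesis
    by (simp only: cross_triple_fixed)
qed

end

lemma frame_closed:
  assumes "Vec3 u v w \<in> frames R"
  shows "u \<in> vec3s R" "v \<in> vec3s R" "w \<in> vec3s R"
  using assms by (auto simp: frames_def cross_triple_def)

lemma Vec3_in_frames: "Vec3 u v w \<in> frames R \<longleftrightarrow> cross_triple R u v w \<and> dot R u u = \<one>"
  by (auto simp: frames_def)

end

section \<open>Two by two matrices\<close>

text \<open>The multiplication is that of \<open>mat2_monoid\<close>. The addition is there for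
  averages and for the decomposition of a matrix into a scalar and a vector part.\<close>

definition mat2_ring :: "('a, 'm) ring_scheme \<Rightarrow> 'a mat2 ring" where
  "mat2_ring R =
     \<lparr>carrier = {A. set_mat2 A \<subseteq> carrier R},
      monoid.mult = mat2_mult R,
      one = Mat2 \<one>\<^bsub>R\<^esub> \<zero>\<^bsub>R\<^esub> \<zero>\<^bsub>R\<^esub> \<one>\<^bsub>R\<^esub>,
      ring.zero = Mat2 \<zero>\<^bsub>R\<^esub> \<zero>\<^bsub>R\<^esub> \<zero>\<^bsub>R\<^esub> \<zero>\<^bsub>R\<^esub>,
      ring.add = (\<lambda>A B. case (A, B) of (Mat2 a b c d, Mat2 a' b' c' d') \<Rightarrow>
         Mat2 (a \<oplus>\<^bsub>R\<^esub> a') (b \<oplus>\<^bsub>R\<^esub> b') (c \<oplus>\<^bsub>R\<^esub> c') (d \<oplus>\<^bsub>R\<^esub> d'))\<rparr>"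

lemma Mat2_closed_iff [simp]:
  "Mat2 a b c d \<in> carrier (mat2_ring R) \<longleftrightarrow>
     a \<in> carrier R \<and> b \<in> carrier R \<and> c \<in> carrier R \<and> d \<in> carrier R"
  by (auto simp: mat2_ring_def)

lemma mat2_ring_simps [simp]:
  "Mat2 a b c d \<otimes>\<^bsub>mat2_ring R\<^esub> Mat2 a' b' c' d' = mat2_mult R (Mat2 a b c d) (Mat2 a' b' c' d')"
  "Mat2 a b c d \<oplus>\<^bsub>mat2_ring R\<^esub> Mat2 a' b' c' d' =
     Mat2 (a \<oplus>\<^bsub>R\<^esub> a') (b \<oplus>\<^bsub>R\<^esub> b') (c \<oplus>\<^bsub>R\<^esub> c') (d \<oplus>\<^bsub>R\<^esub> d')"
  "\<one>\<^bsub>mat2_ring R\<^esub> = Mat2 \<one>\<^bsub>R\<^esub> \<zero>\<^bsub>R\<^esub> \<zero>\<^bsub>R\<^esub> \<one>\<^bsub>R\<^esub>"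
  "\<zero>\<^bsub>mat2_ring R\<^esub> = Mat2 \<zero>\<^bsub>R\<^esub> \<zero>\<^bsub>R\<^esub> \<zero>\<^bsub>R\<^esub> \<zero>\<^bsub>R\<^esub>"
  by (simp_all add: mat2_ring_def)

fun mdet :: "('a, 'm) ring_scheme \<Rightarrow> 'a mat2 \<Rightarrow> 'a" where
  "mdet R (Mat2 a b c d) = a \<otimes>\<^bsub>R\<^esub> d \<ominus>\<^bsub>R\<^esub> b \<otimes>\<^bsub>R\<^esub> c"

definition smat :: "('a, 'm) ring_scheme \<Rightarrow> 'a \<Rightarrow> 'a mat2" where
  "smat R a = Mat2 a \<zero>\<^bsub>R\<^esub> \<zero>\<^bsub>R\<^esub> a"

text \<open>Summing \<open>f x q^-1\<close> over corresponding elements of two quaternion groups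
  gives an element that intertwines them. Opposite pairs contribute equal terms, so four terms
  remain, and the minus signs arise because the inverse of an imaginary unit is its negative. Left
  multiplication by \<open>f1\<close> and right multiplication by \<open>q1\<close> produce the same
  four terms.\<close>

lemma (in ring) average_intertwines:
  assumes [simp]: "f1 \<in> carrier R" "f2 \<in> carrier R" "f3 \<in> carrier R"
    "q1 \<in> carrier R" "q2 \<in> carrier R" "q3 \<in> carrier R" "x \<in> carrier R"
    and f: "f1 \<otimes> f1 = \<ominus> \<one>" "f1 \<otimes> f2 = f3" "f1 \<otimes> f3 = \<ominus> f2"
    and q: "q1 \<otimes> q1 = \<ominus> \<one>" "q2 \<otimes> q1 = \<ominus> q3" "q3 \<otimes> q1 = q2"
  shows "f1 \<otimes> (x \<oplus> \<ominus> (f1 \<otimes> x \<otimes> q1) \<oplus> \<ominus> (f2 \<otimes> x \<otimes> q2) \<oplus> \<ominus> (f3 \<otimes> x \<otimes> q3)) =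
    (x \<oplus> \<ominus> (f1 \<otimes> x \<otimes> q1) \<oplus> \<ominus> (f2 \<otimes> x \<otimes> q2) \<oplus> \<ominus> (f3 \<otimes> x \<otimes> q3)) \<otimes> q1"
proof -
  have "f1 \<otimes> (f1 \<otimes> x \<otimes> q1) = \<ominus> (x \<otimes> q1)" "f1 \<otimes> (f2 \<otimes> x \<otimes> q2) = f3 \<otimes> x \<otimes> q2"
    "f1 \<otimes> (f3 \<otimes> x \<otimes> q3) = \<ominus> (f2 \<otimes> x \<otimes> q3)"
    using f by (simp_all add: m_assoc[symmetric] l_minus)
  moreover have "f1 \<otimes> x \<otimes> q1 \<otimes> q1 = \<ominus> (f1 \<otimes> x)" "f2 \<otimes> x \<otimes> q2 \<otimes> q1 = \<ominus> (f2 \<otimes> x \<otimes> q3)"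
    "f3 \<otimes> x \<otimes> q3 \<otimes> q1 = f3 \<otimes> x \<otimes> q2"
    using q by (simp_all add: m_assoc r_minus)
  ultimately show ?thesis
    by (simp add: r_distr l_distr r_minus l_minus a_ac)
qed

context cring
begin

abbreviation "M2 \<equiv> mat2_ring R"

lemma mat2_ring: "ring M2"
proof (rule ringI)
  show "abelian_group M2"
  proof (rule abelian_groupI)
    fix A assume "A \<in> carrier M2"
    then show "\<exists>B\<in>carrier M2. B \<oplus>\<^bsub>M2\<^esub> A = \<zero>\<^bsub>M2\<^esub>"
      by (cases A) (auto simp: l_neg intro!: bexI[of _ "map_mat2 (\<lambda>x. \<ominus> x) A"])
  next
    fix A B assume "A \<in> carrier M2" "B \<in> carrier M2"
    then show "A \<oplus>\<^bsub>M2\<^esub> B \<in> carrier M2" "A \<oplus>\<^bsub>M2\<^esub> B = B \<oplus>\<^bsub>M2\<^esub> A"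
      by (cases A; cases B; simp add: a_ac)+
  next
    fix A B C assume "A \<in> carrier M2" "B \<in> carrier M2" "C \<in> carrier M2"
    then show "A \<oplus>\<^bsub>M2\<^esub> B \<oplus>\<^bsub>M2\<^esub> C = A \<oplus>\<^bsub>M2\<^esub> (B \<oplus>\<^bsub>M2\<^esub> C)"
      by (cases A; cases B; cases C) (simp add: a_ac)
  next
    fix A assume "A \<in> carrier M2"
    then show "\<zero>\<^bsub>M2\<^esub> \<oplus>\<^bsub>M2\<^esub> A = A"
      by (cases A) simp
  qed simp
  show "monoid M2"
  proof (rule monoidI)
    fix A B assume "A \<in> carrier M2" "B \<in> carrier M2"
    then show "A \<otimes>\<^bsub>M2\<^esub> B \<in> carrier M2"
      by (cases A; cases B) simp
  next
    fix A B C assume "A \<in> carrier M2" "B \<in> carrier M2" "C \<in> carrier M2"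
    then show "A \<otimes>\<^bsub>M2\<^esub> B \<otimes>\<^bsub>M2\<^esub> C = A \<otimes>\<^bsub>M2\<^esub> (B \<otimes>\<^bsub>M2\<^esub> C)"
      by (cases A; cases B; cases C; clarsimp; intro conjI; algebra)
  next
    fix A assume "A \<in> carrier M2"
    then show "\<one>\<^bsub>M2\<^esub> \<otimes>\<^bsub>M2\<^esub> A = A" "A \<otimes>\<^bsub>M2\<^esub> \<one>\<^bsub>M2\<^esub> = A"
      by (cases A; simp)+
  qed simp
  fix A B C assume "A \<in> carrier M2" "B \<in> carrier M2" "C \<in> carrier M2"
  then show "(A \<oplus>\<^bsub>M2\<^esub> B) \<otimes>\<^bsub>M2\<^esub> C = A \<otimes>\<^bsub>M2\<^esub> C \<oplus>\<^bsub>M2\<^esub> B \<otimes>\<^bsub>M2\<^esub> C"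
    "C \<otimes>\<^bsub>M2\<^esub> (A \<oplus>\<^bsub>M2\<^esub> B) = C \<otimes>\<^bsub>M2\<^esub> A \<oplus>\<^bsub>M2\<^esub> C \<otimes>\<^bsub>M2\<^esub> B"
    by (cases A; cases B; cases C; clarsimp; intro conjI; algebra)+
qed

interpretation M: ring M2
  by (rule mat2_ring)

lemma mat2_neg:
  assumes "a \<in> carrier R" "b \<in> carrier R" "c \<in> carrier R" "d \<in> carrier R"
  shows "\<ominus>\<^bsub>M2\<^esub> Mat2 a b c d = Mat2 (\<ominus> a) (\<ominus> b) (\<ominus> c) (\<ominus> d)"
  using assms by (intro M.minus_equality) (auto simp: l_neg)

lemma mdet_closed [simp]: "A \<in> carrier M2 \<Longrightarrow> mdet R A \<in> carrier R"
  by (cases A) simp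

lemma mdet_mult:
  assumes "A \<in> carrier M2" "B \<in> carrier M2"
  shows "mdet R (A \<otimes>\<^bsub>M2\<^esub> B) = mdet R A \<otimes> mdet R B"
  using assms by (cases A; cases B; clarsimp; algebra)

lemma smat_closed [simp]: "smat R a \<in> carrier M2 \<longleftrightarrow> a \<in> carrier R"
  by (auto simp: smat_def)

lemma smat_comm:
  assumes "a \<in> carrier R" "A \<in> carrier M2"
  shows "smat R a \<otimes>\<^bsub>M2\<^esub> A = A \<otimes>\<^bsub>M2\<^esub> smat R a"
  using assms by (cases A) (simp add: smat_def m_comm)

lemma smat_mult:
  assumes "a \<in> carrier R" "b \<in> carrier R"
  shows "smat R a \<otimes>\<^bsub>M2\<^esub> smat R b = smat R (a \<otimes> b)"
  using assms by (simp add: smat_def)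

section \<open>Invertible matrices modulo scalars\<close>

lemma mult_mat2_monoid: "A \<otimes>\<^bsub>mat2_monoid R\<^esub> B = A \<otimes>\<^bsub>M2\<^esub> B"
  by (simp add: mat2_monoid_def mat2_ring_def)

lemma mult_GL2: "A \<otimes>\<^bsub>GL2 R\<^esub> B = A \<otimes>\<^bsub>M2\<^esub> B"
  by (simp add: GL2_def units_of_def mult_mat2_monoid)

lemma one_GL2: "\<one>\<^bsub>GL2 R\<^esub> = \<one>\<^bsub>M2\<^esub>"
  by (simp add: GL2_def units_of_def mat2_monoid_def)

lemma monoid_mat2_monoid: "monoid (mat2_monoid R)"
  using M.monoid_axioms unfolding monoid_def
  by (simp add: mat2_monoid_def mat2_ring_def)

lemma carrier_GL2: "carrier (GL2 R) = Units M2"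
  by (simp add: GL2_def units_of_def Units_def mult_mat2_monoid)
    (simp add: mat2_monoid_def mat2_ring_def)

lemma group_GL2: "group (GL2 R)"
  unfolding GL2_def by (rule monoid.units_group[OF monoid_mat2_monoid])

lemma GL2_closed [simp]: "g \<in> carrier (GL2 R) \<Longrightarrow> g \<in> carrier M2"
  unfolding carrier_GL2 by (rule M.Units_closed)

lemma carrier_GL2_iff: "g \<in> carrier (GL2 R) \<longleftrightarrow> g \<in> carrier M2 \<and> mdet R g \<in> Units R"
proof (intro iffI conjI)
  assume g: "g \<in> carrier (GL2 R)"
  then show gM: "g \<in> carrier M2" by simp
  obtain k where k: "k \<in> carrier M2" "g \<otimes>\<^bsub>M2\<^esub> k = \<one>\<^bsub>M2\<^esub>"
    using g unfolding carrier_GL2 Units_def by blast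
  have "mdet R g \<otimes> mdet R k = \<one>"
    unfolding mdet_mult[OF gM k(1), symmetric] k(2) by (simp add: minus_eq)
  then show "mdet R g \<in> Units R"
    using gM k(1) m_comm[of "mdet R g" "mdet R k"] by (force simp: Units_def)
next
  assume g: "g \<in> carrier M2 \<and> mdet R g \<in> Units R"
  obtain a b c d where gd: "g = Mat2 a b c d" and [simp]: "a \<in> carrier R" "b \<in> carrier R" "c \<in> carrier R" "d \<in> carrier R"
    using g by (cases g) auto
  obtain r where r: "r \<in> carrier R" "r \<otimes> (a \<otimes> d \<ominus> b \<otimes> c) = \<one>"
    using g by (auto simp: gd Units_def)
  \<comment> \<open>The adjugate times \<open>r\<close>, the inverse of the determinant.\<close>
  let ?k = "Mat2 (r \<otimes> d) (\<ominus> (r \<otimes> b)) (\<ominus> (r \<otimes> c)) (r \<otimes> a)"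
  have zero: "x \<otimes> (r \<otimes> y) \<ominus> y \<otimes> (r \<otimes> x) = \<zero>" if "x \<in> carrier R" "y \<in> carrier R" for x y
    using that r(1) by algebra
  have "a \<otimes> (r \<otimes> d) \<oplus> b \<otimes> (\<ominus> (r \<otimes> c)) = \<one>" "c \<otimes> (\<ominus> (r \<otimes> b)) \<oplus> d \<otimes> (r \<otimes> a) = \<one>"
    "r \<otimes> d \<otimes> a \<oplus> \<ominus> (r \<otimes> b) \<otimes> c = \<one>" "\<ominus> (r \<otimes> c) \<otimes> b \<oplus> r \<otimes> a \<otimes> d = \<one>"
    unfolding r(2)[symmetric] using r(1) \<open>a \<in> carrier R\<close> \<open>b \<in> carrier R\<close> \<open>c \<in> carrier R\<close> \<open>d \<in> carrier R\<close>
    by algebra+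
  moreover have "a \<otimes> (\<ominus> (r \<otimes> b)) \<oplus> b \<otimes> (r \<otimes> a) = \<zero>" "c \<otimes> (r \<otimes> d) \<oplus> d \<otimes> (\<ominus> (r \<otimes> c)) = \<zero>"
    "r \<otimes> d \<otimes> b \<oplus> \<ominus> (r \<otimes> b) \<otimes> d = \<zero>" "\<ominus> (r \<otimes> c) \<otimes> a \<oplus> r \<otimes> a \<otimes> c = \<zero>"
    using r(1) \<open>a \<in> carrier R\<close> \<open>b \<in> carrier R\<close> \<open>c \<in> carrier R\<close> \<open>d \<in> carrier R\<close>
    by algebra+
  ultimately have "g \<otimes>\<^bsub>M2\<^esub> ?k = \<one>\<^bsub>M2\<^esub>" "?k \<otimes>\<^bsub>M2\<^esub> g = \<one>\<^bsub>M2\<^esub>"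
    by (simp_all add: gd)
  moreover have "?k \<in> carrier M2"
    using r(1) by simp
  ultimately show "g \<in> carrier (GL2 R)"
    using g unfolding carrier_GL2 Units_def by blast
qed

lemma scalar_units_eq: "scalar_units R = smat R ` Units R"
  by (simp add: scalar_units_def smat_def)

text \<open>The determinant is \<open>a a\<close>, and a factor of a unit is a unit.\<close>

lemma smat_GL2_iff: "a \<in> carrier R \<Longrightarrow> smat R a \<in> carrier (GL2 R) \<longleftrightarrow> a \<in> Units R"
  using unit_factor[of a a] by (auto simp: carrier_GL2_iff) (auto simp: smat_def minus_eq)

lemma scalar_units_normal: "scalar_units R \<lhd> GL2 R"
proof -
  interpret G: group "GL2 R" by (rule group_GL2)
  have "subgroup (scalar_units R) (GL2 R)"
  proof (rule G.subgroupI)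
    show "scalar_units R \<subseteq> carrier (GL2 R)"
      unfolding scalar_units_eq using smat_GL2_iff Units_closed by blast
    show "scalar_units R \<noteq> {}"
      by (auto simp: scalar_units_eq)
  next
    fix A assume "A \<in> scalar_units R"
    then obtain a where a: "a \<in> Units R" "A = smat R a"
      by (auto simp: scalar_units_eq)
    have "smat R (inv a) \<otimes>\<^bsub>GL2 R\<^esub> A = \<one>\<^bsub>GL2 R\<^esub>"
      using a by (simp add: mult_GL2 one_GL2 smat_mult Units_closed) (simp add: smat_def)
    then have "inv\<^bsub>GL2 R\<^esub> A = smat R (inv a)"
      using a smat_GL2_iff by (intro G.inv_equality) (auto simp: Units_closed)
    then show "inv\<^bsub>GL2 R\<^esub> A \<in> scalar_units R"
      using a by (auto simp: scalar_units_eq)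
  next
    fix A B assume "A \<in> scalar_units R" "B \<in> scalar_units R"
    then show "A \<otimes>\<^bsub>GL2 R\<^esub> B \<in> scalar_units R"
      by (auto simp: scalar_units_eq mult_GL2 smat_mult Units_closed)
  qed
  moreover have "scalar_units R #>\<^bsub>GL2 R\<^esub> g = g <#\<^bsub>GL2 R\<^esub> scalar_units R" if "g \<in> carrier (GL2 R)" for g
    using that smat_comm[OF Units_closed]
    by (auto simp: r_coset_def l_coset_def scalar_units_eq mult_GL2)
  ultimately show ?thesis
    by (intro G.normalI) auto
qed

definition coset :: "'a mat2 \<Rightarrow> 'a mat2 set" where
  "coset g = scalar_units R #>\<^bsub>GL2 R\<^esub> g"

lemma coset_iff: "k \<in> coset g \<longleftrightarrow> (\<exists>a\<in>Units R. k = smat R a \<otimes>\<^bsub>M2\<^esub> g)"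
  by (auto simp: coset_def r_coset_def scalar_units_eq mult_GL2)

lemma carrier_GL2_mod_Gm: "carrier (GL2_mod_Gm R) = coset ` carrier (GL2 R)"
  by (auto simp: GL2_mod_Gm_def FactGroup_def RCOSETS_def coset_def)

lemma coset_self: "g \<in> carrier (GL2 R) \<Longrightarrow> g \<in> coset g"
proof -
  assume "g \<in> carrier (GL2 R)"
  then have "g = smat R \<one> \<otimes>\<^bsub>M2\<^esub> g"
    unfolding smat_def mat2_ring_simps(3)[symmetric] by (simp only: M.l_one GL2_closed)
  then show "g \<in> coset g"
    unfolding coset_iff by blast
qed

lemma coset_eq:
  assumes "g \<in> carrier (GL2 R)" "k \<in> coset g"
  shows "coset k = coset g"
  using group.repr_independence[OF group_GL2, of k "scalar_units R" g] assms scalar_units_normal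
  by (simp add: coset_def normal_imp_subgroup)

lemma coset_mult:
  assumes "g \<in> carrier (GL2 R)" "k \<in> carrier (GL2 R)"
  shows "coset g \<otimes>\<^bsub>GL2_mod_Gm R\<^esub> coset k = coset (g \<otimes>\<^bsub>M2\<^esub> k)"
  using normal.rcos_sum[OF scalar_units_normal assms]
  by (simp add: coset_def GL2_mod_Gm_def FactGroup_def mult_GL2)

end

section \<open>Functoriality of matrices and cosets\<close>

lemma map_mat2_ring_hom:
  assumes "cring R" "cring S" "h \<in> ring_hom R S"
  shows "map_mat2 h \<in> ring_hom (mat2_ring R) (mat2_ring S)"
proof -
  interpret h: ring_hom_cring R S h
    using assms by (simp add: ring_hom_cring.intro ring_hom_cring_axioms.intro)
  show ?thesis
  proof (rule ring_hom_memI)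
    fix A B assume "A \<in> carrier (mat2_ring R)" "B \<in> carrier (mat2_ring R)"
    then show "map_mat2 h A \<in> carrier (mat2_ring S)"
      "map_mat2 h (A \<otimes>\<^bsub>mat2_ring R\<^esub> B) = map_mat2 h A \<otimes>\<^bsub>mat2_ring S\<^esub> map_mat2 h B"
      "map_mat2 h (A \<oplus>\<^bsub>mat2_ring R\<^esub> B) = map_mat2 h A \<oplus>\<^bsub>mat2_ring S\<^esub> map_mat2 h B"
      by (cases A; cases B; simp)+
  qed simp
qed

lemma ring_hom_Units:
  assumes "cring R" "cring S" "h \<in> ring_hom R S" "a \<in> Units R"
  shows "h a \<in> Units S"
proof -
  interpret h: ring_hom_cring R S h
    using assms by (simp add: ring_hom_cring.intro ring_hom_cring_axioms.intro)
  obtain b where "b \<in> carrier R" "b \<otimes>\<^bsub>R\<^esub> a = \<one>\<^bsub>R\<^esub>" "a \<otimes>\<^bsub>R\<^esub> b = \<one>\<^bsub>R\<^esub>"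
    using assms(4) by (auto simp: Units_def)
  then have "h b \<otimes>\<^bsub>S\<^esub> h a = \<one>\<^bsub>S\<^esub>" "h a \<otimes>\<^bsub>S\<^esub> h b = \<one>\<^bsub>S\<^esub>" "h b \<in> carrier S"
    using h.R.Units_closed[OF assms(4)] by (simp_all flip: h.hom_mult)
  then show ?thesis
    using h.R.Units_closed[OF assms(4)] by (auto simp: Units_def)
qed

lemma map_mat2_GL2:
  assumes "cring R" "cring S" "h \<in> ring_hom R S" "g \<in> carrier (GL2 R)"
  shows "map_mat2 h g \<in> carrier (GL2 S)"
proof -
  interpret h: ring_hom_cring R S h
    using assms by (simp add: ring_hom_cring.intro ring_hom_cring_axioms.intro)
  have "mdet S (map_mat2 h g) = h (mdet R g)"
    using h.R.GL2_closed[OF assms(4)] by (cases g) (simp add: h.R.minus_eq h.S.minus_eq)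
  then show ?thesis
    using assms(4) ring_hom_Units[OF assms(1-3)] ring_hom_closed[OF map_mat2_ring_hom[OF assms(1-3)]]
    by (auto simp: h.R.carrier_GL2_iff h.S.carrier_GL2_iff)
qed

text \<open>The image of a coset is stable only under scalars coming from \<open>R\<close>. The
  factor \<open>scalar_units S\<close> in \<open>GL2_mod_Gm_map\<close> completes it to a full coset
  over \<open>S\<close>.\<close>

lemma GL2_mod_Gm_map_coset:
  assumes "cring R" "cring S" "h \<in> ring_hom R S" "g \<in> carrier (GL2 R)"
  shows "GL2_mod_Gm_map S h (cring.coset R g) = cring.coset S (map_mat2 h g)"
proof -
  interpret R: cring R by fact
  interpret S: cring S by fact
  interpret M: ring "mat2_ring S" by (rule S.mat2_ring)
  interpret h: ring_hom_cring R S h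
    using assms by (simp add: ring_hom_cring.intro ring_hom_cring_axioms.intro)
  have hg: "map_mat2 h g \<in> carrier (GL2 S)"
    by (rule map_mat2_GL2) fact+
  have smat: "map_mat2 h (smat R a \<otimes>\<^bsub>mat2_ring R\<^esub> g) = smat S (h a) \<otimes>\<^bsub>mat2_ring S\<^esub> map_mat2 h g"
    if "a \<in> Units R" for a
    using that ring_hom_mult[OF map_mat2_ring_hom[OF assms(1-3)]] assms(4) R.Units_closed[OF that]
    by (simp add: smat_def)
  have "k \<in> GL2_mod_Gm_map S h (R.coset g) \<longleftrightarrow> k \<in> S.coset (map_mat2 h g)" for k
  proof
    assume "k \<in> GL2_mod_Gm_map S h (R.coset g)"
    then obtain b a where ba: "b \<in> Units S" "a \<in> Units R"
      and "k = smat S b \<otimes>\<^bsub>mat2_ring S\<^esub> map_mat2 h (smat R a \<otimes>\<^bsub>mat2_ring R\<^esub> g)"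
      by (auto simp: GL2_mod_Gm_map_def set_mult_def S.scalar_units_eq S.mult_GL2 R.coset_iff)
    then have k: "k = smat S b \<otimes>\<^bsub>mat2_ring S\<^esub> (smat S (h a) \<otimes>\<^bsub>mat2_ring S\<^esub> map_mat2 h g)"
      by (simp only: smat)
    have ha: "h a \<in> Units S"
      using ba(2) assms ring_hom_Units by metis
    have "k = smat S (b \<otimes>\<^bsub>S\<^esub> h a) \<otimes>\<^bsub>mat2_ring S\<^esub> map_mat2 h g"
      using ba ha hg unfolding k
      by (simp add: M.m_assoc[symmetric] S.smat_mult S.Units_closed)
    then show "k \<in> S.coset (map_mat2 h g)"
      using ba ha by (auto simp: S.coset_iff)
  next
    assume "k \<in> S.coset (map_mat2 h g)"
    then obtain b where b: "b \<in> Units S" "k = smat S b \<otimes>\<^bsub>mat2_ring S\<^esub> map_mat2 h g"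
      by (auto simp: S.coset_iff)
    moreover have "map_mat2 h g \<in> map_mat2 h ` R.coset g"
      using R.coset_self[OF assms(4)] by blast
    ultimately show "k \<in> GL2_mod_Gm_map S h (R.coset g)"
      unfolding GL2_mod_Gm_map_def set_mult_def S.scalar_units_eq S.mult_GL2 by blast
  qed
  then show ?thesis by blast
qed

section \<open>Orthonormal frames and inner automorphisms\<close>

text \<open>This is \<open>-i (a s1 + b s2 + c s3)\<close> with the Pauli matrices
  \<open>s1\<close>, \<open>s2\<close>, \<open>s3\<close>. The factor \<open>-i\<close> makes the
  standard basis vectors quaternion units: their squares are \<open>-1\<close>, and the first times
  the second is the third.\<close>

fun pauli :: "('a, 'm) ring_scheme \<Rightarrow> 'a \<Rightarrow> 'a vec3 \<Rightarrow> 'a mat2" where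
  "pauli R i (Vec3 a b c) =
     Mat2 (\<ominus>\<^bsub>R\<^esub> (i \<otimes>\<^bsub>R\<^esub> c)) (\<ominus>\<^bsub>R\<^esub> (i \<otimes>\<^bsub>R\<^esub> a) \<ominus>\<^bsub>R\<^esub> b) (b \<ominus>\<^bsub>R\<^esub> i \<otimes>\<^bsub>R\<^esub> a) (i \<otimes>\<^bsub>R\<^esub> c)"

text \<open>The scalar and the vector part of a matrix regarded as a quaternion, where
  \<open>h\<close> stands for one half. The scalar part is half the trace.\<close>

fun unpauli :: "('a, 'm) ring_scheme \<Rightarrow> 'a \<Rightarrow> 'a \<Rightarrow> 'a mat2 \<Rightarrow> 'a \<times> 'a vec3" where
  "unpauli R i h (Mat2 p q r s) =
     (h \<otimes>\<^bsub>R\<^esub> (p \<oplus>\<^bsub>R\<^esub> s),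
      Vec3 (h \<otimes>\<^bsub>R\<^esub> i \<otimes>\<^bsub>R\<^esub> (q \<oplus>\<^bsub>R\<^esub> r)) (h \<otimes>\<^bsub>R\<^esub> (r \<ominus>\<^bsub>R\<^esub> q)) (h \<otimes>\<^bsub>R\<^esub> i \<otimes>\<^bsub>R\<^esub> (p \<ominus>\<^bsub>R\<^esub> s)))"

text \<open>The matrices whose conjugation realises the rotation \<open>U\<close> on pure
  quaternions, written without inverses. Over \<open>R\<close> itself the set may be empty; once it
  has a member it is a coset of the scalars.\<close>

definition twist :: "('a, 'm) ring_scheme \<Rightarrow> 'a \<Rightarrow> 'a vec3 vec3 \<Rightarrow> 'a mat2 set" where
  "twist R i U = (case U of Vec3 u v w \<Rightarrow> {g \<in> carrier (GL2 R).
     pauli R i u \<otimes>\<^bsub>mat2_ring R\<^esub> g = g \<otimes>\<^bsub>mat2_ring R\<^esub> pauli R i (e1 R) \<and>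
     pauli R i v \<otimes>\<^bsub>mat2_ring R\<^esub> g = g \<otimes>\<^bsub>mat2_ring R\<^esub> pauli R i (e2 R) \<and>
     pauli R i w \<otimes>\<^bsub>mat2_ring R\<^esub> g = g \<otimes>\<^bsub>mat2_ring R\<^esub> pauli R i (e3 R)})"

text \<open>The square root of \<open>-1\<close> and the half are parameters rather than merely
  assumed to exist, so that a homomorphism can carry them to the constants of its target.\<close>

locale quat_ring = cring +
  fixes i h
  assumes i_closed [simp]: "i \<in> carrier R" and h_closed [simp]: "h \<in> carrier R"
    and i_sq: "i \<otimes> i = \<ominus> \<one>" and h_two: "(\<one> \<oplus> \<one>) \<otimes> h = \<one>"
begin

sublocale M: ring M2
  by (rule mat2_ring)

section \<open>The matrix algebra as a quaternion algebra\<close>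

abbreviation "P \<equiv> pauli R i"

lemma pauli_closed [simp]: "u \<in> vec3s R \<Longrightarrow> P u \<in> carrier M2"
  by (cases u) simp

lemma half_double: "a \<in> carrier R \<Longrightarrow> h \<otimes> (a \<oplus> a) = a"
proof -
  assume a: "a \<in> carrier R"
  then have "h \<otimes> (a \<oplus> a) = (\<one> \<oplus> \<one>) \<otimes> h \<otimes> a"
    using h_closed by algebra
  then show ?thesis
    using a by (simp add: h_two)
qed

lemma pauli_mult:
  assumes "u \<in> vec3s R" "v \<in> vec3s R"
  shows "P u \<otimes>\<^bsub>M2\<^esub> P v = smat R (\<ominus> dot R u v) \<oplus>\<^bsub>M2\<^esub> P (cross R u v)"
proof -
  obtain a b c a' b' c' where uv: "u = Vec3 a b c" "v = Vec3 a' b' c'"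
    by (meson vec3.exhaust)
  have cl: "a \<in> carrier R" "b \<in> carrier R" "c \<in> carrier R" "a' \<in> carrier R" "b' \<in> carrier R" "c' \<in> carrier R"
    using assms by (simp_all add: uv)
  note [simp] = cl
  \<comment> \<open>A polynomial identity with \<open>i\<close> as an indeterminate isolates
    \<open>i i\<close>, which is then replaced by \<open>-1\<close>. The other three entries follow
    the same pattern.\<close>
  have "\<ominus> (i \<otimes> c) \<otimes> \<ominus> (i \<otimes> c') \<oplus> (\<ominus> (i \<otimes> a) \<ominus> b) \<otimes> (b' \<ominus> i \<otimes> a') =
      i \<otimes> i \<otimes> (c \<otimes> c' \<oplus> a \<otimes> a') \<ominus> b \<otimes> b' \<ominus> i \<otimes> (a \<otimes> b' \<ominus> b \<otimes> a')"
    using cl i_closed by algebra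
  also have "\<dots> = \<ominus> (a \<otimes> a' \<oplus> b \<otimes> b' \<oplus> c \<otimes> c') \<oplus> \<ominus> (i \<otimes> (a \<otimes> b' \<ominus> b \<otimes> a'))"
    unfolding i_sq using cl i_closed by algebra
  finally have 1: "\<ominus> (i \<otimes> c) \<otimes> \<ominus> (i \<otimes> c') \<oplus> (\<ominus> (i \<otimes> a) \<ominus> b) \<otimes> (b' \<ominus> i \<otimes> a') =
      \<ominus> (a \<otimes> a' \<oplus> b \<otimes> b' \<oplus> c \<otimes> c') \<oplus> \<ominus> (i \<otimes> (a \<otimes> b' \<ominus> b \<otimes> a'))" .
  have "\<ominus> (i \<otimes> c) \<otimes> (\<ominus> (i \<otimes> a') \<ominus> b') \<oplus> (\<ominus> (i \<otimes> a) \<ominus> b) \<otimes> (i \<otimes> c') =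
      i \<otimes> i \<otimes> (c \<otimes> a' \<ominus> a \<otimes> c') \<ominus> i \<otimes> (b \<otimes> c' \<ominus> c \<otimes> b')"
    using cl i_closed by algebra
  also have "\<dots> = \<zero> \<oplus> (\<ominus> (i \<otimes> (b \<otimes> c' \<ominus> c \<otimes> b')) \<ominus> (c \<otimes> a' \<ominus> a \<otimes> c'))"
    unfolding i_sq using cl i_closed by algebra
  finally have 2: "\<ominus> (i \<otimes> c) \<otimes> (\<ominus> (i \<otimes> a') \<ominus> b') \<oplus> (\<ominus> (i \<otimes> a) \<ominus> b) \<otimes> (i \<otimes> c') =
      \<zero> \<oplus> (\<ominus> (i \<otimes> (b \<otimes> c' \<ominus> c \<otimes> b')) \<ominus> (c \<otimes> a' \<ominus> a \<otimes> c'))" .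
  have "(b \<ominus> i \<otimes> a) \<otimes> \<ominus> (i \<otimes> c') \<oplus> (i \<otimes> c) \<otimes> (b' \<ominus> i \<otimes> a') =
      i \<otimes> i \<otimes> (a \<otimes> c' \<ominus> c \<otimes> a') \<ominus> i \<otimes> (b \<otimes> c' \<ominus> c \<otimes> b')"
    using cl i_closed by algebra
  also have "\<dots> = \<zero> \<oplus> ((c \<otimes> a' \<ominus> a \<otimes> c') \<ominus> i \<otimes> (b \<otimes> c' \<ominus> c \<otimes> b'))"
    unfolding i_sq using cl i_closed by algebra
  finally have 3: "(b \<ominus> i \<otimes> a) \<otimes> \<ominus> (i \<otimes> c') \<oplus> (i \<otimes> c) \<otimes> (b' \<ominus> i \<otimes> a') =
      \<zero> \<oplus> ((c \<otimes> a' \<ominus> a \<otimes> c') \<ominus> i \<otimes> (b \<otimes> c' \<ominus> c \<otimes> b'))" .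
  have "(b \<ominus> i \<otimes> a) \<otimes> (\<ominus> (i \<otimes> a') \<ominus> b') \<oplus> (i \<otimes> c) \<otimes> (i \<otimes> c') =
      i \<otimes> i \<otimes> (c \<otimes> c' \<oplus> a \<otimes> a') \<ominus> b \<otimes> b' \<oplus> i \<otimes> (a \<otimes> b' \<ominus> b \<otimes> a')"
    using cl i_closed by algebra
  also have "\<dots> = \<ominus> (a \<otimes> a' \<oplus> b \<otimes> b' \<oplus> c \<otimes> c') \<oplus> i \<otimes> (a \<otimes> b' \<ominus> b \<otimes> a')"
    unfolding i_sq using cl i_closed by algebra
  finally have 4: "(b \<ominus> i \<otimes> a) \<otimes> (\<ominus> (i \<otimes> a') \<ominus> b') \<oplus> (i \<otimes> c) \<otimes> (i \<otimes> c') =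
      \<ominus> (a \<otimes> a' \<oplus> b \<otimes> b' \<oplus> c \<otimes> c') \<oplus> i \<otimes> (a \<otimes> b' \<ominus> b \<otimes> a')" .
  show ?thesis
    unfolding uv pauli.simps mat2_ring_simps mat2_mult.simps 1 2 3 4 dot.simps cross.simps smat_def ..
qed

lemma unpauli_pauli:
  assumes "a \<in> carrier R" "u \<in> vec3s R"
  shows "unpauli R i h (smat R a \<oplus>\<^bsub>M2\<^esub> P u) = (a, u)"
proof -
  obtain x y z where u: "u = Vec3 x y z"
    by (meson vec3.exhaust)
  have cl: "x \<in> carrier R" "y \<in> carrier R" "z \<in> carrier R" "a \<in> carrier R"
    using assms by (simp_all add: u)
  have 1: "a \<oplus> \<ominus> (i \<otimes> z) \<oplus> (a \<oplus> i \<otimes> z) = a \<oplus> a"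
    using cl i_closed by algebra
  have "h \<otimes> i \<otimes> (\<zero> \<oplus> (\<ominus> (i \<otimes> x) \<ominus> y) \<oplus> (\<zero> \<oplus> (y \<ominus> i \<otimes> x))) = \<ominus> (i \<otimes> i) \<otimes> (h \<otimes> (x \<oplus> x))"
    using cl i_closed h_closed by algebra
  then have 2: "h \<otimes> i \<otimes> (\<zero> \<oplus> (\<ominus> (i \<otimes> x) \<ominus> y) \<oplus> (\<zero> \<oplus> (y \<ominus> i \<otimes> x))) = x"
    using cl by (simp add: i_sq half_double)
  have 3: "\<zero> \<oplus> (y \<ominus> i \<otimes> x) \<ominus> (\<zero> \<oplus> (\<ominus> (i \<otimes> x) \<ominus> y)) = y \<oplus> y"
    using cl i_closed by algebra
  have "h \<otimes> i \<otimes> (a \<oplus> \<ominus> (i \<otimes> z) \<ominus> (a \<oplus> i \<otimes> z)) = \<ominus> (i \<otimes> i) \<otimes> (h \<otimes> (z \<oplus> z))"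
    using cl i_closed h_closed by algebra
  then have 4: "h \<otimes> i \<otimes> (a \<oplus> \<ominus> (i \<otimes> z) \<ominus> (a \<oplus> i \<otimes> z)) = z"
    using cl by (simp add: i_sq half_double)
  show ?thesis
    unfolding u pauli.simps smat_def mat2_ring_simps unpauli.simps 1 2 3 4
    using cl by (simp add: half_double)
qed

lemma pauli_unpauli:
  assumes "A \<in> carrier M2" "unpauli R i h A = (a, u)"
  shows "a \<in> carrier R" "u \<in> vec3s R" "smat R a \<oplus>\<^bsub>M2\<^esub> P u = A"
proof -
  obtain p q r s where A: "A = Mat2 p q r s"
    by (meson mat2.exhaust)
  have cl: "p \<in> carrier R" "q \<in> carrier R" "r \<in> carrier R" "s \<in> carrier R"
    using assms by (simp_all add: A)
  have au: "a = h \<otimes> (p \<oplus> s)"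
    "u = Vec3 (h \<otimes> i \<otimes> (q \<oplus> r)) (h \<otimes> (r \<ominus> q)) (h \<otimes> i \<otimes> (p \<ominus> s))"
    using assms(2) by (simp_all add: A)
  show "a \<in> carrier R" "u \<in> vec3s R"
    using cl by (simp_all add: au)
  have i: "i \<otimes> (h \<otimes> i \<otimes> x) = \<ominus> (h \<otimes> x)" if "x \<in> carrier R" for x
  proof -
    have "i \<otimes> (h \<otimes> i \<otimes> x) = i \<otimes> i \<otimes> (h \<otimes> x)"
      using that i_closed h_closed by algebra
    then show ?thesis
      using that by (simp add: i_sq l_minus)
  qed
  have "h \<otimes> (p \<oplus> s) \<oplus> \<ominus> (\<ominus> (h \<otimes> (p \<ominus> s))) = h \<otimes> (p \<oplus> p)"
    "\<zero> \<oplus> (\<ominus> (\<ominus> (h \<otimes> (q \<oplus> r))) \<ominus> h \<otimes> (r \<ominus> q)) = h \<otimes> (q \<oplus> q)"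
    "\<zero> \<oplus> (h \<otimes> (r \<ominus> q) \<ominus> \<ominus> (h \<otimes> (q \<oplus> r))) = h \<otimes> (r \<oplus> r)"
    "h \<otimes> (p \<oplus> s) \<oplus> \<ominus> (h \<otimes> (p \<ominus> s)) = h \<otimes> (s \<oplus> s)"
    using cl h_closed by algebra+
  then show "smat R a \<oplus>\<^bsub>M2\<^esub> P u = A"
    using cl by (simp add: au A smat_def i half_double)
qed

lemma smat_pauli_inject:
  assumes "a \<in> carrier R" "u \<in> vec3s R" "b \<in> carrier R" "v \<in> vec3s R"
    and "smat R a \<oplus>\<^bsub>M2\<^esub> P u = smat R b \<oplus>\<^bsub>M2\<^esub> P v"
  shows "a = b" "u = v"
proof -
  have "(a, u) = (b, v)"
    by (rule trans[OF unpauli_pauli[OF assms(1,2), unfolded assms(5), symmetric] unpauli_pauli[OF assms(3,4)]])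
  then show "a = b" "u = v"
    by simp_all
qed

lemma smat_zero_add [simp]: "A \<in> carrier M2 \<Longrightarrow> smat R \<zero> \<oplus>\<^bsub>M2\<^esub> A = A"
  using M.l_zero by (simp add: smat_def)

lemma pauli_vzero: "P (vzero R) = smat R \<zero>"
  by (simp add: vzero_def smat_def minus_eq)

lemma pauli_inject:
  assumes "u \<in> vec3s R" "v \<in> vec3s R" "P u = P v"
  shows "u = v"
  using smat_pauli_inject(2)[of \<zero> u \<zero> v] assms by simp

lemma pauli_add:
  assumes "u \<in> vec3s R" "v \<in> vec3s R"
  shows "P (vadd R u v) = P u \<oplus>\<^bsub>M2\<^esub> P v"
  using assms by (cases u; cases v; clarsimp; intro conjI; use i_closed in algebra)

lemma pauli_smul:
  assumes "a \<in> carrier R" "u \<in> vec3s R"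
  shows "P (smul R a u) = smat R a \<otimes>\<^bsub>M2\<^esub> P u"
  using assms by (cases u; clarsimp simp: smat_def; intro conjI; use i_closed in algebra)

lemma pauli_neg:
  assumes "u \<in> vec3s R"
  shows "P (smul R (\<ominus> \<one>) u) = \<ominus>\<^bsub>M2\<^esub> P u"
proof -
  have "smat R (\<ominus> \<one>) = \<ominus>\<^bsub>M2\<^esub> \<one>\<^bsub>M2\<^esub>"
    by (simp add: smat_def mat2_neg)
  then show ?thesis
    using assms by (simp only: pauli_smul a_inv_closed one_closed) (simp only: M.l_minus M.l_one M.one_closed pauli_closed)
qed

lemma frame_basis: "Vec3 (e1 R) (e2 R) (e3 R) \<in> frames R"
  using cross_triple_basis by (simp add: Vec3_in_frames) (simp add: e1_def)

lemma frame_rotate: "Vec3 u v w \<in> frames R \<Longrightarrow> Vec3 v w u \<in> frames R"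
  using cross_triple_norm[of u v w] by (auto simp: Vec3_in_frames intro: cross_triple_rotate)

lemma smat_neg_one: "smat R (\<ominus> \<one>) = \<ominus>\<^bsub>M2\<^esub> \<one>\<^bsub>M2\<^esub>"
  by (simp add: smat_def mat2_neg)

text \<open>The cross product relations and the norm of a frame become the quaternion relations that
  \<open>average_intertwines\<close> requires on either side.\<close>

lemma frame_pauli:
  assumes "Vec3 u v w \<in> frames R"
  shows "P u \<otimes>\<^bsub>M2\<^esub> P u = \<ominus>\<^bsub>M2\<^esub> \<one>\<^bsub>M2\<^esub>" "P u \<otimes>\<^bsub>M2\<^esub> P v = P w" "P u \<otimes>\<^bsub>M2\<^esub> P w = \<ominus>\<^bsub>M2\<^esub> P v"
    "P v \<otimes>\<^bsub>M2\<^esub> P u = \<ominus>\<^bsub>M2\<^esub> P w" "P w \<otimes>\<^bsub>M2\<^esub> P u = P v"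
proof -
  note cl [simp] = frame_closed[OF assms]
  have t: "cross_triple R u v w" and d: "dot R u u = \<one>"
    using assms by (simp_all add: Vec3_in_frames)
  have c: "cross R u v = w" "cross R v w = u" "cross R w u = v"
    using t by (simp_all add: cross_triple_def)
  have c': "cross R v u = smul R (\<ominus> \<one>) w" "cross R u w = smul R (\<ominus> \<one>) v"
    using cross_anticomm[of u v] cross_anticomm[of w u] c by simp_all
  note o = cross_triple_orthogonal[OF t]
  have o': "dot R v u = \<zero>" "dot R w u = \<zero>"
    using o by (simp_all add: dot_comm)
  have add0: "A \<oplus>\<^bsub>M2\<^esub> smat R \<zero> = A" if "A \<in> carrier M2" for A
    using that M.r_zero[OF that] by (simp add: smat_def)
  show "P u \<otimes>\<^bsub>M2\<^esub> P u = \<ominus>\<^bsub>M2\<^esub> \<one>\<^bsub>M2\<^esub>"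
    by (simp only: pauli_mult cl d cross_self pauli_vzero smat_neg_one add0 M.a_inv_closed M.one_closed)
  show "P u \<otimes>\<^bsub>M2\<^esub> P v = P w" "P u \<otimes>\<^bsub>M2\<^esub> P w = \<ominus>\<^bsub>M2\<^esub> P v"
    "P v \<otimes>\<^bsub>M2\<^esub> P u = \<ominus>\<^bsub>M2\<^esub> P w" "P w \<otimes>\<^bsub>M2\<^esub> P u = P v"
    by (simp_all add: pauli_mult o o' c c' pauli_neg)
qed

text \<open>Commuting with the second unit equates the diagonal entries, commuting with the third
  kills the off-diagonal ones because \<open>2 i\<close> is invertible. Two units suffice, their
  product being the remaining one.\<close>

lemma centralizer:
  assumes A: "A \<in> carrier M2"
    and "A \<otimes>\<^bsub>M2\<^esub> P (e2 R) = P (e2 R) \<otimes>\<^bsub>M2\<^esub> A" "A \<otimes>\<^bsub>M2\<^esub> P (e3 R) = P (e3 R) \<otimes>\<^bsub>M2\<^esub> A"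
  shows "\<exists>a\<in>carrier R. A = smat R a"
proof -
  obtain p q r s where Ad: "A = Mat2 p q r s"
    by (meson mat2.exhaust)
  have cl: "p \<in> carrier R" "q \<in> carrier R" "r \<in> carrier R" "s \<in> carrier R"
    using A by (simp_all add: Ad)
  have "A \<otimes>\<^bsub>M2\<^esub> P (e2 R) = Mat2 q (\<ominus> p) s (\<ominus> r)" "P (e2 R) \<otimes>\<^bsub>M2\<^esub> A = Mat2 (\<ominus> r) (\<ominus> s) p q"
    "A \<otimes>\<^bsub>M2\<^esub> P (e3 R) = Mat2 (\<ominus> (p \<otimes> i)) (q \<otimes> i) (\<ominus> (r \<otimes> i)) (s \<otimes> i)"
    "P (e3 R) \<otimes>\<^bsub>M2\<^esub> A = Mat2 (\<ominus> (i \<otimes> p)) (\<ominus> (i \<otimes> q)) (i \<otimes> r) (i \<otimes> s)"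
    using cl by (simp_all add: Ad e2_def e3_def minus_eq l_minus r_minus)
  then have e: "s = p" "q \<otimes> i = \<ominus> (i \<otimes> q)" "\<ominus> (r \<otimes> i) = i \<otimes> r"
    using assms(2,3) by (metis mat2.inject)+
  \<comment> \<open>The assumption says \<open>2 i x = 0\<close>, and \<open>-i h\<close> is the
    inverse of \<open>2 i\<close>.\<close>
  have eq_zero: "x = \<zero>" if "x \<in> carrier R" "i \<otimes> x = \<ominus> (i \<otimes> x)" for x
  proof -
    have "i \<otimes> x \<oplus> i \<otimes> x = \<zero>"
      using that by (metis i_closed m_closed r_neg)
    moreover have "\<ominus> i \<otimes> (h \<otimes> (i \<otimes> x \<oplus> i \<otimes> x)) = \<ominus> (i \<otimes> i) \<otimes> (h \<otimes> (x \<oplus> x))"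
      using that(1) i_closed h_closed by algebra
    ultimately show ?thesis
      using that(1) by (simp add: i_sq half_double)
  qed
  have "q = \<zero>" "r = \<zero>"
    using eq_zero[of q] eq_zero[of r] e(2,3) cl by (simp_all add: m_comm)
  then show ?thesis
    using cl e(1) by (auto simp: Ad smat_def)
qed

section \<open>Matrices implementing a frame by conjugation\<close>

lemma twist_iff:
  "g \<in> twist R i (Vec3 u v w) \<longleftrightarrow> g \<in> carrier (GL2 R) \<and>
     P u \<otimes>\<^bsub>M2\<^esub> g = g \<otimes>\<^bsub>M2\<^esub> P (e1 R) \<and> P v \<otimes>\<^bsub>M2\<^esub> g = g \<otimes>\<^bsub>M2\<^esub> P (e2 R) \<and> P w \<otimes>\<^bsub>M2\<^esub> g = g \<otimes>\<^bsub>M2\<^esub> P (e3 R)"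
  by (simp add: twist_def)

lemma twist_GL2: "g \<in> twist R i U \<Longrightarrow> g \<in> carrier (GL2 R)"
  by (cases U) (simp add: twist_iff)

lemma GL2_cancel:
  assumes "g \<in> carrier (GL2 R)" "A \<in> carrier M2" "B \<in> carrier M2"
  shows "A \<otimes>\<^bsub>M2\<^esub> g = B \<otimes>\<^bsub>M2\<^esub> g \<longleftrightarrow> A = B" "g \<otimes>\<^bsub>M2\<^esub> A = g \<otimes>\<^bsub>M2\<^esub> B \<longleftrightarrow> A = B"
proof -
  have g: "g \<in> Units M2"
    using assms(1) carrier_GL2 by blast
  then show "g \<otimes>\<^bsub>M2\<^esub> A = g \<otimes>\<^bsub>M2\<^esub> B \<longleftrightarrow> A = B"
    using assms by simp
  have "A = B" if "A \<otimes>\<^bsub>M2\<^esub> g = B \<otimes>\<^bsub>M2\<^esub> g"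
  proof -
    have "A \<otimes>\<^bsub>M2\<^esub> g \<otimes>\<^bsub>M2\<^esub> inv\<^bsub>M2\<^esub> g = B \<otimes>\<^bsub>M2\<^esub> g \<otimes>\<^bsub>M2\<^esub> inv\<^bsub>M2\<^esub> g"
      using that by simp
    then show ?thesis
      using assms(2,3) g by (simp only: M.m_assoc M.Units_closed M.Units_inv_closed M.Units_r_inv M.r_one)
  qed
  then show "A \<otimes>\<^bsub>M2\<^esub> g = B \<otimes>\<^bsub>M2\<^esub> g \<longleftrightarrow> A = B"
    by blast
qed

text \<open>Since \<open>g\<close> is invertible, \<open>P u = g (P e1) g^-1\<close> determines
  \<open>u\<close>, and likewise for the other two vectors.\<close>

lemma twist_unique:
  assumes "U \<in> frames R" "V \<in> frames R" "g \<in> twist R i U" "g \<in> twist R i V"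
  shows "U = V"
proof -
  obtain u v w where U: "U = Vec3 u v w" by (cases U)
  obtain u' v' w' where V: "V = Vec3 u' v' w'" by (cases V)
  have g: "g \<in> carrier (GL2 R)"
    using assms(3) by (rule twist_GL2)
  note cl = frame_closed[OF assms(1)[unfolded U]] frame_closed[OF assms(2)[unfolded V]]
  have "P u \<otimes>\<^bsub>M2\<^esub> g = P u' \<otimes>\<^bsub>M2\<^esub> g" "P v \<otimes>\<^bsub>M2\<^esub> g = P v' \<otimes>\<^bsub>M2\<^esub> g" "P w \<otimes>\<^bsub>M2\<^esub> g = P w' \<otimes>\<^bsub>M2\<^esub> g"
    using assms(3,4) by (simp_all add: U V twist_iff)
  then have "P u = P u'" "P v = P v'" "P w = P w'"
    using GL2_cancel(1)[OF g] cl pauli_closed by blast+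
  then show ?thesis
    using pauli_inject cl by (simp add: U V)
qed

text \<open>If \<open>g\<close> and \<open>k\<close> implement the same frame, \<open>g^-1 k\<close>
  commutes with the quaternion units and is a scalar. A frame with an implementing matrix thus
  determines an element of \<open>GL2_mod_Gm\<close> without any choice.\<close>

lemma twist_eq_coset:
  assumes U: "U \<in> frames R" and g: "g \<in> twist R i U"
  shows "twist R i U = coset g"
proof -
  obtain u v w where Ud: "U = Vec3 u v w" by (cases U)
  note cl [simp] = frame_closed[OF U[unfolded Ud]]
  have gG: "g \<in> carrier (GL2 R)"
    using g by (rule twist_GL2)
  then have gM [simp]: "g \<in> carrier M2" and gU: "g \<in> Units M2"
    using carrier_GL2 by auto
  have gi [simp]: "inv\<^bsub>M2\<^esub> g \<in> carrier M2"
    using gU by (rule M.Units_inv_closed)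
  note tg = g[unfolded Ud twist_iff]
  have "k \<in> coset g" if "k \<in> twist R i U" for k
  proof -
    note tk = that[unfolded Ud twist_iff]
    then have kG: "k \<in> carrier (GL2 R)" and kM [simp]: "k \<in> carrier M2"
      by auto
    define z where "z = inv\<^bsub>M2\<^esub> g \<otimes>\<^bsub>M2\<^esub> k"
    have zM [simp]: "z \<in> carrier M2"
      by (simp add: z_def)
    have gz: "g \<otimes>\<^bsub>M2\<^esub> z = k"
      unfolding z_def using gU by (simp only: M.m_assoc[symmetric] gM gi kM M.Units_r_inv M.l_one)
    have comm: "z \<otimes>\<^bsub>M2\<^esub> P e = P e \<otimes>\<^bsub>M2\<^esub> z"
      if "x \<in> vec3s R" "e \<in> vec3s R" "P x \<otimes>\<^bsub>M2\<^esub> g = g \<otimes>\<^bsub>M2\<^esub> P e" "P x \<otimes>\<^bsub>M2\<^esub> k = k \<otimes>\<^bsub>M2\<^esub> P e" for x e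
    proof -
      have "g \<otimes>\<^bsub>M2\<^esub> (z \<otimes>\<^bsub>M2\<^esub> P e) = P x \<otimes>\<^bsub>M2\<^esub> (g \<otimes>\<^bsub>M2\<^esub> z)"
        using that gz by (simp add: M.m_assoc[symmetric])
      also have "\<dots> = g \<otimes>\<^bsub>M2\<^esub> (P e \<otimes>\<^bsub>M2\<^esub> z)"
        using that by (simp add: M.m_assoc[symmetric])
      finally show ?thesis
        using GL2_cancel(2)[OF gG] that by simp
    qed
    obtain a where a: "a \<in> carrier R" "z = smat R a"
      using centralizer[OF zM] comm tg tk cl by auto
    have "z \<in> carrier (GL2 R)"
      using kG gU unfolding carrier_GL2 z_def by simp
    then have "a \<in> Units R"
      using a smat_GL2_iff by simp
    moreover have "k = smat R a \<otimes>\<^bsub>M2\<^esub> g"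
      using gz a smat_comm[of a g] by simp
    ultimately show ?thesis
      by (auto simp: coset_iff)
  qed
  moreover have "smat R a \<otimes>\<^bsub>M2\<^esub> g \<in> twist R i U" if a: "a \<in> Units R" for a
  proof -
    have aR: "a \<in> carrier R" and sa [simp]: "smat R a \<in> carrier M2"
      using a by (simp_all add: Units_closed)
    have "P x \<otimes>\<^bsub>M2\<^esub> (smat R a \<otimes>\<^bsub>M2\<^esub> g) = smat R a \<otimes>\<^bsub>M2\<^esub> g \<otimes>\<^bsub>M2\<^esub> P e"
      if x: "x \<in> vec3s R" "e \<in> vec3s R" "P x \<otimes>\<^bsub>M2\<^esub> g = g \<otimes>\<^bsub>M2\<^esub> P e" for x e
    proof -
      have "P x \<otimes>\<^bsub>M2\<^esub> (smat R a \<otimes>\<^bsub>M2\<^esub> g) = smat R a \<otimes>\<^bsub>M2\<^esub> (P x \<otimes>\<^bsub>M2\<^esub> g)"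
        using x(1) smat_comm[OF aR, of "P x"]
        by (simp only: M.m_assoc[symmetric] pauli_closed sa gM)
      also have "\<dots> = smat R a \<otimes>\<^bsub>M2\<^esub> g \<otimes>\<^bsub>M2\<^esub> P e"
        using x(2) by (simp only: x(3) M.m_assoc pauli_closed sa gM)
      finally show ?thesis .
    qed
    moreover have "smat R a \<otimes>\<^bsub>M2\<^esub> g \<in> carrier (GL2 R)"
      using a gU smat_GL2_iff[OF aR] unfolding carrier_GL2 by simp
    ultimately show ?thesis
      using tg by (simp add: Ud twist_iff)
  qed
  ultimately show ?thesis
    by (auto simp: coset_iff)
qed

lemma twist_lcomb:
  assumes U: "U \<in> frames R" and g: "g \<in> twist R i U" and x: "x \<in> vec3s R"
  shows "P (lcomb R U x) \<otimes>\<^bsub>M2\<^esub> g = g \<otimes>\<^bsub>M2\<^esub> P x"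
proof -
  obtain u v w where Ud: "U = Vec3 u v w" by (cases U)
  obtain a b c where xd: "x = Vec3 a b c" by (cases x)
  note cl [simp] = frame_closed[OF U[unfolded Ud]]
  have [simp]: "a \<in> carrier R" "b \<in> carrier R" "c \<in> carrier R"
    using x by (simp_all add: xd)
  have gM [simp]: "g \<in> carrier M2"
    using twist_GL2[OF g] by simp
  note tg = g[unfolded Ud twist_iff]
  have 1: "smat R r \<otimes>\<^bsub>M2\<^esub> P y \<otimes>\<^bsub>M2\<^esub> g = g \<otimes>\<^bsub>M2\<^esub> (smat R r \<otimes>\<^bsub>M2\<^esub> P e)"
    if y: "r \<in> carrier R" "y \<in> vec3s R" "e \<in> vec3s R" "P y \<otimes>\<^bsub>M2\<^esub> g = g \<otimes>\<^bsub>M2\<^esub> P e" for r y e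
  proof -
    have "smat R r \<otimes>\<^bsub>M2\<^esub> P y \<otimes>\<^bsub>M2\<^esub> g = smat R r \<otimes>\<^bsub>M2\<^esub> g \<otimes>\<^bsub>M2\<^esub> P e"
      using y by (simp add: M.m_assoc)
    then show ?thesis
      using y by (simp add: smat_comm M.m_assoc)
  qed
  have x': "x = lcomb R (Vec3 (e1 R) (e2 R) (e3 R)) x"
    by (simp add: xd e1_def e2_def e3_def)
  have lc: "P (lcomb R (Vec3 y y' y'') x) = smat R a \<otimes>\<^bsub>M2\<^esub> P y \<oplus>\<^bsub>M2\<^esub> smat R b \<otimes>\<^bsub>M2\<^esub> P y' \<oplus>\<^bsub>M2\<^esub> smat R c \<otimes>\<^bsub>M2\<^esub> P y''"
    if "y \<in> vec3s R" "y' \<in> vec3s R" "y'' \<in> vec3s R" for y y' y''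
    using that by (simp add: xd pauli_add pauli_smul)
  have "P (lcomb R U x) \<otimes>\<^bsub>M2\<^esub> g = g \<otimes>\<^bsub>M2\<^esub> P (lcomb R (Vec3 (e1 R) (e2 R) (e3 R)) x)"
    using 1[of a u "e1 R"] 1[of b v "e2 R"] 1[of c w "e3 R"] tg by (simp add: Ud lc M.l_distr M.r_distr)
  then show ?thesis
    by (simp only: x'[symmetric])
qed

text \<open>Conjugation by a product is the composite of the conjugations, so multiplying matrices
  corresponds to composing rotations.\<close>

lemma twist_mult:
  assumes "Vec3 u v w \<in> frames R" "U \<in> frames R" "g \<in> twist R i U" "k \<in> twist R i (Vec3 u v w)"
  shows "g \<otimes>\<^bsub>M2\<^esub> k \<in> twist R i (Vec3 (lcomb R U u) (lcomb R U v) (lcomb R U w))"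
proof -
  note cl = frame_closed[OF assms(1)]
  note tk = assms(4)[unfolded twist_iff]
  have gG: "g \<in> carrier (GL2 R)" and gM [simp]: "g \<in> carrier M2" and kM [simp]: "k \<in> carrier M2"
    using twist_GL2[OF assms(3)] tk by auto
  have lc [simp]: "lcomb R U x \<in> vec3s R" if "x \<in> vec3s R" for x
    using that assms(2) frame_closed by (cases U; cases x) simp
  have "P (lcomb R U x) \<otimes>\<^bsub>M2\<^esub> (g \<otimes>\<^bsub>M2\<^esub> k) = g \<otimes>\<^bsub>M2\<^esub> k \<otimes>\<^bsub>M2\<^esub> P e"
    if x: "x \<in> vec3s R" "e \<in> vec3s R" "P x \<otimes>\<^bsub>M2\<^esub> k = k \<otimes>\<^bsub>M2\<^esub> P e" for x e
  proof -
    have "P (lcomb R U x) \<otimes>\<^bsub>M2\<^esub> (g \<otimes>\<^bsub>M2\<^esub> k) = g \<otimes>\<^bsub>M2\<^esub> P x \<otimes>\<^bsub>M2\<^esub> k"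
      using x(1) twist_lcomb[OF assms(2,3) x(1)] by (simp add: M.m_assoc[symmetric])
    then show ?thesis
      using x by (simp add: M.m_assoc)
  qed
  moreover have "g \<otimes>\<^bsub>M2\<^esub> k \<in> carrier (GL2 R)"
    using gG tk by (simp add: carrier_GL2)
  ultimately show ?thesis
    using cl tk by (simp add: twist_iff)
qed

text \<open>\<open>A\<close> is the conjugate \<open>g (P e) g^-1\<close> and has the trace of
  \<open>P e\<close>, which is zero. Its scalar part, half the trace, therefore vanishes.\<close>

lemma mtrace_zero_pauli:
  assumes "A \<in> carrier M2" "g \<in> carrier (GL2 R)" "e \<in> vec3s R" "A \<otimes>\<^bsub>M2\<^esub> g = g \<otimes>\<^bsub>M2\<^esub> P e"
  shows "\<exists>u\<in>vec3s R. A = P u"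
proof -
  define tr where "tr B = (case B of Mat2 p q r s \<Rightarrow> p \<oplus> s)" for B :: "'a mat2"
  have tr_comm: "tr (B \<otimes>\<^bsub>M2\<^esub> C) = tr (C \<otimes>\<^bsub>M2\<^esub> B)" if "B \<in> carrier M2" "C \<in> carrier M2" for B C
    using that by (cases B; cases C) (simp add: tr_def m_comm a_ac)
  have gU: "g \<in> Units M2"
    using assms(2) carrier_GL2 by blast
  then have cl: "g \<in> carrier M2" "inv\<^bsub>M2\<^esub> g \<in> carrier M2" "P e \<in> carrier M2"
    using assms(3) by auto
  have "A = A \<otimes>\<^bsub>M2\<^esub> g \<otimes>\<^bsub>M2\<^esub> inv\<^bsub>M2\<^esub> g"
    using gU cl assms(1) by (simp only: M.m_assoc M.Units_r_inv M.r_one)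
  also have "\<dots> = g \<otimes>\<^bsub>M2\<^esub> (P e \<otimes>\<^bsub>M2\<^esub> inv\<^bsub>M2\<^esub> g)"
    using cl by (simp only: assms(4) M.m_assoc)
  finally have "tr A = tr (g \<otimes>\<^bsub>M2\<^esub> (P e \<otimes>\<^bsub>M2\<^esub> inv\<^bsub>M2\<^esub> g))"
    by simp
  also have "\<dots> = tr (P e \<otimes>\<^bsub>M2\<^esub> inv\<^bsub>M2\<^esub> g \<otimes>\<^bsub>M2\<^esub> g)"
    using cl by (intro tr_comm) auto
  also have "\<dots> = tr (P e)"
    using gU cl by (simp only: M.m_assoc M.Units_l_inv M.r_one)
  also have "\<dots> = \<zero>"
    using assms(3) by (cases e) (simp add: tr_def l_neg)
  finally have "fst (unpauli R i h A) = \<zero>"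
    using assms(1) by (cases A) (simp add: tr_def)
  then obtain u where "unpauli R i h A = (\<zero>, u)"
    by (metis prod.collapse)
  then show ?thesis
    using pauli_unpauli[OF assms(1)] by (metis pauli_closed smat_zero_add)
qed

text \<open>Conjugation preserves trace zero and products, so the conjugates of the three units are
  pure and satisfy the quaternion relations. Comparing vector parts of products gives the cross
  products, comparing scalar parts of a square gives the norm.\<close>

lemma twist_exists:
  assumes g: "g \<in> carrier (GL2 R)"
  shows "\<exists>U\<in>frames R. g \<in> twist R i U"
proof -
  have gU: "g \<in> Units M2"
    using g carrier_GL2 by blast
  then have [simp]: "g \<in> carrier M2" "inv\<^bsub>M2\<^esub> g \<in> carrier M2"
    by auto
  have ex: "\<exists>u\<in>vec3s R. P u \<otimes>\<^bsub>M2\<^esub> g = g \<otimes>\<^bsub>M2\<^esub> P e" if e: "e \<in> vec3s R" for e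
  proof -
    let ?A = "g \<otimes>\<^bsub>M2\<^esub> P e \<otimes>\<^bsub>M2\<^esub> inv\<^bsub>M2\<^esub> g"
    have "?A \<otimes>\<^bsub>M2\<^esub> g = g \<otimes>\<^bsub>M2\<^esub> P e"
      using e gU by (simp only: M.m_assoc M.Units_l_inv M.r_one pauli_closed M.m_closed M.Units_closed M.Units_inv_closed)
    then show ?thesis
      using mtrace_zero_pauli[of ?A g e] g e by force
  qed
  obtain u v w where cl: "u \<in> vec3s R" "v \<in> vec3s R" "w \<in> vec3s R"
    and eq: "P u \<otimes>\<^bsub>M2\<^esub> g = g \<otimes>\<^bsub>M2\<^esub> P (e1 R)" "P v \<otimes>\<^bsub>M2\<^esub> g = g \<otimes>\<^bsub>M2\<^esub> P (e2 R)" "P w \<otimes>\<^bsub>M2\<^esub> g = g \<otimes>\<^bsub>M2\<^esub> P (e3 R)"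
    using ex by (meson vec3_closed)
  have mult: "P x \<otimes>\<^bsub>M2\<^esub> P y \<otimes>\<^bsub>M2\<^esub> g = g \<otimes>\<^bsub>M2\<^esub> (P e \<otimes>\<^bsub>M2\<^esub> P e')"
    if "x \<in> vec3s R" "y \<in> vec3s R" "e \<in> vec3s R" "e' \<in> vec3s R"
      "P x \<otimes>\<^bsub>M2\<^esub> g = g \<otimes>\<^bsub>M2\<^esub> P e" "P y \<otimes>\<^bsub>M2\<^esub> g = g \<otimes>\<^bsub>M2\<^esub> P e'" for x y e e'
  proof -
    have "P x \<otimes>\<^bsub>M2\<^esub> P y \<otimes>\<^bsub>M2\<^esub> g = P x \<otimes>\<^bsub>M2\<^esub> (g \<otimes>\<^bsub>M2\<^esub> P e')"
      using that by (simp add: M.m_assoc)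
    also have "\<dots> = g \<otimes>\<^bsub>M2\<^esub> P e \<otimes>\<^bsub>M2\<^esub> P e'"
      using that by (simp add: M.m_assoc[symmetric])
    finally show ?thesis
      using that by (simp add: M.m_assoc)
  qed
  note fb = frame_pauli[OF frame_basis] frame_pauli[OF frame_rotate[OF frame_basis]]
    frame_pauli[OF frame_rotate[OF frame_rotate[OF frame_basis]]]
  have mult': "P x \<otimes>\<^bsub>M2\<^esub> P y = P z" "cross R x y = z"
    if "x \<in> vec3s R" "y \<in> vec3s R" "z \<in> vec3s R" "e \<in> vec3s R" "e' \<in> vec3s R" "e'' \<in> vec3s R"
      "P x \<otimes>\<^bsub>M2\<^esub> g = g \<otimes>\<^bsub>M2\<^esub> P e" "P y \<otimes>\<^bsub>M2\<^esub> g = g \<otimes>\<^bsub>M2\<^esub> P e'" "P z \<otimes>\<^bsub>M2\<^esub> g = g \<otimes>\<^bsub>M2\<^esub> P e''"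
      "P e \<otimes>\<^bsub>M2\<^esub> P e' = P e''" for x y z e e' e''
  proof -
    have "P x \<otimes>\<^bsub>M2\<^esub> P y \<otimes>\<^bsub>M2\<^esub> g = P z \<otimes>\<^bsub>M2\<^esub> g"
      using mult[of x y e e'] that by simp
    then show *: "P x \<otimes>\<^bsub>M2\<^esub> P y = P z"
      by (rule iffD1[OF GL2_cancel(1)[OF g], rotated -1]) (simp_all add: that)
    have "smat R (\<ominus> dot R x y) \<oplus>\<^bsub>M2\<^esub> P (cross R x y) = smat R \<zero> \<oplus>\<^bsub>M2\<^esub> P z"
      using that * by (simp only: pauli_mult[symmetric] smat_zero_add pauli_closed)
    then show "cross R x y = z"
      by (rule smat_pauli_inject(2)[rotated 4]) (simp_all add: that)
  qed
  have "cross_triple R u v w"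
    using mult'(2)[of u v w "e1 R" "e2 R" "e3 R"] mult'(2)[of v w u "e2 R" "e3 R" "e1 R"]
      mult'(2)[of w u v "e3 R" "e1 R" "e2 R"] cl eq fb(2,7,12)
    by (simp add: cross_triple_def)
  moreover have "dot R u u = \<one>"
  proof -
    have "P u \<otimes>\<^bsub>M2\<^esub> P u \<otimes>\<^bsub>M2\<^esub> g = \<ominus>\<^bsub>M2\<^esub> \<one>\<^bsub>M2\<^esub> \<otimes>\<^bsub>M2\<^esub> g"
      using mult[of u u "e1 R" "e1 R"] cl eq
      by (simp only: vec3_closed fb(1)) (simp only: M.l_minus M.r_minus M.one_closed M.l_one M.r_one \<open>g \<in> carrier M2\<close>)
    then have "P u \<otimes>\<^bsub>M2\<^esub> P u = smat R (\<ominus> \<one>)"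
      using GL2_cancel(1)[OF g] cl(1) by (simp only: smat_neg_one M.m_closed pauli_closed M.a_inv_closed M.one_closed)
    then have "smat R (\<ominus> dot R u u) \<oplus>\<^bsub>M2\<^esub> P (cross R u u) = smat R (\<ominus> \<one>) \<oplus>\<^bsub>M2\<^esub> P (vzero R)"
      using cl(1) M.r_zero[of "smat R (\<ominus> \<one>)"] by (simp only: pauli_mult[symmetric] pauli_vzero) (simp add: smat_def)
    then have "\<ominus> dot R u u = \<ominus> \<one>"
      by (rule smat_pauli_inject(1)[rotated 4]) (simp_all add: cl)
    then have "\<ominus> (\<ominus> dot R u u) = \<ominus> (\<ominus> \<one>)"
      by simp
    then show ?thesis
      using cl(1) by simp
  qed
  ultimately show ?thesis
    using eq g by (intro bexI[of _ "Vec3 u v w"]) (auto simp: Vec3_in_frames twist_iff)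
qed

section \<open>Averaging over the quaternion group\<close>

definition average :: "'a vec3 vec3 \<Rightarrow> 'a vec3 vec3 \<Rightarrow> 'a mat2 \<Rightarrow> 'a mat2" where
  "average U V x = (case (U, V) of (Vec3 u v w, Vec3 a b c) \<Rightarrow>
     x \<oplus>\<^bsub>M2\<^esub> \<ominus>\<^bsub>M2\<^esub> (P u \<otimes>\<^bsub>M2\<^esub> x \<otimes>\<^bsub>M2\<^esub> P a) \<oplus>\<^bsub>M2\<^esub> \<ominus>\<^bsub>M2\<^esub> (P v \<otimes>\<^bsub>M2\<^esub> x \<otimes>\<^bsub>M2\<^esub> P b)
       \<oplus>\<^bsub>M2\<^esub> \<ominus>\<^bsub>M2\<^esub> (P w \<otimes>\<^bsub>M2\<^esub> x \<otimes>\<^bsub>M2\<^esub> P c))"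

lemma average_closed [simp]:
  assumes "U \<in> frames R" "V \<in> frames R" "x \<in> carrier M2"
  shows "average U V x \<in> carrier M2"
  using assms frame_closed by (cases U; cases V) (simp add: average_def)

text \<open>The average does not change when both frames are permuted cyclically, so the relation
  for the first vectors gives the other two.\<close>

lemma average_intertwines_frames:
  assumes "Vec3 u v w \<in> frames R" "Vec3 a b c \<in> frames R" and x: "x \<in> carrier M2"
  shows "P u \<otimes>\<^bsub>M2\<^esub> average (Vec3 u v w) (Vec3 a b c) x = average (Vec3 u v w) (Vec3 a b c) x \<otimes>\<^bsub>M2\<^esub> P a"
    "P v \<otimes>\<^bsub>M2\<^esub> average (Vec3 u v w) (Vec3 a b c) x = average (Vec3 u v w) (Vec3 a b c) x \<otimes>\<^bsub>M2\<^esub> P b"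
    "P w \<otimes>\<^bsub>M2\<^esub> average (Vec3 u v w) (Vec3 a b c) x = average (Vec3 u v w) (Vec3 a b c) x \<otimes>\<^bsub>M2\<^esub> P c"
proof -
  have 1: "P u \<otimes>\<^bsub>M2\<^esub> average (Vec3 u v w) (Vec3 a b c) x = average (Vec3 u v w) (Vec3 a b c) x \<otimes>\<^bsub>M2\<^esub> P a"
    if "Vec3 u v w \<in> frames R" "Vec3 a b c \<in> frames R" for u v w a b c
    unfolding average_def prod.case vec3.case
    by (rule M.average_intertwines)
      (use x that frame_closed frame_pauli[OF that(1)] frame_pauli[OF that(2)] in \<open>blast intro: pauli_closed\<close>)+
  have rot: "average (Vec3 u v w) (Vec3 a b c) x = average (Vec3 v w u) (Vec3 b c a) x"
    if "Vec3 u v w \<in> frames R" "Vec3 a b c \<in> frames R" for u v w a b c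
    using x frame_closed[OF that(1)] frame_closed[OF that(2)] by (simp add: average_def M.a_ac)
  note r = assms(1,2)[THEN frame_rotate]
  show "P u \<otimes>\<^bsub>M2\<^esub> average (Vec3 u v w) (Vec3 a b c) x = average (Vec3 u v w) (Vec3 a b c) x \<otimes>\<^bsub>M2\<^esub> P a"
    by (rule 1[OF assms(1,2)])
  show "P v \<otimes>\<^bsub>M2\<^esub> average (Vec3 u v w) (Vec3 a b c) x = average (Vec3 u v w) (Vec3 a b c) x \<otimes>\<^bsub>M2\<^esub> P b"
    unfolding rot[OF assms(1,2)] by (rule 1[OF r])
  show "P w \<otimes>\<^bsub>M2\<^esub> average (Vec3 u v w) (Vec3 a b c) x = average (Vec3 u v w) (Vec3 a b c) x \<otimes>\<^bsub>M2\<^esub> P c"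
    unfolding rot[OF assms(1,2)] rot[OF r] by (rule 1[OF r[THEN frame_rotate]])
qed

abbreviation "B \<equiv> Vec3 (e1 R) (e2 R) (e3 R)"

text \<open>The average for \<open>(B, U)\<close> intertwines in the opposite direction, so the
  product of the two averages commutes with the standard units and is a scalar. Its top left entry
  alone decides: if that is a unit, the determinant of \<open>average U B x\<close> divides a
  unit.\<close>

lemma average_twist:
  assumes U: "U \<in> frames R" and xy: "x \<in> carrier M2" "y \<in> carrier M2"
    and unit: "average B U y \<otimes>\<^bsub>M2\<^esub> average U B x = Mat2 p q r s" "p \<in> Units R"
  shows "average U B x \<in> twist R i U"
proof -
  obtain u v w where Ud: "U = Vec3 u v w" by (cases U)
  note cl [simp] = frame_closed[OF U[unfolded Ud]]
  define G where "G = average U B x"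
  define H where "H = average B U y"
  have [simp]: "G \<in> carrier M2" "H \<in> carrier M2"
    using U xy frame_basis by (simp_all add: G_def H_def)
  note G = average_intertwines_frames[OF U[unfolded Ud] frame_basis xy(1), folded Ud, folded G_def]
  note H = average_intertwines_frames[OF frame_basis U[unfolded Ud] xy(2), folded Ud, folded H_def]
  have comm: "H \<otimes>\<^bsub>M2\<^esub> G \<otimes>\<^bsub>M2\<^esub> P e = P e \<otimes>\<^bsub>M2\<^esub> (H \<otimes>\<^bsub>M2\<^esub> G)"
    if "e \<in> vec3s R" "z \<in> vec3s R" "P z \<otimes>\<^bsub>M2\<^esub> G = G \<otimes>\<^bsub>M2\<^esub> P e" "P e \<otimes>\<^bsub>M2\<^esub> H = H \<otimes>\<^bsub>M2\<^esub> P z" for e z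
  proof -
    have "H \<otimes>\<^bsub>M2\<^esub> G \<otimes>\<^bsub>M2\<^esub> P e = H \<otimes>\<^bsub>M2\<^esub> P z \<otimes>\<^bsub>M2\<^esub> G"
      using that(1,2) by (simp add: M.m_assoc that(3)[symmetric])
    then show ?thesis
      using that(1,2) by (simp add: M.m_assoc that(4)[symmetric])
  qed
  obtain a where a: "a \<in> carrier R" "H \<otimes>\<^bsub>M2\<^esub> G = smat R a"
    using centralizer[of "H \<otimes>\<^bsub>M2\<^esub> G"] comm[OF _ _ G(2) H(2)] comm[OF _ _ G(3) H(3)] by auto
  then have "a \<in> Units R"
    using unit by (simp add: G_def H_def smat_def)
  moreover have "mdet R H \<otimes> mdet R G = a \<otimes> a"
    using a mdet_mult[of H G] by (simp add: smat_def minus_eq)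
  ultimately have "mdet R G \<otimes> mdet R H \<in> Units R"
    by (simp add: m_comm)
  then have "mdet R G \<in> Units R"
    by (rule unit_factor) simp_all
  then have "G \<in> carrier (GL2 R)"
    by (simp add: carrier_GL2_iff)
  then have "G \<in> twist R i U"
    using G by (simp add: Ud twist_iff)
  then show ?thesis
    by (simp add: G_def)
qed

text \<open>The two averages below are invertible where \<open>2 (1 + w\<^sub>3)\<close> and where \<open>2 (1 - w\<^sub>3)\<close> are units,
  and these elements add up to \<open>4\<close>.\<close>

lemma twist_nonempty:
  assumes U: "Vec3 u v (Vec3 a b c) \<in> frames R"
  shows "(\<one> \<oplus> \<one>) \<otimes> (\<one> \<oplus> c) \<in> Units R \<Longrightarrow> twist R i (Vec3 u v (Vec3 a b c)) \<noteq> {}"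
    and "(\<one> \<oplus> \<one>) \<otimes> (\<one> \<ominus> c) \<in> Units R \<Longrightarrow> twist R i (Vec3 u v (Vec3 a b c)) \<noteq> {}"
proof -
  let ?U = "Vec3 u v (Vec3 a b c)"
  have cl: "a \<in> carrier R" "b \<in> carrier R" "c \<in> carrier R"
    using frame_closed[OF U] by simp_all
  note [simp] = cl
  obtain u1 u2 u3 v1 v2 v3 where uv: "u = Vec3 u1 u2 u3" "v = Vec3 v1 v2 v3"
    and [simp]: "u1 \<in> carrier R" "u2 \<in> carrier R" "u3 \<in> carrier R"
      "v1 \<in> carrier R" "v2 \<in> carrier R" "v3 \<in> carrier R"
    using frame_closed[OF U] by (cases u; cases v) auto
  have norm: "a \<otimes> a \<oplus> b \<otimes> b \<oplus> c \<otimes> c = \<one>"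
    using frame_rotate[OF frame_rotate[OF U]] by (simp add: Vec3_in_frames)
  have i_i: "i \<otimes> (i \<otimes> x) = \<ominus> x" if "x \<in> carrier R" for x
    using that by (simp add: m_assoc[symmetric] i_sq l_minus)
  note ev = average_def uv e1_def e2_def e3_def mat2_neg minus_eq l_minus r_minus i_sq i_i
  \<comment> \<open>Averages of matrix units have short entries. With \<open>?E\<close> in both
    places the top left entry of the product is \<open>2 (1 + c)\<close>, with \<open>?E'\<close>
    and \<open>?E''\<close> it is \<open>2 (1 - c)\<close>.\<close>
  let ?E = "Mat2 \<one> \<zero> \<zero> \<zero>" and ?E' = "Mat2 \<zero> \<zero> \<one> \<zero>" and ?E'' = "Mat2 \<zero> \<one> \<zero> \<zero>"
  {
    assume unit: "(\<one> \<oplus> \<one>) \<otimes> (\<one> \<oplus> c) \<in> Units R"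
    \<comment> \<open>The top left entry of the product needs only the top row of the left factor
      and the left column of the right one; the other entries remain anonymous.\<close>
    have "\<exists>q s. average ?U B ?E = Mat2 (\<one> \<oplus> c) q (a \<oplus> i \<otimes> b) s"
      by (simp add: ev) (simp add: a_ac m_ac r_distr r_minus i_sq i_i)
    moreover have "\<exists>r s. average B ?U ?E = Mat2 (\<one> \<oplus> c) (a \<ominus> i \<otimes> b) r s"
      by (simp add: ev) (simp add: a_ac m_ac r_distr r_minus i_sq i_i)
    moreover have "(\<one> \<oplus> c) \<otimes> (\<one> \<oplus> c) \<oplus> (a \<ominus> i \<otimes> b) \<otimes> (a \<oplus> i \<otimes> b) = (\<one> \<oplus> \<one>) \<otimes> (\<one> \<oplus> c)"
    proof -
      have "(\<one> \<oplus> c) \<otimes> (\<one> \<oplus> c) \<oplus> (a \<ominus> i \<otimes> b) \<otimes> (a \<oplus> i \<otimes> b) =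
          \<one> \<oplus> c \<oplus> c \<oplus> (a \<otimes> a \<ominus> i \<otimes> i \<otimes> (b \<otimes> b) \<oplus> c \<otimes> c)"
        using cl i_closed by algebra
      also have "\<dots> = \<one> \<oplus> c \<oplus> c \<oplus> \<one>"
        unfolding norm[symmetric] using cl by (simp add: i_sq l_minus minus_eq)
      also have "\<dots> = (\<one> \<oplus> \<one>) \<otimes> (\<one> \<oplus> c)"
        using cl by algebra
      finally show ?thesis .
    qed
    ultimately have "\<exists>q r s. average B ?U ?E \<otimes>\<^bsub>M2\<^esub> average ?U B ?E = Mat2 ((\<one> \<oplus> \<one>) \<otimes> (\<one> \<oplus> c)) q r s"
      by auto
    then show "twist R i ?U \<noteq> {}"
      using average_twist[OF U, of ?E ?E] unit by auto
  }
  {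
    assume unit: "(\<one> \<oplus> \<one>) \<otimes> (\<one> \<ominus> c) \<in> Units R"
    have "\<exists>q s. average ?U B ?E' = Mat2 (a \<ominus> i \<otimes> b) q (\<one> \<ominus> c) s"
      by (simp add: ev) (simp add: a_ac m_ac r_distr r_minus i_sq i_i)
    moreover have "\<exists>r s. average B ?U ?E'' = Mat2 (a \<oplus> i \<otimes> b) (\<one> \<ominus> c) r s"
      by (simp add: ev) (simp add: a_ac m_ac r_distr r_minus i_sq i_i)
    moreover have "(a \<oplus> i \<otimes> b) \<otimes> (a \<ominus> i \<otimes> b) \<oplus> (\<one> \<ominus> c) \<otimes> (\<one> \<ominus> c) = (\<one> \<oplus> \<one>) \<otimes> (\<one> \<ominus> c)"
    proof -
      have "(a \<oplus> i \<otimes> b) \<otimes> (a \<ominus> i \<otimes> b) \<oplus> (\<one> \<ominus> c) \<otimes> (\<one> \<ominus> c) =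
          \<one> \<ominus> c \<ominus> c \<oplus> (a \<otimes> a \<ominus> i \<otimes> i \<otimes> (b \<otimes> b) \<oplus> c \<otimes> c)"
        using cl i_closed by algebra
      also have "\<dots> = \<one> \<ominus> c \<ominus> c \<oplus> \<one>"
        unfolding norm[symmetric] using cl by (simp add: i_sq l_minus minus_eq)
      also have "\<dots> = (\<one> \<oplus> \<one>) \<otimes> (\<one> \<ominus> c)"
        using cl by algebra
      finally show ?thesis .
    qed
    ultimately have "\<exists>q r s. average B ?U ?E'' \<otimes>\<^bsub>M2\<^esub> average ?U B ?E' = Mat2 ((\<one> \<oplus> \<one>) \<otimes> (\<one> \<ominus> c)) q r s"
      by auto
    then show "twist R i ?U \<noteq> {}"
      using average_twist[OF U, of ?E' ?E''] unit by auto
  }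
qed

end

section \<open>Frames and sections of the sheaf \<open>PGL\<^sub>2\<close>\<close>

text \<open>The product of the two matrices of columns.\<close>

fun fcomp :: "('a, 'm) ring_scheme \<Rightarrow> 'a vec3 vec3 \<Rightarrow> 'a vec3 vec3 \<Rightarrow> 'a vec3 vec3" where
  "fcomp R U (Vec3 u v w) = Vec3 (lcomb R U u) (lcomb R U v) (lcomb R U w)"

text \<open>An idempotent \<open>e\<close> splits the ring into the part where it is
  \<open>0\<close> and the part where it is \<open>1\<close>. The blend is \<open>u\<close> over the
  former and \<open>v\<close> over the latter.\<close>

definition vblend :: "('a, 'm) ring_scheme \<Rightarrow> 'a \<Rightarrow> 'a vec3 \<Rightarrow> 'a vec3 \<Rightarrow> 'a vec3" where
  "vblend R e u v = vadd R (smul R (\<one>\<^bsub>R\<^esub> \<ominus>\<^bsub>R\<^esub> e) u) (smul R e v)"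

fun fblend :: "('a, 'm) ring_scheme \<Rightarrow> 'a \<Rightarrow> 'a vec3 vec3 \<Rightarrow> 'a vec3 vec3 \<Rightarrow> 'a vec3 vec3" where
  "fblend R e (Vec3 u v w) (Vec3 u' v' w') = Vec3 (vblend R e u u') (vblend R e v v') (vblend R e w w')"

abbreviation fmap :: "('a \<Rightarrow> 'b) \<Rightarrow> 'a vec3 vec3 \<Rightarrow> 'b vec3 vec3" where
  "fmap f \<equiv> map_vec3 (map_vec3 f)"

context cring
begin

section \<open>Rotations of vectors and composition of frames\<close>

lemma lcomb_closed [simp]:
  assumes "U \<in> frames R" "x \<in> vec3s R" shows "lcomb R U x \<in> vec3s R"
  using assms frame_closed by (cases U; cases x) simp

lemma lcomb_vadd:
  assumes "U \<in> frames R" "x \<in> vec3s R" "y \<in> vec3s R"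
  shows "lcomb R U (vadd R x y) = vadd R (lcomb R U x) (lcomb R U y)"
  using assms frame_closed by (cases U; cases x; cases y) (simp add: add_smul vadd_ac)

lemma lcomb_smul:
  assumes "U \<in> frames R" "r \<in> carrier R" "x \<in> vec3s R"
  shows "lcomb R U (smul R r x) = smul R r (lcomb R U x)"
  using assms frame_closed by (cases U; cases x) (simp add: smul_add smul_smul)

text \<open>Bilinearity reduces the left side to cross products of the frame vectors. What remains
  is the scalar identity \<open>coord\<close>, applied in each of the three coordinates.\<close>

lemma lcomb_cross:
  assumes U: "U \<in> frames R" and xy: "x \<in> vec3s R" "y \<in> vec3s R"
  shows "cross R (lcomb R U x) (lcomb R U y) = lcomb R U (cross R x y)"
proof -
  obtain u v w where Ud: "U = Vec3 u v w" by (cases U)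
  obtain a b c a' b' c' where xyd: "x = Vec3 a b c" "y = Vec3 a' b' c'" by (meson vec3.exhaust)
  note cl [simp] = frame_closed[OF U[unfolded Ud]]
  have [simp]: "a \<in> carrier R" "b \<in> carrier R" "c \<in> carrier R" "a' \<in> carrier R" "b' \<in> carrier R" "c' \<in> carrier R"
    using xy by (simp_all add: xyd)
  have t: "cross R u v = w" "cross R v w = u" "cross R w u = v"
    using U by (auto simp: Ud Vec3_in_frames cross_triple_def)
  have t': "cross R v u = smul R (\<ominus> \<one>) w" "cross R w v = smul R (\<ominus> \<one>) u" "cross R u w = smul R (\<ominus> \<one>) v"
    using cross_anticomm[of u v] cross_anticomm[of v w] cross_anticomm[of w u] t by simp_all
  have "cross R (lcomb R U x) (lcomb R U y) =
      vadd R (vadd R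
        (vadd R (smul R a' (smul R b (smul R (\<ominus> \<one>) w))) (smul R a' (smul R c v)))
        (vadd R (smul R b' (smul R a w)) (smul R b' (smul R c (smul R (\<ominus> \<one>) u)))))
        (vadd R (smul R c' (smul R a (smul R (\<ominus> \<one>) v))) (smul R c' (smul R b u)))"
    by (simp add: Ud xyd cross_add cross_smul smul_add t t' cross_self)
  also have "\<dots> = lcomb R U (cross R x y)"
  proof -
    have coord: "a' \<otimes> (b \<otimes> (\<ominus> \<one> \<otimes> r)) \<oplus> a' \<otimes> (c \<otimes> q) \<oplus> (b' \<otimes> (a \<otimes> r) \<oplus> b' \<otimes> (c \<otimes> (\<ominus> \<one> \<otimes> p))) \<oplus>
        (c' \<otimes> (a \<otimes> (\<ominus> \<one> \<otimes> q)) \<oplus> c' \<otimes> (b \<otimes> p)) =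
        (b \<otimes> c' \<ominus> c \<otimes> b') \<otimes> p \<oplus> (c \<otimes> a' \<ominus> a \<otimes> c') \<otimes> q \<oplus> (a \<otimes> b' \<ominus> b \<otimes> a') \<otimes> r"
      if [simp]: "p \<in> carrier R" "q \<in> carrier R" "r \<in> carrier R" for p q r
    proof -
      have neg: "\<ominus> \<one> \<otimes> z = \<ominus> z" if "z \<in> carrier R" for z
        using that by (simp add: l_minus)
      show ?thesis
        unfolding neg[OF that(1)] neg[OF that(2)] neg[OF that(3)]
        using that \<open>a \<in> carrier R\<close> \<open>b \<in> carrier R\<close> \<open>c \<in> carrier R\<close>
          \<open>a' \<in> carrier R\<close> \<open>b' \<in> carrier R\<close> \<open>c' \<in> carrier R\<close>
        by algebra
    qed
    obtain u1 u2 u3 v1 v2 v3 w1 w2 w3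
      where uvw: "u = Vec3 u1 u2 u3" "v = Vec3 v1 v2 v3" "w = Vec3 w1 w2 w3"
      by (meson vec3.exhaust)
    then show ?thesis
      using cl unfolding Ud uvw xyd lcomb.simps smul.simps vadd.simps cross.simps vec3.inject Vec3_in_vec3s
      by (intro conjI coord) simp_all
  qed
  finally show ?thesis .
qed

lemma lcomb_dot:
  assumes U: "U \<in> frames R" and xy: "x \<in> vec3s R" "y \<in> vec3s R"
  shows "dot R (lcomb R U x) (lcomb R U y) = dot R x y"
proof -
  obtain u v w where Ud: "U = Vec3 u v w" by (cases U)
  obtain a b c a' b' c' where xyd: "x = Vec3 a b c" "y = Vec3 a' b' c'" by (meson vec3.exhaust)
  note cl [simp] = frame_closed[OF U[unfolded Ud]]
  have [simp]: "a \<in> carrier R" "b \<in> carrier R" "c \<in> carrier R" "a' \<in> carrier R" "b' \<in> carrier R" "c' \<in> carrier R"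
    using xy by (simp_all add: xyd)
  have t: "cross_triple R u v w" and n: "dot R u u = \<one>"
    using U by (auto simp: Ud Vec3_in_frames)
  note t' = cross_triple_rotate[OF t] and t'' = cross_triple_rotate[OF cross_triple_rotate[OF t]]
  have n': "dot R v v = \<one>" "dot R w w = \<one>"
    using cross_triple_norm[OF t] cross_triple_norm[OF t'] n by simp_all
  show ?thesis
    by (simp add: Ud xyd dot_add dot_smul n n' cross_triple_orthogonal[OF t]
        cross_triple_orthogonal[OF t'] cross_triple_orthogonal[OF t''] m_comm)
qed

lemma fcomp_frames:
  assumes "U \<in> frames R" "V \<in> frames R"
  shows "fcomp R U V \<in> frames R"
proof -
  obtain u v w where V: "V = Vec3 u v w" by (cases V)
  note cl = frame_closed[OF assms(2)[unfolded V]]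
  then show ?thesis
    using assms by (simp add: V Vec3_in_frames cross_triple_def lcomb_cross lcomb_dot)
qed

lemma lcomb_fcomp:
  assumes "U \<in> frames R" "V \<in> frames R" "x \<in> vec3s R"
  shows "lcomb R (fcomp R U V) x = lcomb R U (lcomb R V x)"
proof -
  obtain u v w where V: "V = Vec3 u v w" by (cases V)
  note cl = frame_closed[OF assms(2)[unfolded V]]
  obtain a b c where x: "x = Vec3 a b c" by (cases x)
  show ?thesis
    using assms(1,3) cl by (simp add: V x lcomb_vadd lcomb_smul)
qed

section \<open>Blending along an idempotent\<close>

lemma vblend_closed [simp]:
  "e \<in> carrier R \<Longrightarrow> u \<in> vec3s R \<Longrightarrow> v \<in> vec3s R \<Longrightarrow> vblend R e u v \<in> vec3s R"
  by (simp add: vblend_def)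

lemma idem_complement:
  assumes "e \<in> carrier R" "e \<otimes> e = e"
  shows "(\<one> \<ominus> e) \<otimes> e = \<zero>" "e \<otimes> (\<one> \<ominus> e) = \<zero>" "(\<one> \<ominus> e) \<otimes> (\<one> \<ominus> e) = \<one> \<ominus> e"
  using assms by (simp_all add: minus_eq l_distr r_distr l_minus r_minus r_neg)

text \<open>The mixed terms carry the factor \<open>(1 - e) e = 0\<close>.\<close>

lemma vblend_cross:
  assumes [simp]: "e \<in> carrier R" "u \<in> vec3s R" "v \<in> vec3s R" "u' \<in> vec3s R" "v' \<in> vec3s R"
    and e: "e \<otimes> e = e"
  shows "cross R (vblend R e u u') (vblend R e v v') = vblend R e (cross R u v) (cross R u' v')"
  by (simp add: vblend_def cross_add cross_smul smul_add smul_smul idem_complement e)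

lemma vblend_dot:
  assumes [simp]: "e \<in> carrier R" "u \<in> vec3s R" "v \<in> vec3s R" "u' \<in> vec3s R" "v' \<in> vec3s R"
    and e: "e \<otimes> e = e"
  shows "dot R (vblend R e u u') (vblend R e v v') = (\<one> \<ominus> e) \<otimes> dot R u v \<oplus> e \<otimes> dot R u' v'"
  by (simp add: vblend_def dot_add dot_smul r_distr m_assoc[symmetric] idem_complement e)

lemma fblend_frames:
  assumes "U \<in> frames R" "V \<in> frames R" "e \<in> carrier R" "e \<otimes> e = e"
  shows "fblend R e U V \<in> frames R"
proof -
  obtain u v w where U: "U = Vec3 u v w" by (cases U)
  obtain u' v' w' where V: "V = Vec3 u' v' w'" by (cases V)
  note cl = frame_closed[OF assms(1)[unfolded U]] frame_closed[OF assms(2)[unfolded V]]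
  have "\<one> \<ominus> e \<oplus> e = \<one>"
    using assms(3) by algebra
  then show ?thesis
    using assms cl by (simp add: U V Vec3_in_frames cross_triple_def vblend_cross vblend_dot)
qed

lemma smul_vblend:
  assumes "e \<in> carrier R" "r \<in> carrier R" "u \<in> vec3s R" "v \<in> vec3s R"
  shows "smul R r (vblend R e u v) = vblend R e (smul R r u) (smul R r v)"
  using assms by (simp add: vblend_def smul_add smul_smul m_comm)

lemma vadd_vblend:
  assumes "e \<in> carrier R" "u \<in> vec3s R" "v \<in> vec3s R" "u' \<in> vec3s R" "v' \<in> vec3s R"
  shows "vadd R (vblend R e u v) (vblend R e u' v') = vblend R e (vadd R u u') (vadd R v v')"
  using assms by (simp add: vblend_def smul_add vadd_ac)

lemma lcomb_fblend:
  assumes "U \<in> frames R" "V \<in> frames R" "e \<in> carrier R" "x \<in> vec3s R"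
  shows "lcomb R (fblend R e U V) x = vblend R e (lcomb R U x) (lcomb R V x)"
proof -
  obtain u v w where U: "U = Vec3 u v w" by (cases U)
  obtain u' v' w' where V: "V = Vec3 u' v' w'" by (cases V)
  obtain a b c where x: "x = Vec3 a b c" by (cases x)
  show ?thesis
    using assms frame_closed[OF assms(1)[unfolded U]] frame_closed[OF assms(2)[unfolded V]]
    by (simp add: U V x smul_vblend vadd_vblend)
qed

end

section \<open>Base change of frames and implementing matrices\<close>

locale quat_hom = R: quat_ring R i h + S: quat_ring S "\<phi> i" "\<phi> h" + ring_hom_cring R S \<phi>
  for R (structure) and S (structure) and i h \<phi>
begin

lemma map_vec3_closed [simp]: "u \<in> vec3s R \<Longrightarrow> map_vec3 \<phi> u \<in> vec3s S"
  by (cases u) simp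

lemma map_vec3_simps:
  assumes "u \<in> vec3s R" "v \<in> vec3s R"
  shows "map_vec3 \<phi> (cross R u v) = cross S (map_vec3 \<phi> u) (map_vec3 \<phi> v)"
    "\<phi> (dot R u v) = dot S (map_vec3 \<phi> u) (map_vec3 \<phi> v)"
  using assms by (cases u; cases v; simp add: R.minus_eq S.minus_eq)+

lemma map_frames:
  assumes "U \<in> frames R" shows "fmap \<phi> U \<in> frames S"
proof -
  obtain u v w where U: "U = Vec3 u v w" by (cases U)
  show ?thesis
    using assms R.frame_closed[OF assms[unfolded U]]
    by (simp add: U R.Vec3_in_frames S.Vec3_in_frames cross_triple_def flip: map_vec3_simps)
qed

lemma map_basis: "map_vec3 \<phi> (e1 R) = e1 S" "map_vec3 \<phi> (e2 R) = e2 S" "map_vec3 \<phi> (e3 R) = e3 S"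
  by (simp_all add: e1_def e2_def e3_def)

lemma map_pauli: "u \<in> vec3s R \<Longrightarrow> map_mat2 \<phi> (R.P u) = S.P (map_vec3 \<phi> u)"
  by (cases u) (simp add: R.minus_eq S.minus_eq)

lemma map_twist:
  assumes "U \<in> frames R" "g \<in> twist R i U"
  shows "map_mat2 \<phi> g \<in> twist S (\<phi> i) (fmap \<phi> U)"
proof -
  obtain u v w where U: "U = Vec3 u v w" by (cases U)
  note cl = R.frame_closed[OF assms(1)[unfolded U]]
  note tg = assms(2)[unfolded U R.twist_iff]
  have hom: "map_mat2 \<phi> \<in> ring_hom (mat2_ring R) (mat2_ring S)"
    using map_mat2_ring_hom R.is_cring S.is_cring homh by blast
  have "S.P (map_vec3 \<phi> x) \<otimes>\<^bsub>mat2_ring S\<^esub> map_mat2 \<phi> g = map_mat2 \<phi> g \<otimes>\<^bsub>mat2_ring S\<^esub> S.P (map_vec3 \<phi> e)"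
    if x: "x \<in> vec3s R" "e \<in> vec3s R" "R.P x \<otimes>\<^bsub>mat2_ring R\<^esub> g = g \<otimes>\<^bsub>mat2_ring R\<^esub> R.P e" for x e
  proof -
    have "g \<in> carrier (mat2_ring R)"
      using tg by simp
    then show ?thesis
      using arg_cong[OF x(3), of "map_mat2 \<phi>"] x(1,2) ring_hom_mult[OF hom] by (simp add: map_pauli)
  qed
  moreover have "map_mat2 \<phi> g \<in> carrier (GL2 S)"
    using tg map_mat2_GL2 R.is_cring S.is_cring homh by blast
  ultimately show ?thesis
    using tg cl by (simp add: U S.twist_iff flip: map_basis)
qed

lemma map_twist_coset:
  assumes "U \<in> frames R" "g \<in> twist R i U"
  shows "GL2_mod_Gm_map S \<phi> (twist R i U) = twist S (\<phi> i) (fmap \<phi> U)"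
  using GL2_mod_Gm_map_coset[OF R.is_cring S.is_cring homh R.twist_GL2[OF assms(2)]]
  unfolding R.twist_eq_coset[OF assms] S.twist_eq_coset[OF map_frames[OF assms(1)] map_twist[OF assms]] .

end

lemma quat_homI:
  assumes "quat_ring R i h" "cring S" "\<phi> \<in> ring_hom R S"
  shows "quat_hom R S i h \<phi>"
proof -
  interpret R: quat_ring R i h by fact
  interpret S: cring S by fact
  interpret ring_hom_cring R S \<phi>
    by unfold_locales fact
  have "\<phi> i \<otimes>\<^bsub>S\<^esub> \<phi> i = \<ominus>\<^bsub>S\<^esub> \<one>\<^bsub>S\<^esub>"
    using arg_cong[OF R.i_sq, of \<phi>] by simp
  moreover have "(\<one>\<^bsub>S\<^esub> \<oplus>\<^bsub>S\<^esub> \<one>\<^bsub>S\<^esub>) \<otimes>\<^bsub>S\<^esub> \<phi> h = \<one>\<^bsub>S\<^esub>"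
    using arg_cong[OF R.h_two, of \<phi>] by simp
  ultimately show ?thesis
    by unfold_locales simp_all
qed

lemma vec3_glue:
  assumes "cring R"
    and local: "\<And>p. p \<in> Spec R \<Longrightarrow> \<exists>f\<in>carrier R - p. \<exists>c\<in>vec3s (localization R (away R f)).
      \<forall>q\<in>Spec R. f \<notin> q \<longrightarrow> s q = map_vec3 (localization_map R (carrier R - q) (\<lambda>x. x)) c"
  shows "\<exists>a\<in>vec3s R. \<forall>p\<in>Spec R. s p = map_vec3 (germ R p) a"
proof -
  interpret cring R by fact
  have sel: "\<exists>a\<in>carrier R. \<forall>p\<in>Spec R. sel (s p) = germ R p a"
    if "sel \<in> {vfst, vsnd, vthd}" for sel
  proof (rule sections_glue)
    fix p assume "p \<in> Spec R"
    then obtain f c where f: "f \<in> carrier R - p" and c: "c \<in> vec3s (localization R (away R f))"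
      and s: "\<forall>q\<in>Spec R. f \<notin> q \<longrightarrow> s q = map_vec3 (localization_map R (carrier R - q) (\<lambda>x. x)) c"
      using local by blast
    have "sel c \<in> carrier (localization R (away R f))"
      using that c by (cases c) auto
    moreover have "sel (map_vec3 (localization_map R (carrier R - q) (\<lambda>x. x)) c) =
        localization_map R (carrier R - q) (\<lambda>x. x) (sel c)" for q
      using that by (cases c) auto
    ultimately show "\<exists>f\<in>carrier R - p. \<exists>c\<in>carrier (localization R (away R f)).
        \<forall>q\<in>Spec R. f \<notin> q \<longrightarrow> sel (s q) = localization_map R (carrier R - q) (\<lambda>x. x) c"
      using f s by (intro bexI[of _ f] bexI[of _ "sel c"]) auto
  qed
  obtain a b c where "a \<in> carrier R" "b \<in> carrier R" "c \<in> carrier R"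
    and "\<forall>p\<in>Spec R. vfst (s p) = germ R p a" "\<forall>p\<in>Spec R. vsnd (s p) = germ R p b"
      "\<forall>p\<in>Spec R. vthd (s p) = germ R p c"
    using sel[of vfst] sel[of vsnd] sel[of vthd] by auto
  then show ?thesis
    by (intro bexI[of _ "Vec3 a b c"]) (auto intro: vec3.expand)
qed

lemma (in cring) vec3_germs_inject:
  assumes "u \<in> vec3s R" "v \<in> vec3s R" "\<And>p. p \<in> Spec R \<Longrightarrow> map_vec3 (germ R p) u = map_vec3 (germ R p) v"
  shows "u = v"
  using assms by (cases u; cases v) (auto intro!: germs_inject)

text \<open>The value at \<open>p\<close> is the whole set of matrices over the local ring that
  implement the germ of the frame. This avoids a choice; that the set is nonempty and a coset has to
  be proved.\<close>

definition frame_section :: "('a, 'm) ring_scheme \<Rightarrow> 'a \<Rightarrow> 'a vec3 vec3 \<Rightarrow> 'a set \<Rightarrow> ('a \<times> 'a) set mat2 set" where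
  "frame_section R i U = (\<lambda>p\<in>Spec R. twist (local_ring_at R p) (germ R p i) (fmap (germ R p) U))"

context quat_ring
begin

section \<open>The section attached to a frame\<close>

lemma germ_hom:
  assumes "p \<in> Spec R"
  shows "quat_hom R (local_ring_at R p) i h (germ R p)"
proof -
  interpret mult_set "carrier R - p" R by (rule mult_set_prime) fact
  show ?thesis
    by (rule quat_homI[OF quat_ring_axioms cring_loc to_loc_hom])
qed

lemma away_hom:
  assumes "f \<in> carrier R"
  shows "quat_hom R (localization R (away R f)) i h (\<lambda>a. fraction R (away R f) a \<one>)"
proof -
  interpret mult_set "away R f" R by (rule mult_set_away) fact
  show ?thesis
    by (rule quat_homI[OF quat_ring_axioms cring_loc to_loc_hom])
qed

lemma away_subset: "f \<in> carrier R \<Longrightarrow> q \<in> Spec R \<Longrightarrow> f \<notin> q \<Longrightarrow> away R f \<subseteq> carrier R - q"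
  using Spec_pow by (auto simp: away_def)

lemma away_germ_hom:
  assumes f: "f \<in> carrier R" and q: "q \<in> Spec R" "f \<notin> q"
  shows "quat_hom (localization R (away R f)) (local_ring_at R q) (fraction R (away R f) i \<one>)
      (fraction R (away R f) h \<one>) (localization_map R (carrier R - q) (\<lambda>x. x))"
proof -
  have id: "(\<lambda>x. x) \<in> ring_hom R R" "(\<lambda>x. x) ` away R f \<subseteq> carrier R - q"
    using away_subset[OF f q] by (auto simp: ring_hom_def)
  show ?thesis
    by (intro quat_homI localization_map_hom mult_set_away mult_set_prime f q(1) id
        quat_hom.axioms(2)[OF away_hom] mult_set.cring_loc)
qed

lemma away_germ:
  assumes f: "f \<in> carrier R" and q: "q \<in> Spec R" "f \<notin> q" and a: "a \<in> carrier R"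
  shows "localization_map R (carrier R - q) (\<lambda>x. x) (fraction R (away R f) a \<one>) = germ R q a"
proof -
  have id: "(\<lambda>x. x) \<in> ring_hom R R" "(\<lambda>x. x) ` away R f \<subseteq> carrier R - q"
    using away_subset[OF f q] by (auto simp: ring_hom_def)
  show ?thesis
    using localization_map_fraction[OF mult_set_away[OF f] mult_set_prime[OF q(1)] id a]
      mult_set.one_in[OF mult_set_away[OF f]] by simp
qed

lemma fmap_away_germ:
  assumes "f \<in> carrier R" "q \<in> Spec R" "f \<notin> q" "U \<in> frames R"
  shows "fmap (localization_map R (carrier R - q) (\<lambda>x. x)) (fmap (\<lambda>a. fraction R (away R f) a \<one>) U) = fmap (germ R q) U"
proof -
  have "map_vec3 (localization_map R (carrier R - q) (\<lambda>x. x)) (map_vec3 (\<lambda>a. fraction R (away R f) a \<one>) u) = map_vec3 (germ R q) u"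
    if "u \<in> vec3s R" for u
    using that away_germ[OF assms(1-3)] by (cases u) simp
  then show ?thesis
    using assms(4) frame_closed by (cases U) simp
qed

text \<open>The elements \<open>2 (1 + c)\<close> and \<open>2 (1 - c)\<close> add up to the unit
  \<open>4\<close>, so a prime cannot contain both. Inverting one that lies outside \<open>p\<close>
  makes the corresponding average invertible.\<close>

lemma twist_local:
  assumes U: "U \<in> frames R" and p: "p \<in> Spec R"
  shows "\<exists>f\<in>carrier R - p. \<exists>g. g \<in> twist (localization R (away R f)) (fraction R (away R f) i \<one>)
      (fmap (\<lambda>a. fraction R (away R f) a \<one>) U)"
proof -
  obtain u v a b c where Ud: "U = Vec3 u v (Vec3 a b c)"
    by (metis vec3.exhaust)
  have c [simp]: "c \<in> carrier R"
    using frame_closed[OF U[unfolded Ud]] by simp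
  let ?t = "(\<one> \<oplus> \<one>) \<otimes> (\<one> \<oplus> c)" and ?t' = "(\<one> \<oplus> \<one>) \<otimes> (\<one> \<ominus> c)"
  have "?t \<oplus> ?t' = (\<one> \<oplus> \<one>) \<otimes> (\<one> \<oplus> \<one>)"
    using c by algebra
  then have "h \<otimes> h \<otimes> (?t \<oplus> ?t') = (\<one> \<oplus> \<one>) \<otimes> h \<otimes> ((\<one> \<oplus> \<one>) \<otimes> h)"
    by (simp add: m_ac)
  then have sum: "h \<otimes> h \<otimes> ?t \<oplus> h \<otimes> h \<otimes> ?t' = \<one>"
    by (simp add: h_two r_distr)
  have nonempty: "\<exists>g. g \<in> twist (localization R (away R f)) (fraction R (away R f) i \<one>)
      (fmap (\<lambda>a. fraction R (away R f) a \<one>) U)" if f: "f = ?t \<or> f = ?t'" for f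
  proof -
    have fR: "f \<in> carrier R"
      using f by auto
    interpret L: mult_set "away R f" R
      by (rule mult_set_away[OF fR])
    interpret H: quat_hom R "localization R (away R f)" i h "\<lambda>a. fraction R (away R f) a \<one>"
      by (rule away_hom[OF fR])
    have "f \<in> away R f"
      using fR by (auto simp: away_def intro!: exI[of _ 1])
    then have unit: "fraction R (away R f) f \<one> \<in> Units (localization R (away R f))"
      by (rule L.to_loc_Units)
    have cl: "fraction R (away R f) c \<one> \<in> carrier (localization R (away R f))"
      by simp
    have ev: "fraction R (away R f) ?t \<one> = (\<one>\<^bsub>L.L\<^esub> \<oplus>\<^bsub>L.L\<^esub> \<one>\<^bsub>L.L\<^esub>) \<otimes>\<^bsub>L.L\<^esub> (\<one>\<^bsub>L.L\<^esub> \<oplus>\<^bsub>L.L\<^esub> fraction R (away R f) c \<one>)"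
      "fraction R (away R f) ?t' \<one> = (\<one>\<^bsub>L.L\<^esub> \<oplus>\<^bsub>L.L\<^esub> \<one>\<^bsub>L.L\<^esub>) \<otimes>\<^bsub>L.L\<^esub> (\<one>\<^bsub>L.L\<^esub> \<ominus>\<^bsub>L.L\<^esub> fraction R (away R f) c \<one>)"
      using c by (simp_all only: H.hom_mult H.hom_add H.hom_one H.hom_a_inv minus_eq H.S.minus_eq
          one_closed a_closed a_inv_closed)
    have fr: "fmap (\<lambda>a. fraction R (away R f) a \<one>) U \<in> frames L.L"
      by (rule H.map_frames[OF U])
    from f unit have "fraction R (away R f) ?t \<one> \<in> Units L.L \<or> fraction R (away R f) ?t' \<one> \<in> Units L.L"
      by fast
    then have "twist L.L (L.to_loc i) (fmap L.to_loc U) \<noteq> {}"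
      unfolding ev using H.S.twist_nonempty[OF fr[unfolded Ud vec3.map]] unfolding Ud vec3.map by blast
    then show ?thesis
      by blast
  qed
  have "?t \<notin> p \<or> ?t' \<notin> p"
  proof (rule ccontr)
    assume "\<not> ?thesis"
    then have "h \<otimes> h \<otimes> ?t \<in> p" "h \<otimes> h \<otimes> ?t' \<in> p"
      using Spec_mult[OF p, of "h \<otimes> h" ?t] Spec_mult[OF p, of "h \<otimes> h" ?t'] c by auto
    then have "h \<otimes> h \<otimes> ?t \<oplus> h \<otimes> h \<otimes> ?t' \<in> p"
      by (rule Spec_add[OF p])
    then show False
      unfolding sum using Spec_one[OF p] by blast
  qed
  then consider "?t \<in> carrier R - p" | "?t' \<in> carrier R - p"
    using c by auto
  then show ?thesis
    using nonempty[of ?t] nonempty[of ?t'] by cases blast+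
qed

lemma frame_section_local:
  assumes U: "U \<in> frames R" and p: "p \<in> Spec R"
  shows "\<exists>f\<in>carrier R - p. \<exists>C\<in>carrier (GL2_mod_Gm (localization R (away R f))).
    \<forall>q\<in>Spec R. f \<notin> q \<longrightarrow> frame_section R i U q =
      GL2_mod_Gm_map (local_ring_at R q) (localization_map R (carrier R - q) (\<lambda>x. x)) C"
proof -
  obtain f g where f: "f \<in> carrier R - p" and g: "g \<in> twist (localization R (away R f))
      (fraction R (away R f) i \<one>) (fmap (\<lambda>a. fraction R (away R f) a \<one>) U)"
    using twist_local[OF assms] by blast
  have fR: "f \<in> carrier R"
    using f by blast
  interpret H: quat_hom R "localization R (away R f)" i h "\<lambda>a. fraction R (away R f) a \<one>"
    by (rule away_hom[OF fR])
  let ?V = "fmap (\<lambda>a. fraction R (away R f) a \<one>) U"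
  let ?C = "twist (localization R (away R f)) (fraction R (away R f) i \<one>) ?V"
  have fr: "?V \<in> frames (localization R (away R f))"
    by (rule H.map_frames[OF U])
  have "?C \<in> carrier (GL2_mod_Gm (localization R (away R f)))"
    using H.S.twist_eq_coset[OF fr g] H.S.twist_GL2[OF g] H.S.carrier_GL2_mod_Gm by blast
  moreover have "frame_section R i U q =
      GL2_mod_Gm_map (local_ring_at R q) (localization_map R (carrier R - q) (\<lambda>x. x)) ?C"
    if q: "q \<in> Spec R" "f \<notin> q" for q
  proof -
    interpret K: quat_hom "localization R (away R f)" "local_ring_at R q" "fraction R (away R f) i \<one>"
      "fraction R (away R f) h \<one>" "localization_map R (carrier R - q) (\<lambda>x. x)"
      by (rule away_germ_hom[OF fR q])
    show ?thesis
      using K.map_twist_coset[OF fr g] q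
      by (simp add: frame_section_def fmap_away_germ[OF fR q U] away_germ[OF fR q])
  qed
  ultimately show ?thesis
    using f by blast
qed

lemma twist_germ_nonempty:
  assumes U: "U \<in> frames R" and p: "p \<in> Spec R"
  obtains g where "g \<in> twist (local_ring_at R p) (germ R p i) (fmap (germ R p) U)"
proof -
  obtain f g where f: "f \<in> carrier R - p" and g: "g \<in> twist (localization R (away R f))
      (fraction R (away R f) i \<one>) (fmap (\<lambda>a. fraction R (away R f) a \<one>) U)"
    using twist_local[OF assms] by blast
  have fR: "f \<in> carrier R" "f \<notin> p"
    using f by blast+
  interpret H: quat_hom R "localization R (away R f)" i h "\<lambda>a. fraction R (away R f) a \<one>"
    by (rule away_hom[OF fR(1)])
  interpret K: quat_hom "localization R (away R f)" "local_ring_at R p" "fraction R (away R f) i \<one>"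
    "fraction R (away R f) h \<one>" "localization_map R (carrier R - p) (\<lambda>x. x)"
    by (rule away_germ_hom[OF fR(1) p fR(2)])
  show thesis
    using K.map_twist[OF H.map_frames[OF U] g] that
    by (simp add: fmap_away_germ[OF fR(1) p fR(2) U] away_germ[OF fR(1) p fR(2)])
qed

lemma frame_section_closed:
  assumes U: "U \<in> frames R"
  shows "frame_section R i U \<in> carrier (PGL2_points R)"
proof -
  have "frame_section R i U p \<in> carrier (GL2_mod_Gm (local_ring_at R p))" if p: "p \<in> Spec R" for p
  proof -
    interpret G: quat_hom R "local_ring_at R p" i h "germ R p"
      by (rule germ_hom[OF p])
    obtain g where g: "g \<in> twist (local_ring_at R p) (germ R p i) (fmap (germ R p) U)"
      by (rule twist_germ_nonempty[OF U p])
    show ?thesis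
      using G.S.twist_eq_coset[OF G.map_frames[OF U] g] G.S.twist_GL2[OF g] p
      by (simp add: frame_section_def G.S.carrier_GL2_mod_Gm)
  qed
  then have "frame_section R i U \<in> (\<Pi>\<^sub>E p\<in>Spec R. carrier (GL2_mod_Gm (local_ring_at R p)))"
    by (auto simp: frame_section_def)
  then show ?thesis
    using frame_section_local[OF U] unfolding PGL2_points_def by simp
qed

text \<open>One matrix in the common coset at a prime determines the germ of the frame there, and
  the entries of a frame are determined by their germs.\<close>

lemma frame_section_inject:
  assumes U: "U \<in> frames R" and V: "V \<in> frames R" and eq: "frame_section R i U = frame_section R i V"
  shows "U = V"
proof -
  have "fmap (germ R p) U = fmap (germ R p) V" if p: "p \<in> Spec R" for p
  proof -
    interpret G: quat_hom R "local_ring_at R p" i h "germ R p"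
      by (rule germ_hom[OF p])
    obtain g where g: "g \<in> twist (local_ring_at R p) (germ R p i) (fmap (germ R p) U)"
      by (rule twist_germ_nonempty[OF U p])
    then have "g \<in> twist (local_ring_at R p) (germ R p i) (fmap (germ R p) V)"
      using fun_cong[OF eq, of p] p by (simp add: frame_section_def)
    then show ?thesis
      using G.S.twist_unique G.map_frames U V g by blast
  qed
  moreover obtain u v w u' v' w' where "U = Vec3 u v w" "V = Vec3 u' v' w'"
    by (meson vec3.exhaust)
  ultimately show ?thesis
    using frame_closed U V by (auto intro!: vec3_germs_inject)
qed

text \<open>At each prime the coset belongs to exactly one frame \<open>V p\<close> over the local
  ring. Near a given prime all these frames come from one matrix, hence from one frame over a
  localization at an element. The coordinates of \<open>V\<close> are thus sections of the structure
  sheaf and glue to elements of \<open>R\<close>, although the matrices themselves need not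
  glue.\<close>

lemma frame_section_surj:
  assumes s: "s \<in> carrier (PGL2_points R)"
  shows "\<exists>U\<in>frames R. s = frame_section R i U"
proof -
  have ext: "s \<in> extensional (Spec R)"
    and germs: "\<And>p. p \<in> Spec R \<Longrightarrow> s p \<in> carrier (GL2_mod_Gm (local_ring_at R p))"
    and local: "\<And>p. p \<in> Spec R \<Longrightarrow> \<exists>f\<in>carrier R - p. \<exists>C\<in>carrier (GL2_mod_Gm (localization R (away R f))).
      \<forall>q\<in>Spec R. f \<notin> q \<longrightarrow> s q =
        GL2_mod_Gm_map (local_ring_at R q) (localization_map R (carrier R - q) (\<lambda>x. x)) C"
    using s unfolding PGL2_points_def by (auto simp: PiE_def)
  define V where "V p = (THE U. U \<in> frames (local_ring_at R p) \<and> s p = twist (local_ring_at R p) (germ R p i) U)" for p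
  \<comment> \<open>A frame sharing a single implementing matrix with \<open>s p\<close> must be
    \<open>V p\<close>. This serves both for existence at one prime and for compatibility around
    it.\<close>
  have V_eq: "V p = U \<and> s p = twist (local_ring_at R p) (germ R p i) U"
    if p: "p \<in> Spec R" and U: "U \<in> frames (local_ring_at R p)"
      and g: "g \<in> s p" "g \<in> twist (local_ring_at R p) (germ R p i) U" for p U g
  proof -
    interpret G: quat_hom R "local_ring_at R p" i h "germ R p"
      by (rule germ_hom[OF p])
    obtain k where k: "k \<in> carrier (GL2 (local_ring_at R p))" "s p = G.S.coset k"
      using germs[OF p] by (auto simp: G.S.carrier_GL2_mod_Gm)
    then have "s p = G.S.coset g"
      using g(1) G.S.coset_eq by simp
    then have *: "s p = twist (local_ring_at R p) (germ R p i) U"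
      using G.S.twist_eq_coset[OF U g(2)] by simp
    moreover have "V p = U"
      unfolding V_def using U * G.S.twist_unique g(2) by (intro the_equality) auto
    ultimately show ?thesis by blast
  qed
  have V: "V p \<in> frames (local_ring_at R p) \<and> s p = twist (local_ring_at R p) (germ R p i) (V p)"
    if p: "p \<in> Spec R" for p
  proof -
    interpret G: quat_hom R "local_ring_at R p" i h "germ R p"
      by (rule germ_hom[OF p])
    obtain k where k: "k \<in> carrier (GL2 (local_ring_at R p))" "s p = G.S.coset k"
      using germs[OF p] by (auto simp: G.S.carrier_GL2_mod_Gm)
    then have "k \<in> s p"
      using G.S.coset_self by simp
    moreover obtain U where "U \<in> frames (local_ring_at R p)" "k \<in> twist (local_ring_at R p) (germ R p i) U"
      using G.S.twist_exists[OF k(1)] by blast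
    ultimately show ?thesis
      using V_eq[OF p] by blast
  qed
  have loc: "\<exists>f\<in>carrier R - p. \<exists>W\<in>frames (localization R (away R f)).
      \<forall>q\<in>Spec R. f \<notin> q \<longrightarrow> V q = fmap (localization_map R (carrier R - q) (\<lambda>x. x)) W"
    if p: "p \<in> Spec R" for p
  proof -
    obtain f C where f: "f \<in> carrier R - p" and C: "C \<in> carrier (GL2_mod_Gm (localization R (away R f)))"
      and sC: "\<And>q. q \<in> Spec R \<Longrightarrow> f \<notin> q \<Longrightarrow>
        s q = GL2_mod_Gm_map (local_ring_at R q) (localization_map R (carrier R - q) (\<lambda>x. x)) C"
      using local[OF p] by blast
    have fR: "f \<in> carrier R"
      using f by blast
    interpret H: quat_hom R "localization R (away R f)" i h "\<lambda>a. fraction R (away R f) a \<one>"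
      by (rule away_hom[OF fR])
    obtain g where g: "g \<in> carrier (GL2 (localization R (away R f)))" "C = H.S.coset g"
      using C by (auto simp: H.S.carrier_GL2_mod_Gm)
    obtain W where W: "W \<in> frames (localization R (away R f))"
      "g \<in> twist (localization R (away R f)) (fraction R (away R f) i \<one>) W"
      using H.S.twist_exists[OF g(1)] by blast
    have "V q = fmap (localization_map R (carrier R - q) (\<lambda>x. x)) W" if q: "q \<in> Spec R" "f \<notin> q" for q
    proof -
      interpret K: quat_hom "localization R (away R f)" "local_ring_at R q" "fraction R (away R f) i \<one>"
        "fraction R (away R f) h \<one>" "localization_map R (carrier R - q) (\<lambda>x. x)"
        by (rule away_germ_hom[OF fR q])
      let ?g = "map_mat2 (localization_map R (carrier R - q) (\<lambda>x. x)) g"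
      have "?g \<in> twist (local_ring_at R q) (germ R q i) (fmap (localization_map R (carrier R - q) (\<lambda>x. x)) W)"
        using K.map_twist[OF W] by (simp add: away_germ[OF fR q])
      moreover have "s q = K.S.coset ?g"
        unfolding sC[OF q] g(2) by (rule GL2_mod_Gm_map_coset[OF H.S.is_cring K.S.is_cring K.homh g(1)])
      then have "?g \<in> s q"
        using K.S.coset_self[OF map_mat2_GL2[OF H.S.is_cring K.S.is_cring K.homh g(1)]] by simp
      ultimately show ?thesis
        using V_eq[OF q(1) K.map_frames[OF W(1)]] by blast
    qed
    then show ?thesis
      using f W(1) by blast
  qed
  have sel: "\<exists>a\<in>vec3s R. \<forall>p\<in>Spec R. sel (V p) = map_vec3 (germ R p) a"
    if sel: "sel \<in> {vfst, vsnd, vthd}" for sel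
  proof (rule vec3_glue[OF is_cring])
    fix p assume "p \<in> Spec R"
    then obtain f W where f: "f \<in> carrier R - p" and W: "W \<in> frames (localization R (away R f))"
      and VW: "\<forall>q\<in>Spec R. f \<notin> q \<longrightarrow> V q = fmap (localization_map R (carrier R - q) (\<lambda>x. x)) W"
      using loc by blast
    have fR: "f \<in> carrier R"
      using f by blast
    interpret H: quat_hom R "localization R (away R f)" i h "\<lambda>a. fraction R (away R f) a \<one>"
      by (rule away_hom[OF fR])
    have "sel W \<in> vec3s (localization R (away R f))"
      using sel W H.S.frame_closed by (cases W) auto
    moreover have "sel (fmap (localization_map R (carrier R - q) (\<lambda>x. x)) W) =
        map_vec3 (localization_map R (carrier R - q) (\<lambda>x. x)) (sel W)" for q
      using sel by (cases W) auto
    ultimately show "\<exists>f\<in>carrier R - p. \<exists>c\<in>vec3s (localization R (away R f)).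
        \<forall>q\<in>Spec R. f \<notin> q \<longrightarrow> sel (V q) = map_vec3 (localization_map R (carrier R - q) (\<lambda>x. x)) c"
      using f VW by (intro bexI[of _ f] bexI[of _ "sel W"]) auto
  qed
  obtain u v w where cl: "u \<in> vec3s R" "v \<in> vec3s R" "w \<in> vec3s R"
    and "\<forall>p\<in>Spec R. vfst (V p) = map_vec3 (germ R p) u" "\<forall>p\<in>Spec R. vsnd (V p) = map_vec3 (germ R p) v"
      "\<forall>p\<in>Spec R. vthd (V p) = map_vec3 (germ R p) w"
    using sel[of vfst] sel[of vsnd] sel[of vthd] by auto
  then have VU: "V p = fmap (germ R p) (Vec3 u v w)" if "p \<in> Spec R" for p
    using that by (auto intro: vec3.expand)
  \<comment> \<open>The frame equations hold in every local ring, hence in \<open>R\<close>.\<close>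
  have eqs: "map_vec3 (germ R p) (cross R u v) = map_vec3 (germ R p) w"
    "map_vec3 (germ R p) (cross R v w) = map_vec3 (germ R p) u"
    "map_vec3 (germ R p) (cross R w u) = map_vec3 (germ R p) v"
    "germ R p (dot R u u) = germ R p \<one>" if p: "p \<in> Spec R" for p
  proof -
    interpret G: quat_hom R "local_ring_at R p" i h "germ R p"
      by (rule germ_hom[OF p])
    have "fmap (germ R p) (Vec3 u v w) \<in> frames (local_ring_at R p)"
      using V[OF p] VU[OF p] by simp
    then show "map_vec3 (germ R p) (cross R u v) = map_vec3 (germ R p) w"
      "map_vec3 (germ R p) (cross R v w) = map_vec3 (germ R p) u"
      "map_vec3 (germ R p) (cross R w u) = map_vec3 (germ R p) v"
      "germ R p (dot R u u) = germ R p \<one>"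
      using cl by (simp_all add: G.S.Vec3_in_frames cross_triple_def G.map_vec3_simps)
  qed
  have "Vec3 u v w \<in> frames R"
    unfolding Vec3_in_frames cross_triple_def
    using cl eqs by (intro conjI vec3_germs_inject germs_inject) auto
  moreover have "s = frame_section R i (Vec3 u v w)"
    using V VU ext unfolding frame_section_def by (intro extensionalityI[OF ext]) auto
  ultimately show ?thesis by blast
qed

text \<open>Nonemptiness provides representatives, from which the product of the cosets is read off.
  The application is to local rings, where it is guaranteed by
  \<open>twist_germ_nonempty\<close>.\<close>

lemma germ_twist_mult:
  assumes U: "U \<in> frames R" and V: "V \<in> frames R"
  shows "twist R i U \<noteq> {} \<Longrightarrow> twist R i V \<noteq> {} \<Longrightarrow>
    twist R i U \<otimes>\<^bsub>GL2_mod_Gm R\<^esub> twist R i V = twist R i (fcomp R U V)"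
proof -
  assume "twist R i U \<noteq> {}" "twist R i V \<noteq> {}"
  then obtain g k where g: "g \<in> twist R i U" and k: "k \<in> twist R i V"
    by blast
  obtain u v w where Vd: "V = Vec3 u v w" by (cases V)
  have "g \<otimes>\<^bsub>M2\<^esub> k \<in> twist R i (fcomp R U V)"
    using twist_mult[OF V[unfolded Vd] U g k[unfolded Vd]] by (simp add: Vd)
  then show ?thesis
    using coset_mult[OF twist_GL2[OF g] twist_GL2[OF k]] twist_eq_coset[OF U g] twist_eq_coset[OF V k]
      twist_eq_coset[OF fcomp_frames[OF U V]] by simp
qed

end

lemma preimage_in_Spec:
  assumes "cring R" "cring S" "\<phi> \<in> ring_hom R S" "q \<in> Spec S"
  shows "{x \<in> carrier R. \<phi> x \<in> q} \<in> Spec R"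
proof -
  interpret h: ring_hom_cring R S \<phi>
    using assms by (simp add: ring_hom_cring.intro ring_hom_cring_axioms.intro)
  interpret q: primeideal q S
    using assms(4) by (simp add: Spec_def)
  let ?p = "{x \<in> carrier R. \<phi> x \<in> q}"
  have "primeideal ?p R"
  proof (rule primeidealI)
    show "ideal ?p R"
    proof (rule idealI[OF h.R.ring_axioms])
      show "subgroup ?p (add_monoid R)"
        by (rule subgroup.intro) (auto simp flip: a_inv_def)
    qed (auto intro: q.I_l_closed q.I_r_closed)
    show "carrier R \<noteq> ?p"
      using h.S.Spec_one[OF assms(4)] h.hom_one h.R.one_closed by (metis (mono_tags, lifting) mem_Collect_eq)
    show "a \<in> ?p \<or> b \<in> ?p" if "a \<in> carrier R" "b \<in> carrier R" "a \<otimes>\<^bsub>R\<^esub> b \<in> ?p" for a b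
      using that q.I_prime[of "\<phi> a" "\<phi> b"] by auto
  qed (rule assms(1))
  then show ?thesis
    by (simp add: Spec_def)
qed

text \<open>The germ at \<open>q\<close> arises from the germ at the preimage of \<open>q\<close>
  through the induced map of local rings. That map carries implementing matrices to implementing
  matrices, so one representative settles the equality of cosets.\<close>

lemma frame_section_natural:
  fixes R S :: "('k, 'r) module"
  assumes "quat_ring R i h" "cring S" and \<phi>: "\<phi> \<in> ring_hom R S" and U: "U \<in> frames R"
  shows "trans PGL2 R S \<phi> (frame_section R i U) = frame_section S (\<phi> i) (fmap \<phi> U)"
proof -
  interpret quat_hom R S i h \<phi>
    by (rule quat_homI) fact+
  have germs: "GL2_mod_Gm_map (local_ring_at S q) (localization_map S (carrier S - q) \<phi>)
      (frame_section R i U {x \<in> carrier R. \<phi> x \<in> q}) = frame_section S (\<phi> i) (fmap \<phi> U) q"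
    if q: "q \<in> Spec S" for q
  proof -
    let ?p = "{x \<in> carrier R. \<phi> x \<in> q}" and ?l = "localization_map S (carrier S - q) \<phi>"
    have p: "?p \<in> Spec R"
      by (rule preimage_in_Spec[OF R.is_cring S.is_cring homh q])
    interpret G: quat_hom R "local_ring_at R ?p" i h "germ R ?p"
      by (rule R.germ_hom[OF p])
    note ms = R.mult_set_prime[OF p] S.mult_set_prime[OF q]
    have sub: "\<phi> ` (carrier R - ?p) \<subseteq> carrier S - q"
      by auto
    have germ: "?l (germ R ?p a) = germ S q (\<phi> a)" if "a \<in> carrier R" for a
      using localization_map_fraction[OF ms homh sub that mult_set.one_in[OF ms(1)]] by simp
    interpret K: quat_hom "local_ring_at R ?p" "local_ring_at S q" "germ R ?p i" "germ R ?p h" ?l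
      by (rule quat_homI[OF G.S.quat_ring_axioms mult_set.cring_loc[OF ms(2)] localization_map_hom[OF ms homh sub]])
    obtain g where g: "g \<in> twist (local_ring_at R ?p) (germ R ?p i) (fmap (germ R ?p) U)"
      by (rule R.twist_germ_nonempty[OF U p])
    have "map_vec3 ?l (map_vec3 (germ R ?p) u) = map_vec3 (germ S q) (map_vec3 \<phi> u)" if "u \<in> vec3s R" for u
      using that germ by (cases u) simp
    then have "fmap ?l (fmap (germ R ?p) U) = fmap (germ S q) (fmap \<phi> U)"
      using U R.frame_closed by (cases U) simp
    then show ?thesis
      using K.map_twist_coset[OF G.map_frames[OF U] g] p q germ[OF R.i_closed] by (simp add: frame_section_def)
  qed
  have "trans PGL2 R S \<phi> (frame_section R i U) = (\<lambda>q\<in>Spec S. GL2_mod_Gm_map (local_ring_at S q)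
      (localization_map S (carrier S - q) \<phi>) (frame_section R i U {x \<in> carrier R. \<phi> x \<in> q}))"
    by (simp add: PGL2_def)
  also have "\<dots> = restrict (frame_section S (\<phi> i) (fmap \<phi> U)) (Spec S)"
    by (rule restrict_ext) (rule germs)
  also have "\<dots> = frame_section S (\<phi> i) (fmap \<phi> U)"
    by (simp add: frame_section_def)
  finally show ?thesis .
qed

section \<open>Endomorphisms of the cross product algebra\<close>

text \<open>The zero map is allowed: the blocks of an automorphism with respect to the two copies
  vanish over parts of the spectrum.\<close>

definition cross_hom :: "('a, 'm) ring_scheme \<Rightarrow> ('a vec3 \<Rightarrow> 'a vec3) set" where
  "cross_hom R = {p \<in> vec3s R \<rightarrow> vec3s R.
     (\<forall>u\<in>vec3s R. \<forall>v\<in>vec3s R. p (vadd R u v) = vadd R (p u) (p v)) \<and>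
     (\<forall>a\<in>carrier R. \<forall>u\<in>vec3s R. p (smul R a u) = smul R a (p u)) \<and>
     (\<forall>u\<in>vec3s R. \<forall>v\<in>vec3s R. p (cross R u v) = cross R (p u) (p v))}"

text \<open>Multiplication by the transposed matrix, the inverse of a rotation.\<close>

fun finv :: "('a, 'm) ring_scheme \<Rightarrow> 'a vec3 vec3 \<Rightarrow> 'a vec3 \<Rightarrow> 'a vec3" where
  "finv R (Vec3 u v w) x = Vec3 (dot R u x) (dot R v x) (dot R w x)"

context cring
begin

lemma vec3_cancel:
  assumes "u \<in> vec3s R" "v \<in> vec3s R" "vadd R u (smul R (\<ominus> \<one>) v) = vzero R"
  shows "u = v"
  using assms by (cases u; cases v) (auto simp: vzero_def l_minus simp flip: minus_eq)

lemma finv_closed [simp]: "U \<in> frames R \<Longrightarrow> x \<in> vec3s R \<Longrightarrow> finv R U x \<in> vec3s R"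
  using frame_closed by (cases U) simp

lemma lcomb_basis:
  assumes "Vec3 u v w \<in> frames R"
  shows "lcomb R (Vec3 u v w) (e1 R) = u" "lcomb R (Vec3 u v w) (e2 R) = v" "lcomb R (Vec3 u v w) (e3 R) = w"
  using frame_closed[OF assms] by (simp_all add: e1_def e2_def e3_def)

lemma finv_lcomb:
  assumes U: "U \<in> frames R" and x: "x \<in> vec3s R"
  shows "finv R U (lcomb R U x) = x"
proof -
  obtain u v w where Ud: "U = Vec3 u v w" by (cases U)
  note b = lcomb_basis[OF U[unfolded Ud]] and d = lcomb_dot[OF U[unfolded Ud] _ x]
  obtain a b c where xd: "x = Vec3 a b c" by (cases x)
  have "dot R (e1 R) x = a" "dot R (e2 R) x = b" "dot R (e3 R) x = c"
    using x by (simp_all add: xd e1_def e2_def e3_def)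
  then show ?thesis
    using d[of "e1 R"] d[of "e2 R"] d[of "e3 R"] b by (simp add: Ud xd)
qed

text \<open>That a left inverse is a right inverse is shown without determinants. The defect
  \<open>y\<close> is orthogonal to the frame; Grassmann's identity for
  \<open>y \<times> (v \<times> w)\<close> gives \<open>y \<times> u = 0\<close>, and for
  \<open>u \<times> (u \<times> y)\<close> it gives \<open>y = (u . y) u = 0\<close>.\<close>

lemma lcomb_finv:
  assumes U: "U \<in> frames R" and x: "x \<in> vec3s R"
  shows "lcomb R U (finv R U x) = x"
proof -
  obtain u v w where Ud: "U = Vec3 u v w" by (cases U)
  note cl [simp] = frame_closed[OF U[unfolded Ud]]
  have t: "cross R v w = u" and n: "dot R u u = \<one>"
    using U by (simp_all add: Ud Vec3_in_frames cross_triple_def)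
  let ?x = "lcomb R U (finv R U x)"
  have [simp]: "?x \<in> vec3s R"
    using U x by simp
  define y where "y = vadd R x (smul R (\<ominus> \<one>) ?x)"
  have y [simp]: "y \<in> vec3s R"
    using x by (simp add: y_def)
  have "finv R U ?x = finv R U x"
    using U x by (simp add: finv_lcomb)
  then have "dot R u ?x = dot R u x" "dot R v ?x = dot R v x" "dot R w ?x = dot R w x"
    by (simp_all only: Ud finv.simps vec3.inject)
  then have o: "dot R u y = \<zero>" "dot R v y = \<zero>" "dot R w y = \<zero>"
    using x by (simp_all add: y_def dot_add dot_smul l_minus r_neg)
  have "vadd R (cross R y (cross R v w)) (smul R (dot R y v) w) = smul R (dot R y w) v"
    by (rule cross_cross) simp_all
  then have "cross R y u = vzero R"
    using o by (simp add: t dot_comm[of y])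
  then have "cross R u y = vzero R"
    using cross_anticomm[of y u] by simp
  then have "vadd R (vzero R) y = smul R (dot R u y) u"
    using cross_cross[of u u y] n by simp
  then have "y = vzero R"
    using o by simp
  then show ?thesis
    using x vec3_cancel unfolding y_def by (metis \<open>?x \<in> vec3s R\<close>)
qed

lemma vblend_involutive:
  assumes "e \<in> carrier R" "e \<otimes> e = e" "u \<in> vec3s R" "v \<in> vec3s R"
  shows "vblend R e (vblend R e u v) (vblend R e v u) = u"
proof -
  have "vblend R e (vblend R e u v) (vblend R e v u) = smul R ((\<one> \<ominus> e) \<oplus> e) u"
    using assms by (simp add: vblend_def smul_add smul_smul idem_complement add_smul)
  moreover have "(\<one> \<ominus> e) \<oplus> e = \<one>"
    using assms(1) by algebra
  ultimately show ?thesis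
    using assms by simp
qed

lemma vblend_same: "e \<in> carrier R \<Longrightarrow> u \<in> vec3s R \<Longrightarrow> vblend R e u u = u"
proof -
  assume e: "e \<in> carrier R" and u: "u \<in> vec3s R"
  then have "vblend R e u u = smul R ((\<one> \<ominus> e) \<oplus> e) u"
    by (simp add: vblend_def add_smul)
  moreover have "(\<one> \<ominus> e) \<oplus> e = \<one>"
    using e by algebra
  ultimately show ?thesis
    using u by simp
qed

section \<open>The support of a homomorphism of cross products\<close>

lemma cross_homD:
  assumes "p \<in> cross_hom R"
  shows "u \<in> vec3s R \<Longrightarrow> p u \<in> vec3s R"
    and "u \<in> vec3s R \<Longrightarrow> v \<in> vec3s R \<Longrightarrow> p (vadd R u v) = vadd R (p u) (p v)"
    and "a \<in> carrier R \<Longrightarrow> u \<in> vec3s R \<Longrightarrow> p (smul R a u) = smul R a (p u)"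
    and "u \<in> vec3s R \<Longrightarrow> v \<in> vec3s R \<Longrightarrow> p (cross R u v) = cross R (p u) (p v)"
  using assms by (auto simp: cross_hom_def)

lemma cross_hom_triple:
  assumes "p \<in> cross_hom R"
  shows "cross_triple R (p (e1 R)) (p (e2 R)) (p (e3 R))"
  using cross_homD[OF assms] cross_triple_basis by (simp add: cross_triple_def flip: cross_homD(4)[OF assms])

lemma cross_hom_lcomb:
  assumes "p \<in> cross_hom R" "u \<in> vec3s R"
  shows "p u = lcomb R (Vec3 (p (e1 R)) (p (e2 R)) (p (e3 R))) u"
proof -
  obtain a b c where u: "u = Vec3 a b c" by (cases u)
  have cl: "a \<in> carrier R" "b \<in> carrier R" "c \<in> carrier R"
    using assms(2) by (simp_all add: u)
  then have "u = vadd R (vadd R (smul R a (e1 R)) (smul R b (e2 R))) (smul R c (e3 R))"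
    by (simp add: u e1_def e2_def e3_def)
  then have "p u = p (vadd R (vadd R (smul R a (e1 R)) (smul R b (e2 R))) (smul R c (e3 R)))"
    by simp
  also have "\<dots> = lcomb R (Vec3 (p (e1 R)) (p (e2 R)) (p (e3 R))) u"
    using cl by (simp add: u cross_homD[OF assms(1)])
  finally show ?thesis .
qed

text \<open>The idempotent supporting \<open>p\<close>: where it is \<open>1\<close>, \<open>p\<close> is given by a frame, and where it is
  \<open>0\<close>, \<open>p\<close> vanishes.\<close>

definition csupp :: "('a vec3 \<Rightarrow> 'a vec3) \<Rightarrow> 'a" where
  "csupp p = dot R (p (e1 R)) (p (e1 R))"

lemma csupp_closed [simp]: "p \<in> cross_hom R \<Longrightarrow> csupp p \<in> carrier R"
  by (simp add: csupp_def cross_homD(1))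

text \<open>The images of the three basis vectors have the same norm, and multiplication by this
  norm fixes each of them.\<close>

lemma csupp_fixes:
  assumes "p \<in> cross_hom R" "u \<in> vec3s R"
  shows "smul R (csupp p) (p u) = p u"
proof -
  note t = cross_hom_triple[OF assms(1)]
  have n: "dot R (p (e2 R)) (p (e2 R)) = csupp p" "dot R (p (e3 R)) (p (e3 R)) = csupp p"
    using cross_triple_norm[OF t] cross_triple_norm[OF cross_triple_rotate[OF t]] by (simp_all add: csupp_def)
  have f: "smul R (csupp p) (p (e1 R)) = p (e1 R)" "smul R (csupp p) (p (e2 R)) = p (e2 R)"
    "smul R (csupp p) (p (e3 R)) = p (e3 R)"
    using cross_triple_fixed[OF t] cross_triple_fixed[OF cross_triple_rotate[OF t]]
      cross_triple_fixed[OF cross_triple_rotate[OF cross_triple_rotate[OF t]]] n by (simp_all add: csupp_def)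
  obtain a b c where u: "u = Vec3 a b c" by (cases u)
  have cl: "a \<in> carrier R" "b \<in> carrier R" "c \<in> carrier R"
    using assms(2) by (simp_all add: u)
  have sw: "smul R (csupp p) (smul R r z) = smul R r (smul R (csupp p) z)" if "r \<in> carrier R" "z \<in> vec3s R" for r z
    using that assms(1) by (simp add: smul_smul m_comm)
  have "smul R (csupp p) (p u) = smul R (csupp p) (lcomb R (Vec3 (p (e1 R)) (p (e2 R)) (p (e3 R))) u)"
    by (subst cross_hom_lcomb[OF assms]) (rule refl)
  also have "\<dots> = lcomb R (Vec3 (p (e1 R)) (p (e2 R)) (p (e3 R))) u"
    using cl assms(1) by (simp add: u smul_add cross_homD(1)[OF assms(1)] sw f)
  also have "\<dots> = p u"
    by (rule cross_hom_lcomb[OF assms, symmetric])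
  finally show ?thesis .
qed

text \<open>From \<open>q e1 = q e2 \<times> q e3\<close> the triple product gives
  \<open>x . q e1 = (x \<times> q e2) . q e3 = 0\<close>, and cyclically. Grassmann's identity for
  \<open>q e1 \<times> (q e1 \<times> x)\<close> then leaves \<open>|q e1|^2 x = 0\<close>.\<close>

lemma csupp_annihilates:
  assumes q: "q \<in> cross_hom R" and x: "x \<in> vec3s R"
    and orth: "\<And>u. u \<in> vec3s R \<Longrightarrow> cross R x (q u) = vzero R"
  shows "smul R (csupp q) x = vzero R" "\<And>u. u \<in> vec3s R \<Longrightarrow> dot R x (q u) = \<zero>"
proof -
  note cl [simp] = cross_homD(1)[OF q]
  have t: "cross R (q (e2 R)) (q (e3 R)) = q (e1 R)" "cross R (q (e3 R)) (q (e1 R)) = q (e2 R)"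
    "cross R (q (e1 R)) (q (e2 R)) = q (e3 R)"
    using cross_hom_triple[OF q] by (simp_all add: cross_triple_def)
  have d: "dot R x (q (e1 R)) = \<zero>" "dot R x (q (e2 R)) = \<zero>" "dot R x (q (e3 R)) = \<zero>"
    using triple_product[of x "q (e2 R)" "q (e3 R)"] triple_product[of x "q (e3 R)" "q (e1 R)"]
      triple_product[of x "q (e1 R)" "q (e2 R)"] x by (simp_all add: t orth)
  have "cross R (q (e1 R)) x = vzero R"
    using cross_anticomm[of x "q (e1 R)"] x orth by simp
  then have "vadd R (vzero R) (smul R (csupp q) x) = smul R (dot R (q (e1 R)) x) (q (e1 R))"
    using cross_cross[of "q (e1 R)" "q (e1 R)" x] x by (simp add: csupp_def)
  then show "smul R (csupp q) x = vzero R"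
    using d x q by (simp add: dot_comm[of "q (e1 R)" x])
  fix u assume u: "u \<in> vec3s R"
  obtain a b c where ud: "u = Vec3 a b c" by (cases u)
  then show "dot R x (q u) = \<zero>"
    using u x d by (subst cross_hom_lcomb[OF q u]) (simp add: dot_add dot_smul)
qed

text \<open>Each support annihilates the image of the other map, so \<open>csupp p + csupp q\<close>
  fixes every sum of values of \<open>p\<close> and \<open>q\<close>. In particular it fixes
  \<open>e1\<close>, which forces it to be \<open>1\<close>. The sum of the two mutually orthogonal
  triples then has norm \<open>1\<close>.\<close>

lemma cross_hom_pair:
  assumes p: "p \<in> cross_hom R" and q: "q \<in> cross_hom R"
    and orth: "\<forall>u\<in>vec3s R. \<forall>v\<in>vec3s R. cross R (p u) (q v) = vzero R"
    and surj: "\<exists>u\<in>vec3s R. \<exists>v\<in>vec3s R. vadd R (p u) (q v) = e1 R"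
  shows "u \<in> vec3s R \<Longrightarrow> smul R (csupp q) (p u) = vzero R"
    and "u \<in> vec3s R \<Longrightarrow> smul R (csupp p) (q u) = vzero R"
    and "csupp p \<oplus> csupp q = \<one>"
    and "Vec3 (vadd R (p (e1 R)) (q (e1 R))) (vadd R (p (e2 R)) (q (e2 R))) (vadd R (p (e3 R)) (q (e3 R))) \<in> frames R"
proof -
  note cl [simp] = cross_homD(1)[OF p] cross_homD(1)[OF q]
  have orth': "cross R (q v) (p u) = vzero R" if "u \<in> vec3s R" "v \<in> vec3s R" for u v
    using that cross_anticomm[of "p u" "q v"] orth by simp
  have 1: "smul R (csupp q) (p u) = vzero R" if "u \<in> vec3s R" for u
    using csupp_annihilates(1)[OF q, of "p u"] that orth by simp
  have 2: "smul R (csupp p) (q u) = vzero R" if "u \<in> vec3s R" for u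
    using csupp_annihilates(1)[OF p, of "q u"] that orth' by simp
  show "u \<in> vec3s R \<Longrightarrow> smul R (csupp q) (p u) = vzero R" "u \<in> vec3s R \<Longrightarrow> smul R (csupp p) (q u) = vzero R"
    by (fact 1 2)+
  obtain u v where uv: "u \<in> vec3s R" "v \<in> vec3s R" "vadd R (p u) (q v) = e1 R"
    using surj by blast
  have "smul R (csupp p \<oplus> csupp q) (vadd R (p u) (q v)) = vadd R (p u) (q v)"
    using uv(1,2) p q by (simp add: add_smul smul_add csupp_fixes 1 2)
  then have "smul R (csupp p \<oplus> csupp q) (e1 R) = e1 R"
    using uv(3) by simp
  then show s: "csupp p \<oplus> csupp q = \<one>"
    using p q by (simp add: e1_def)
  have c: "cross R (vadd R (p u) (q u)) (vadd R (p v) (q v)) = vadd R (p (cross R u v)) (q (cross R u v))"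
    if "u \<in> vec3s R" "v \<in> vec3s R" for u v
    using that by (simp add: cross_add orth orth' cross_homD(4)[OF p] cross_homD(4)[OF q])
  have d: "dot R (p u) (q v) = \<zero>" if "u \<in> vec3s R" "v \<in> vec3s R" for u v
    using csupp_annihilates(2)[OF q, of "p u" v] that orth by simp
  have "dot R (vadd R (p (e1 R)) (q (e1 R))) (vadd R (p (e1 R)) (q (e1 R))) = csupp p \<oplus> csupp q"
    using d[of "e1 R" "e1 R"] p q by (simp add: dot_add dot_comm[of "q (e1 R)" "p (e1 R)"] flip: csupp_def)
  then show "Vec3 (vadd R (p (e1 R)) (q (e1 R))) (vadd R (p (e2 R)) (q (e2 R))) (vadd R (p (e3 R)) (q (e3 R))) \<in> frames R"
    using c cross_triple_basis s by (simp add: Vec3_in_frames cross_triple_def)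
qed

end

section \<open>Coordinates on the Lorentz type algebra\<close>

text \<open>The elements \<open>-b4, -b5, -b6\<close> act as rotations \<open>J1, J2, J3\<close> and
  \<open>-b3, b2, -b1\<close> as boosts \<open>K1, K2, K3\<close>: \<open>[J1, J2] = J3\<close>,
  \<open>[J1, K2] = K3\<close>, \<open>[K1, K2] = -J3\<close>, and cyclically. The map with
  parameter \<open>j\<close> sends \<open>Jk\<close> to the \<open>k\<close>-th basis vector and
  \<open>Kk\<close> to \<open>j\<close> times that vector.\<close>

definition lvec :: "('a, 'm) ring_scheme \<Rightarrow> 'a \<Rightarrow> (nat \<Rightarrow> 'a) \<Rightarrow> 'a vec3" where
  "lvec R j x = Vec3 (\<ominus>\<^bsub>R\<^esub> x 4 \<ominus>\<^bsub>R\<^esub> j \<otimes>\<^bsub>R\<^esub> x 3) (j \<otimes>\<^bsub>R\<^esub> x 2 \<ominus>\<^bsub>R\<^esub> x 5) (\<ominus>\<^bsub>R\<^esub> x 6 \<ominus>\<^bsub>R\<^esub> j \<otimes>\<^bsub>R\<^esub> x 1)"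

text \<open>Half the sum of the two images recovers the rotation part, the difference divided by
  \<open>2 i\<close> the boost part. Division by \<open>i\<close> is multiplication by
  \<open>-i\<close>; together with the signs in the boosts this fixes the order of the
  differences.\<close>

fun lunvec :: "('a, 'm) ring_scheme \<Rightarrow> 'a \<Rightarrow> 'a \<Rightarrow> 'a vec3 \<Rightarrow> 'a vec3 \<Rightarrow> nat \<Rightarrow> 'a" where
  "lunvec R i h (Vec3 a b c) (Vec3 a' b' c') = (\<lambda>k\<in>{1..6}.
     if k = 1 then h \<otimes>\<^bsub>R\<^esub> (i \<otimes>\<^bsub>R\<^esub> (c \<ominus>\<^bsub>R\<^esub> c'))
     else if k = 2 then h \<otimes>\<^bsub>R\<^esub> (i \<otimes>\<^bsub>R\<^esub> (b' \<ominus>\<^bsub>R\<^esub> b))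
     else if k = 3 then h \<otimes>\<^bsub>R\<^esub> (i \<otimes>\<^bsub>R\<^esub> (a \<ominus>\<^bsub>R\<^esub> a'))
     else if k = 4 then \<ominus>\<^bsub>R\<^esub> (h \<otimes>\<^bsub>R\<^esub> (a \<oplus>\<^bsub>R\<^esub> a'))
     else if k = 5 then \<ominus>\<^bsub>R\<^esub> (h \<otimes>\<^bsub>R\<^esub> (b \<oplus>\<^bsub>R\<^esub> b'))
     else \<ominus>\<^bsub>R\<^esub> (h \<otimes>\<^bsub>R\<^esub> (c \<oplus>\<^bsub>R\<^esub> c')))"

lemma atLeastAtMost_1_6: "{1..6::nat} = {1, 2, 3, 4, 5, 6}"
  by auto

lemma carrier_lorentz: "carrier (lorentz_alg R) = {1..6} \<rightarrow>\<^sub>E carrier R"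
  by (simp add: lorentz_alg_def)

lemma lorentz_ext:
  assumes "x \<in> carrier (lorentz_alg R)" "y \<in> carrier (lorentz_alg R)"
    and "x 1 = y 1" "x 2 = y 2" "x 3 = y 3" "x 4 = y 4" "x 5 = y 5" "x 6 = y 6"
  shows "x = y"
proof (rule PiE_ext)
  show "x \<in> {1..6} \<rightarrow>\<^sub>E carrier R" "y \<in> {1..6} \<rightarrow>\<^sub>E carrier R"
    using assms(1,2) by (simp_all add: carrier_lorentz)
  show "x k = y k" if "k \<in> {1..6}" for k
    using that assms(3-8) unfolding atLeastAtMost_1_6 by blast
qed

lemma lorentz_coord [simp]:
  assumes "x \<in> carrier (lorentz_alg R)"
  shows "x 1 \<in> carrier R" "x (Suc 0) \<in> carrier R" "x 2 \<in> carrier R" "x 3 \<in> carrier R"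
    "x 4 \<in> carrier R" "x 5 \<in> carrier R" "x 6 \<in> carrier R"
  using assms by (auto simp: carrier_lorentz PiE_iff)

lemma lorentz_add:
  "k \<in> {1..6} \<Longrightarrow> (x \<oplus>\<^bsub>lorentz_alg R\<^esub> y) k = x k \<oplus>\<^bsub>R\<^esub> y k"
  by (simp add: lorentz_alg_def)

lemma lorentz_smult:
  "k \<in> {1..6} \<Longrightarrow> (a \<odot>\<^bsub>lorentz_alg R\<^esub> x) k = a \<otimes>\<^bsub>R\<^esub> x k"
  by (simp add: lorentz_alg_def)

context cring
begin

abbreviation "LA \<equiv> lorentz_alg R"

lemma finsum_1_6:
  assumes "f \<in> {1..6::nat} \<rightarrow> carrier R"
  shows "(\<Oplus>k\<in>{1..6}. f k) = f 1 \<oplus> (f 2 \<oplus> (f 3 \<oplus> (f 4 \<oplus> (f 5 \<oplus> f 6))))"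
  using assms unfolding atLeastAtMost_1_6 by (simp add: Pi_iff)

lemma lorentz_closed [simp]:
  assumes x: "x \<in> carrier LA" and y: "y \<in> carrier LA"
  shows "x \<oplus>\<^bsub>LA\<^esub> y \<in> carrier LA" "a \<in> carrier R \<Longrightarrow> a \<odot>\<^bsub>LA\<^esub> x \<in> carrier LA" "x \<otimes>\<^bsub>LA\<^esub> y \<in> carrier LA"
proof -
  have c: "x k \<in> carrier R" "y k \<in> carrier R" if "k \<in> {1..6}" for k
    using that x y by (auto simp: carrier_lorentz)
  show "x \<oplus>\<^bsub>LA\<^esub> y \<in> carrier LA" "a \<in> carrier R \<Longrightarrow> a \<odot>\<^bsub>LA\<^esub> x \<in> carrier LA" "x \<otimes>\<^bsub>LA\<^esub> y \<in> carrier LA"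
    using c by (auto simp: lorentz_alg_def intro!: finsum_closed add.int_pow_closed)
qed

lemma lorentz_bracket:
  assumes x: "x \<in> carrier LA" and y: "y \<in> carrier LA"
  shows "(x \<otimes>\<^bsub>LA\<^esub> y) 1 = \<ominus> (x 2 \<otimes> y 4) \<oplus> x 4 \<otimes> y 2 \<ominus> x 3 \<otimes> y 5 \<oplus> x 5 \<otimes> y 3"
    "(x \<otimes>\<^bsub>LA\<^esub> y) 2 = x 1 \<otimes> y 4 \<ominus> x 4 \<otimes> y 1 \<ominus> x 3 \<otimes> y 6 \<oplus> x 6 \<otimes> y 3"
    "(x \<otimes>\<^bsub>LA\<^esub> y) 3 = x 1 \<otimes> y 5 \<ominus> x 5 \<otimes> y 1 \<oplus> x 2 \<otimes> y 6 \<ominus> x 6 \<otimes> y 2"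
    "(x \<otimes>\<^bsub>LA\<^esub> y) 4 = x 1 \<otimes> y 2 \<ominus> x 2 \<otimes> y 1 \<ominus> x 5 \<otimes> y 6 \<oplus> x 6 \<otimes> y 5"
    "(x \<otimes>\<^bsub>LA\<^esub> y) 5 = x 1 \<otimes> y 3 \<ominus> x 3 \<otimes> y 1 \<oplus> x 4 \<otimes> y 6 \<ominus> x 6 \<otimes> y 4"
    "(x \<otimes>\<^bsub>LA\<^esub> y) 6 = x 2 \<otimes> y 3 \<ominus> x 3 \<otimes> y 2 \<ominus> x 4 \<otimes> y 5 \<oplus> x 5 \<otimes> y 4"
proof -
  note [simp] = lorentz_coord[OF x] lorentz_coord[OF y]
  have c: "x k \<in> carrier R" "y k \<in> carrier R" if "k \<in> {1..6}" for k
    using that x y by (auto simp: carrier_lorentz)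
  \<comment> \<open>The structure constants are \<open>0\<close>, \<open>1\<close> and
    \<open>-1\<close>, so only these multiples occur among the 36 terms of a coordinate.\<close>
  have pow: "add_pow R (0::int) a = \<zero>" "add_pow R (1::int) a = a" "add_pow R (- 1 :: int) a = \<ominus> a"
    if "a \<in> carrier R" for a
    using that add.int_pow_neg[of a 1] by (simp_all, simp_all add: add_pow_def int_pow_def2)
  define g where "g k i j = add_pow R (lorentz_coeff i j k) (x i \<otimes> y j)" for k i j
  have g: "g k i j \<in> carrier R" if "i \<in> {1..6}" "j \<in> {1..6}" for k i j
    using that c by (simp add: g_def add.int_pow_closed)
  have inner: "(\<Oplus>j\<in>{1..6}. g k i j) = g k i 1 \<oplus> (g k i 2 \<oplus> (g k i 3 \<oplus> (g k i 4 \<oplus> (g k i 5 \<oplus> g k i 6))))"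
    if "i \<in> {1..6}" for k i
    using g[OF that] by (intro finsum_1_6) blast
  have outer: "(\<Oplus>i\<in>{1..6}. \<Oplus>j\<in>{1..6}. g k i j) = (\<Oplus>j\<in>{1..6}. g k 1 j) \<oplus> ((\<Oplus>j\<in>{1..6}. g k 2 j) \<oplus>
      ((\<Oplus>j\<in>{1..6}. g k 3 j) \<oplus> ((\<Oplus>j\<in>{1..6}. g k 4 j) \<oplus> ((\<Oplus>j\<in>{1..6}. g k 5 j) \<oplus> (\<Oplus>j\<in>{1..6}. g k 6 j)))))" for k
    using g by (intro finsum_1_6) (blast intro: finsum_closed)
  have e: "(x \<otimes>\<^bsub>LA\<^esub> y) k = (\<Oplus>i\<in>{1..6}. \<Oplus>j\<in>{1..6}. g k i j)" if "k \<in> {1..6}" for k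
    using that by (simp add: lorentz_alg_def g_def)
  have m: "1 \<in> {1..6::nat}" "2 \<in> {1..6::nat}" "3 \<in> {1..6::nat}" "4 \<in> {1..6::nat}" "5 \<in> {1..6::nat}" "6 \<in> {1..6::nat}"
    by auto
  note ev = outer inner[OF m(1)] inner[OF m(2)] inner[OF m(3)] inner[OF m(4)] inner[OF m(5)] inner[OF m(6)]
  note cf = g_def lorentz_coeff_def lorentz_table_def pow
  show "(x \<otimes>\<^bsub>LA\<^esub> y) 1 = \<ominus> (x 2 \<otimes> y 4) \<oplus> x 4 \<otimes> y 2 \<ominus> x 3 \<otimes> y 5 \<oplus> x 5 \<otimes> y 3"
    unfolding e[OF m(1)] ev by (simp add: cf) (simp add: minus_eq a_ac)
  show "(x \<otimes>\<^bsub>LA\<^esub> y) 2 = x 1 \<otimes> y 4 \<ominus> x 4 \<otimes> y 1 \<ominus> x 3 \<otimes> y 6 \<oplus> x 6 \<otimes> y 3"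
    unfolding e[OF m(2)] ev by (simp add: cf) (simp add: minus_eq a_ac)
  show "(x \<otimes>\<^bsub>LA\<^esub> y) 3 = x 1 \<otimes> y 5 \<ominus> x 5 \<otimes> y 1 \<oplus> x 2 \<otimes> y 6 \<ominus> x 6 \<otimes> y 2"
    unfolding e[OF m(3)] ev by (simp add: cf) (simp add: minus_eq a_ac)
  show "(x \<otimes>\<^bsub>LA\<^esub> y) 4 = x 1 \<otimes> y 2 \<ominus> x 2 \<otimes> y 1 \<ominus> x 5 \<otimes> y 6 \<oplus> x 6 \<otimes> y 5"
    unfolding e[OF m(4)] ev by (simp add: cf) (simp add: minus_eq a_ac)
  show "(x \<otimes>\<^bsub>LA\<^esub> y) 5 = x 1 \<otimes> y 3 \<ominus> x 3 \<otimes> y 1 \<oplus> x 4 \<otimes> y 6 \<ominus> x 6 \<otimes> y 4"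
    unfolding e[OF m(5)] ev by (simp add: cf) (simp add: minus_eq a_ac)
  show "(x \<otimes>\<^bsub>LA\<^esub> y) 6 = x 2 \<otimes> y 3 \<ominus> x 3 \<otimes> y 2 \<ominus> x 4 \<otimes> y 5 \<oplus> x 5 \<otimes> y 4"
    unfolding e[OF m(6)] ev by (simp add: cf) (simp add: minus_eq a_ac)
qed

lemma lvec_closed [simp]: "j \<in> carrier R \<Longrightarrow> x \<in> carrier LA \<Longrightarrow> lvec R j x \<in> vec3s R"
  by (simp add: lvec_def)

lemma lvec_add:
  assumes "j \<in> carrier R" "x \<in> carrier LA" "y \<in> carrier LA"
  shows "lvec R j (x \<oplus>\<^bsub>LA\<^esub> y) = vadd R (lvec R j x) (lvec R j y)"
  using assms by (simp add: lvec_def lorentz_add minus_eq minus_add r_distr a_ac)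

lemma lvec_smult:
  assumes "j \<in> carrier R" "a \<in> carrier R" "x \<in> carrier LA"
  shows "lvec R j (a \<odot>\<^bsub>LA\<^esub> x) = smul R a (lvec R j x)"
  using assms by (simp add: lvec_def lorentz_smult minus_eq r_distr r_minus m_lcomm)

text \<open>The parameter enters through \<open>j j = -1\<close>, which holds for \<open>i\<close>
  as well as for \<open>-i\<close>. As with the Pauli matrices, \<open>j j\<close> is isolated in
  each coordinate before it is replaced.\<close>

lemma lvec_bracket:
  assumes j: "j \<in> carrier R" "j \<otimes> j = \<ominus> \<one>" and x: "x \<in> carrier LA" and y: "y \<in> carrier LA"
  shows "lvec R j (x \<otimes>\<^bsub>LA\<^esub> y) = cross R (lvec R j x) (lvec R j y)"
proof -
  obtain x1 x2 x3 x4 x5 x6 y1 y2 y3 y4 y5 y6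
    where xy: "x 1 = x1" "x 2 = x2" "x 3 = x3" "x 4 = x4" "x 5 = x5" "x 6 = x6"
      "y 1 = y1" "y 2 = y2" "y 3 = y3" "y 4 = y4" "y 5 = y5" "y 6 = y6"
    by blast
  have cl: "x1 \<in> carrier R" "x2 \<in> carrier R" "x3 \<in> carrier R" "x4 \<in> carrier R" "x5 \<in> carrier R" "x6 \<in> carrier R"
    "y1 \<in> carrier R" "y2 \<in> carrier R" "y3 \<in> carrier R" "y4 \<in> carrier R" "y5 \<in> carrier R" "y6 \<in> carrier R"
    using lorentz_coord[OF x] lorentz_coord[OF y] xy by auto
  have 1: "(j \<otimes> x2 \<ominus> x5) \<otimes> (\<ominus> y6 \<ominus> j \<otimes> y1) \<ominus> (\<ominus> x6 \<ominus> j \<otimes> x1) \<otimes> (j \<otimes> y2 \<ominus> y5) =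
      \<ominus> (x1 \<otimes> y2 \<ominus> x2 \<otimes> y1 \<ominus> x5 \<otimes> y6 \<oplus> x6 \<otimes> y5) \<ominus> j \<otimes> (x1 \<otimes> y5 \<ominus> x5 \<otimes> y1 \<oplus> x2 \<otimes> y6 \<ominus> x6 \<otimes> y2)"
    (is "?l = ?r")
  proof -
    have "?l = j \<otimes> j \<otimes> (x1 \<otimes> y2 \<ominus> x2 \<otimes> y1) \<ominus> (\<ominus> (x5 \<otimes> y6) \<oplus> x6 \<otimes> y5) \<ominus>
        j \<otimes> (x1 \<otimes> y5 \<ominus> x5 \<otimes> y1 \<oplus> x2 \<otimes> y6 \<ominus> x6 \<otimes> y2)"
      using cl j(1) by algebra
    also have "\<dots> = ?r"
      unfolding j(2) using cl j(1) by algebra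
    finally show ?thesis .
  qed
  have 2: "(\<ominus> x6 \<ominus> j \<otimes> x1) \<otimes> (\<ominus> y4 \<ominus> j \<otimes> y3) \<ominus> (\<ominus> x4 \<ominus> j \<otimes> x3) \<otimes> (\<ominus> y6 \<ominus> j \<otimes> y1) =
      j \<otimes> (x1 \<otimes> y4 \<ominus> x4 \<otimes> y1 \<ominus> x3 \<otimes> y6 \<oplus> x6 \<otimes> y3) \<ominus> (x1 \<otimes> y3 \<ominus> x3 \<otimes> y1 \<oplus> x4 \<otimes> y6 \<ominus> x6 \<otimes> y4)"
    (is "?l = ?r")
  proof -
    have "?l = j \<otimes> j \<otimes> (x1 \<otimes> y3 \<ominus> x3 \<otimes> y1) \<ominus> (x4 \<otimes> y6 \<ominus> x6 \<otimes> y4) \<oplus>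
        j \<otimes> (x1 \<otimes> y4 \<ominus> x4 \<otimes> y1 \<ominus> x3 \<otimes> y6 \<oplus> x6 \<otimes> y3)"
      using cl j(1) by algebra
    also have "\<dots> = ?r"
      unfolding j(2) using cl j(1) by algebra
    finally show ?thesis .
  qed
  have 3: "(\<ominus> x4 \<ominus> j \<otimes> x3) \<otimes> (j \<otimes> y2 \<ominus> y5) \<ominus> (j \<otimes> x2 \<ominus> x5) \<otimes> (\<ominus> y4 \<ominus> j \<otimes> y3) =
      \<ominus> (x2 \<otimes> y3 \<ominus> x3 \<otimes> y2 \<ominus> x4 \<otimes> y5 \<oplus> x5 \<otimes> y4) \<ominus> j \<otimes> (\<ominus> (x2 \<otimes> y4) \<oplus> x4 \<otimes> y2 \<ominus> x3 \<otimes> y5 \<oplus> x5 \<otimes> y3)"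
    (is "?l = ?r")
  proof -
    have "?l = j \<otimes> j \<otimes> (x2 \<otimes> y3 \<ominus> x3 \<otimes> y2) \<ominus> (\<ominus> (x4 \<otimes> y5) \<oplus> x5 \<otimes> y4) \<ominus>
        j \<otimes> (\<ominus> (x2 \<otimes> y4) \<oplus> x4 \<otimes> y2 \<ominus> x3 \<otimes> y5 \<oplus> x5 \<otimes> y3)"
      using cl j(1) by algebra
    also have "\<dots> = ?r"
      unfolding j(2) using cl j(1) by algebra
    finally show ?thesis .
  qed
  show ?thesis
    unfolding lvec_def lorentz_bracket[OF x y] cross.simps xy 1 2 3 ..
qed

end

section \<open>Automorphisms of the Lorentz type algebra\<close>

text \<open>The interchange selected by \<open>e\<close> acts before the rotations, as in the
  semidirect product, where the component in \<open>Z2\<close> stands on the right. The second copy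
  is blended in the opposite order.\<close>

definition lmap :: "('a, 'm) ring_scheme \<Rightarrow> 'a \<Rightarrow> 'a \<Rightarrow> 'a vec3 vec3 \<Rightarrow> 'a vec3 vec3 \<Rightarrow> 'a \<Rightarrow>
    (nat \<Rightarrow> 'a) \<Rightarrow> (nat \<Rightarrow> 'a)" where
  "lmap R i h U V e = (\<lambda>x\<in>carrier (lorentz_alg R). lunvec R i h
     (lcomb R U (vblend R e (lvec R i x) (lvec R (\<ominus>\<^bsub>R\<^esub> i) x)))
     (lcomb R V (vblend R e (lvec R (\<ominus>\<^bsub>R\<^esub> i) x) (lvec R i x))))"

definition idems :: "('a, 'm) ring_scheme \<Rightarrow> 'a set" where
  "idems R = {e \<in> carrier R. e \<otimes>\<^bsub>R\<^esub> e = e}"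

text \<open>The symmetric difference of two idempotents, which is the group law on the points of the
  constant group of order two.\<close>

definition isum :: "('a, 'm) ring_scheme \<Rightarrow> 'a \<Rightarrow> 'a \<Rightarrow> 'a" where
  "isum R e e' = (\<one>\<^bsub>R\<^esub> \<ominus>\<^bsub>R\<^esub> e) \<otimes>\<^bsub>R\<^esub> e' \<oplus>\<^bsub>R\<^esub> e \<otimes>\<^bsub>R\<^esub> (\<one>\<^bsub>R\<^esub> \<ominus>\<^bsub>R\<^esub> e')"

context quat_ring
begin

abbreviation "V1 \<equiv> lvec R i"
abbreviation "V2 \<equiv> lvec R (\<ominus> i)"
abbreviation "W \<equiv> lunvec R i h"

lemma neg_i_sq: "\<ominus> i \<otimes> \<ominus> i = \<ominus> \<one>"
  by (simp add: l_minus r_minus i_sq)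

lemmas V_bracket = lvec_bracket[OF i_closed i_sq] lvec_bracket[OF a_inv_closed[OF i_closed] neg_i_sq]

lemma W_closed [simp]:
  assumes "a \<in> vec3s R" "b \<in> vec3s R" shows "W a b \<in> carrier LA"
  using assms by (cases a; cases b) (auto simp: carrier_lorentz)

lemma V_W:
  assumes "a \<in> vec3s R" "b \<in> vec3s R"
  shows "V1 (W a b) = a" "V2 (W a b) = b"
proof -
  obtain a1 a2 a3 b1 b2 b3 where ab: "a = Vec3 a1 a2 a3" "b = Vec3 b1 b2 b3"
    by (meson vec3.exhaust)
  have cl: "a1 \<in> carrier R" "a2 \<in> carrier R" "a3 \<in> carrier R" "b1 \<in> carrier R" "b2 \<in> carrier R" "b3 \<in> carrier R"
    using assms by (simp_all add: ab)
  have 1: "\<ominus> (\<ominus> (h \<otimes> (p \<oplus> q))) \<ominus> i \<otimes> (h \<otimes> (i \<otimes> (p \<ominus> q))) = p"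
    if pq: "p \<in> carrier R" "q \<in> carrier R" for p q
  proof -
    have "\<ominus> (\<ominus> (h \<otimes> (p \<oplus> q))) \<ominus> i \<otimes> (h \<otimes> (i \<otimes> (p \<ominus> q))) = h \<otimes> (p \<oplus> q) \<ominus> i \<otimes> i \<otimes> (h \<otimes> (p \<ominus> q))"
      using pq i_closed h_closed by algebra
    also have "\<dots> = h \<otimes> (p \<oplus> p)"
      unfolding i_sq using pq h_closed by algebra
    finally show ?thesis
      using pq by (simp add: half_double)
  qed
  have 2: "\<ominus> (\<ominus> (h \<otimes> (p \<oplus> q))) \<ominus> \<ominus> i \<otimes> (h \<otimes> (i \<otimes> (p \<ominus> q))) = q"
    if pq: "p \<in> carrier R" "q \<in> carrier R" for p q
  proof -
    have "\<ominus> (\<ominus> (h \<otimes> (p \<oplus> q))) \<ominus> \<ominus> i \<otimes> (h \<otimes> (i \<otimes> (p \<ominus> q))) = h \<otimes> (p \<oplus> q) \<oplus> i \<otimes> i \<otimes> (h \<otimes> (p \<ominus> q))"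
      using pq i_closed h_closed by algebra
    also have "\<dots> = h \<otimes> (q \<oplus> q)"
      unfolding i_sq using pq h_closed by algebra
    finally show ?thesis
      using pq by (simp add: half_double)
  qed
  have "i \<otimes> (h \<otimes> (i \<otimes> (b2 \<ominus> a2))) \<ominus> \<ominus> (h \<otimes> (a2 \<oplus> b2)) = \<ominus> (\<ominus> (h \<otimes> (a2 \<oplus> b2))) \<ominus> i \<otimes> (h \<otimes> (i \<otimes> (a2 \<ominus> b2)))"
    "\<ominus> i \<otimes> (h \<otimes> (i \<otimes> (b2 \<ominus> a2))) \<ominus> \<ominus> (h \<otimes> (a2 \<oplus> b2)) = \<ominus> (\<ominus> (h \<otimes> (a2 \<oplus> b2))) \<ominus> \<ominus> i \<otimes> (h \<otimes> (i \<otimes> (a2 \<ominus> b2)))"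
    using cl i_closed h_closed by algebra+
  then show "V1 (W a b) = a" "V2 (W a b) = b"
    using 1 2 cl by (simp_all add: ab lvec_def)
qed

text \<open>Half the sum and half the difference of conjugate coordinates recover the original
  entries. Identities in the Lorentz algebra can thereby be checked on each copy separately.\<close>

lemma V_inject:
  assumes x: "x \<in> carrier LA" and y: "y \<in> carrier LA" and V: "V1 x = V1 y" "V2 x = V2 y"
  shows "x = y"
proof -
  note cx = lorentz_coord[OF x] and cy = lorentz_coord[OF y]
  have i_cancel: "p = q" if pq: "p \<in> carrier R" "q \<in> carrier R" and eq: "i \<otimes> p = i \<otimes> q" for p q
  proof -
    have "i \<otimes> (i \<otimes> r) = \<ominus> r" if "r \<in> carrier R" for r
      using that by (simp add: m_assoc[symmetric] i_sq l_minus)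
    then have "\<ominus> p = \<ominus> q"
      using eq pq by metis
    then show ?thesis
      using pq by (metis minus_minus)
  qed
  have *: "p = p' \<and> q = q'"
    if cl: "p \<in> carrier R" "q \<in> carrier R" "p' \<in> carrier R" "q' \<in> carrier R"
      and e: "\<ominus> p \<ominus> i \<otimes> q = \<ominus> p' \<ominus> i \<otimes> q'" "\<ominus> p \<ominus> \<ominus> i \<otimes> q = \<ominus> p' \<ominus> \<ominus> i \<otimes> q'" for p q p' q'
  proof -
    have "h \<otimes> ((\<ominus> r \<ominus> i \<otimes> t) \<oplus> (\<ominus> r \<ominus> \<ominus> i \<otimes> t)) = \<ominus> r" "h \<otimes> ((\<ominus> r \<ominus> \<ominus> i \<otimes> t) \<ominus> (\<ominus> r \<ominus> i \<otimes> t)) = i \<otimes> t"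
      if rt: "r \<in> carrier R" "t \<in> carrier R" for r t
    proof -
      have "(\<ominus> r \<ominus> i \<otimes> t) \<oplus> (\<ominus> r \<ominus> \<ominus> i \<otimes> t) = (\<ominus> r) \<oplus> (\<ominus> r)"
        "(\<ominus> r \<ominus> \<ominus> i \<otimes> t) \<ominus> (\<ominus> r \<ominus> i \<otimes> t) = i \<otimes> t \<oplus> i \<otimes> t"
        using rt i_closed by algebra+
      then show "h \<otimes> ((\<ominus> r \<ominus> i \<otimes> t) \<oplus> (\<ominus> r \<ominus> \<ominus> i \<otimes> t)) = \<ominus> r" "h \<otimes> ((\<ominus> r \<ominus> \<ominus> i \<otimes> t) \<ominus> (\<ominus> r \<ominus> i \<otimes> t)) = i \<otimes> t"
        using rt by (simp_all only: half_double a_inv_closed m_closed i_closed)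
    qed
    from this[OF cl(1,2)] this[OF cl(3,4)] have "\<ominus> p = \<ominus> p'" "i \<otimes> q = i \<otimes> q'"
      using e by simp_all
    then show ?thesis
      using cl i_cancel by (metis minus_minus)
  qed
  have neg: "\<ominus> p \<ominus> i \<otimes> \<ominus> q = i \<otimes> q \<ominus> p" "\<ominus> p \<ominus> \<ominus> i \<otimes> \<ominus> q = \<ominus> i \<otimes> q \<ominus> p"
    if "p \<in> carrier R" "q \<in> carrier R" for p q
    using that i_closed by algebra+
  have "x 4 = y 4 \<and> x 3 = y 3" "x 6 = y 6 \<and> x 1 = y 1"
    using V cx cy by (intro *; simp add: lvec_def)+
  moreover have "x 5 = y 5 \<and> \<ominus> x 2 = \<ominus> y 2"
    using V cx cy by (intro *; simp add: lvec_def neg)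
  then have "x 5 = y 5" "x 2 = y 2"
    using cx cy by (metis minus_minus)+
  ultimately show ?thesis
    using lorentz_ext[OF x y] by blast
qed

lemma W_V: "x \<in> carrier LA \<Longrightarrow> W (V1 x) (V2 x) = x"
  by (rule V_inject) (simp_all add: V_W)

lemma idemsD [dest]: "e \<in> idems R \<Longrightarrow> e \<in> carrier R" "e \<in> idems R \<Longrightarrow> e \<otimes> e = e"
  by (simp_all add: idems_def)

abbreviation "LM \<equiv> lmap R i h"

lemma lmap_closed [simp]:
  assumes "U \<in> frames R" "V \<in> frames R" "e \<in> idems R" "x \<in> carrier LA"
  shows "LM U V e x \<in> carrier LA"
  using assms idemsD[OF assms(3)] by (simp add: lmap_def)

lemma V_lmap:
  assumes "U \<in> frames R" "V \<in> frames R" "e \<in> idems R" "x \<in> carrier LA"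
  shows "V1 (LM U V e x) = lcomb R U (vblend R e (V1 x) (V2 x))"
    "V2 (LM U V e x) = lcomb R V (vblend R e (V2 x) (V1 x))"
  using assms idemsD[OF assms(3)] by (simp_all add: lmap_def V_W)

lemma lmap_aut:
  assumes U: "U \<in> frames R" and V: "V \<in> frames R" and e: "e \<in> idems R"
  shows "LM U V e \<in> carrier (lie_aut R LA)"
proof -
  note [simp] = V_lmap[OF U V e] lmap_closed[OF U V e] U V idemsD(1)[OF e]
  note ee = idemsD(2)[OF e]
  have "bij_betw (LM U V e) (carrier LA) (carrier LA)"
  proof (rule bij_betwI)
    \<comment> \<open>The rotations are undone by their transposes, and the interchange is its own
      inverse by \<open>vblend_involutive\<close>.\<close>
    let ?g = "\<lambda>x. W (vblend R e (finv R U (V1 x)) (finv R V (V2 x))) (vblend R e (finv R V (V2 x)) (finv R U (V1 x)))"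
    show "LM U V e \<in> carrier LA \<rightarrow> carrier LA" "?g \<in> carrier LA \<rightarrow> carrier LA"
      by auto
    show "?g (LM U V e x) = x" if "x \<in> carrier LA" for x
      using that by (intro V_inject) (simp_all add: V_W finv_lcomb vblend_involutive ee)
    show "LM U V e (?g x) = x" if "x \<in> carrier LA" for x
      using that by (intro V_inject) (simp_all add: V_W lcomb_finv vblend_involutive ee)
  qed
  moreover have "LM U V e (x \<oplus>\<^bsub>LA\<^esub> y) = LM U V e x \<oplus>\<^bsub>LA\<^esub> LM U V e y" if "x \<in> carrier LA" "y \<in> carrier LA" for x y
    using that by (intro V_inject) (simp_all add: lvec_add lcomb_vadd flip: vadd_vblend)
  moreover have "LM U V e (a \<odot>\<^bsub>LA\<^esub> x) = a \<odot>\<^bsub>LA\<^esub> LM U V e x" if "a \<in> carrier R" "x \<in> carrier LA" for a x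
    using that by (intro V_inject) (simp_all add: lvec_smult lcomb_smul lorentz_closed(2)[OF that(2) that(2)] flip: smul_vblend)
  moreover have "LM U V e (x \<otimes>\<^bsub>LA\<^esub> y) = LM U V e x \<otimes>\<^bsub>LA\<^esub> LM U V e y" if "x \<in> carrier LA" "y \<in> carrier LA" for x y
    using that by (intro V_inject) (simp_all add: V_bracket lcomb_cross ee flip: vblend_cross)
  moreover have "LM U V e \<in> extensional (carrier LA)"
    by (simp add: lmap_def)
  ultimately show ?thesis
    by (simp add: lie_aut_def Bij_def)
qed

lemma lmap_inject:
  assumes U: "U \<in> frames R" and V: "V \<in> frames R" and e: "e \<in> idems R"
    and U': "U' \<in> frames R" and V': "V' \<in> frames R" and e': "e' \<in> idems R"
    and eq: "LM U V e = LM U' V' e'"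
  shows "U = U'" "V = V'" "e = e'"
proof -
  note [simp] = idemsD(1)[OF e] idemsD(1)[OF e']
  obtain u v w where Ud: "U = Vec3 u v w" by (cases U)
  obtain u' v' w' where Ud': "U' = Vec3 u' v' w'" by (cases U')
  obtain x y z where Vd: "V = Vec3 x y z" by (cases V)
  obtain x' y' z' where Vd': "V' = Vec3 x' y' z'" by (cases V')
  \<comment> \<open>On a pair with equal components the interchange is invisible, which isolates the
    frames.\<close>
  have same: "lcomb R U a = lcomb R U' a" "lcomb R V a = lcomb R V' a" if a: "a \<in> vec3s R" for a
    using V_lmap[OF U V e, of "W a a"] V_lmap[OF U' V' e', of "W a a"] a eq
    by (simp_all add: V_W vblend_same)
  then show UU: "U = U'" and VV: "V = V'"
    using lcomb_basis[OF U[unfolded Ud]] lcomb_basis[OF U'[unfolded Ud']]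
      lcomb_basis[OF V[unfolded Vd]] lcomb_basis[OF V'[unfolded Vd']]
    unfolding Ud Ud' Vd Vd' by (metis vec3_closed(6-8))+
  \<comment> \<open>The interchange sends the pair \<open>(0, e1)\<close> to one whose first
    component is \<open>e e1\<close>, so cancelling the rotation exposes \<open>e\<close>.\<close>
  have "lcomb R U (vblend R e (vzero R) (e1 R)) = lcomb R U (vblend R e' (vzero R) (e1 R))"
    using V_lmap(1)[OF U V e, of "W (vzero R) (e1 R)"] V_lmap(1)[OF U' V' e', of "W (vzero R) (e1 R)"] eq UU
    by (simp add: V_W)
  then have "vblend R e (vzero R) (e1 R) = vblend R e' (vzero R) (e1 R)"
    using finv_lcomb[OF U] by (metis vblend_closed \<open>e \<in> carrier R\<close> \<open>e' \<in> carrier R\<close> vec3_closed(5,6))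
  then show "e = e'"
    by (simp add: vblend_def) (simp add: e1_def)
qed

text \<open>Where \<open>e\<close> is \<open>1\<close> the sum is the complement of
  \<open>e'\<close>, where \<open>e\<close> is \<open>0\<close> it is \<open>e'\<close>. The
  products with \<open>e\<close> and \<open>1 - e\<close> express this in the form in which blends
  use it.\<close>

lemma isum_idems:
  assumes "e \<in> idems R" "e' \<in> idems R"
  shows "isum R e e' \<in> idems R"
    "e \<otimes> isum R e e' = e \<otimes> (\<one> \<ominus> e')" "e \<otimes> (\<one> \<ominus> isum R e e') = e \<otimes> e'"
    "(\<one> \<ominus> e) \<otimes> isum R e e' = (\<one> \<ominus> e) \<otimes> e'"
    "(\<one> \<ominus> e) \<otimes> (\<one> \<ominus> isum R e e') = (\<one> \<ominus> e) \<otimes> (\<one> \<ominus> e')"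
proof -
  note cl [simp] = idemsD(1)[OF assms(1)] idemsD(1)[OF assms(2)]
  note idc = idem_complement[OF cl(1) idemsD(2)[OF assms(1)]] idem_complement[OF cl(2) idemsD(2)[OF assms(2)]]
  have c: "\<one> \<ominus> e \<in> carrier R" "\<one> \<ominus> e' \<in> carrier R"
    by simp_all
  have s [simp]: "isum R e e' \<in> carrier R"
    by (simp add: isum_def)
  have "e \<otimes> isum R e e' = e \<otimes> (\<one> \<ominus> e) \<otimes> e' \<oplus> e \<otimes> e \<otimes> (\<one> \<ominus> e')"
    unfolding isum_def using cl c by (simp add: r_distr m_assoc)
  then show 1: "e \<otimes> isum R e e' = e \<otimes> (\<one> \<ominus> e')"
    using idc idemsD(2)[OF assms(1)] by simp
  have "(\<one> \<ominus> e) \<otimes> isum R e e' = (\<one> \<ominus> e) \<otimes> (\<one> \<ominus> e) \<otimes> e' \<oplus> (\<one> \<ominus> e) \<otimes> e \<otimes> (\<one> \<ominus> e')"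
    unfolding isum_def using cl c by (simp add: r_distr m_assoc)
  then show 2: "(\<one> \<ominus> e) \<otimes> isum R e e' = (\<one> \<ominus> e) \<otimes> e'"
    using idc by simp
  have "e \<otimes> (\<one> \<ominus> isum R e e') = e \<ominus> e \<otimes> isum R e e'"
    by (simp add: minus_eq r_distr r_minus)
  also have "\<dots> = e \<otimes> e'"
    unfolding 1 using cl by algebra
  finally show "e \<otimes> (\<one> \<ominus> isum R e e') = e \<otimes> e'" .
  have "(\<one> \<ominus> e) \<otimes> (\<one> \<ominus> isum R e e') = (\<one> \<ominus> e) \<ominus> (\<one> \<ominus> e) \<otimes> isum R e e'"
    using c by (simp add: minus_eq[of _ "isum R e e'"] minus_eq[of _ "_ \<otimes> _"] r_distr r_minus)
  also have "\<dots> = (\<one> \<ominus> e) \<otimes> (\<one> \<ominus> e')"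
    unfolding 2 using cl by algebra
  finally show "(\<one> \<ominus> e) \<otimes> (\<one> \<ominus> isum R e e') = (\<one> \<ominus> e) \<otimes> (\<one> \<ominus> e')" .
  have "isum R e e' \<otimes> isum R e e' = e' \<otimes> ((\<one> \<ominus> e) \<otimes> isum R e e') \<oplus> (\<one> \<ominus> e') \<otimes> (e \<otimes> isum R e e')"
    by (subst (1) isum_def) (use cl c s in \<open>simp add: l_distr r_distr m_ac\<close>)
  also have "\<dots> = (\<one> \<ominus> e) \<otimes> (e' \<otimes> e') \<oplus> e \<otimes> ((\<one> \<ominus> e') \<otimes> (\<one> \<ominus> e'))"
    unfolding 1 2 using cl c by (simp add: m_ac)
  also have "\<dots> = isum R e e'"
    using idc idemsD(2)[OF assms(2)] by (simp add: isum_def)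
  finally show "isum R e e' \<in> idems R"
    by (simp add: idems_def)
qed

text \<open>Moving the outer interchange past the inner rotations exchanges these where
  \<open>e\<close> is \<open>1\<close>, which \<open>fblend\<close> expresses. The two interchanges
  then combine to the one for \<open>isum R e e'\<close>.\<close>

lemma lmap_comp:
  assumes U: "U \<in> frames R" and V: "V \<in> frames R" and e: "e \<in> idems R"
    and U': "U' \<in> frames R" and V': "V' \<in> frames R" and e': "e' \<in> idems R"
  shows "compose (carrier LA) (LM U V e) (LM U' V' e') =
    LM (fcomp R U (fblend R e U' V')) (fcomp R V (fblend R e V' U')) (isum R e e')"
proof
  fix x
  note [simp] = idemsD(1)[OF e] idemsD(1)[OF e'] idemsD(1)[OF isum_idems(1)[OF e e']] U V U' V'
  have fr: "fblend R e U' V' \<in> frames R" "fblend R e V' U' \<in> frames R"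
    using fblend_frames idemsD(2)[OF e] by simp_all
  note fr' = fcomp_frames[OF U fr(1)] fcomp_frames[OF V fr(2)]
  \<comment> \<open>A blend sees its first argument only after multiplication by
    \<open>1 - e\<close> and its second only after multiplication by \<open>e\<close>. On each of
    these parts the inner blend agrees with the blend by \<open>isum R e e'\<close>.\<close>
  have key: "vblend R e (lcomb R A (vblend R e' a b)) (lcomb R B (vblend R e' b a)) =
      vblend R e (lcomb R A (vblend R (isum R e e') a b)) (lcomb R B (vblend R (isum R e e') a b))"
    if [simp]: "A \<in> frames R" "B \<in> frames R" "a \<in> vec3s R" "b \<in> vec3s R" for A B a b
  proof -
    have "smul R (\<one> \<ominus> e) (vblend R e' a b) = smul R (\<one> \<ominus> e) (vblend R (isum R e e') a b)"
      by (simp add: vblend_def smul_add smul_smul isum_idems[OF e e'])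
    moreover have "smul R e (vblend R e' b a) = smul R e (vblend R (isum R e e') a b)"
      by (simp add: vblend_def smul_add smul_smul isum_idems[OF e e'] vadd_comm)
    ultimately show ?thesis
      unfolding vblend_def[of R e] by (simp flip: lcomb_smul)
  qed
  show "compose (carrier LA) (LM U V e) (LM U' V' e') x =
      LM (fcomp R U (fblend R e U' V')) (fcomp R V (fblend R e V' U')) (isum R e e') x"
  proof (cases "x \<in> carrier LA")
    case True
    note [simp] = True lmap_closed[OF U' V' e' True] lmap_closed[OF U V e]
      lmap_closed[OF fr' isum_idems(1)[OF e e'] True]
    show ?thesis
    proof (rule V_inject)
      show "V1 (compose (carrier LA) (LM U V e) (LM U' V' e') x) =
          V1 (LM (fcomp R U (fblend R e U' V')) (fcomp R V (fblend R e V' U')) (isum R e e') x)"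
        by (simp add: compose_def V_lmap[OF U V e] V_lmap[OF U' V' e'] V_lmap[OF fr' isum_idems(1)[OF e e']]
            key lcomb_fcomp fr lcomb_fblend)
      show "V2 (compose (carrier LA) (LM U V e) (LM U' V' e') x) =
          V2 (LM (fcomp R U (fblend R e U' V')) (fcomp R V (fblend R e V' U')) (isum R e e') x)"
        by (simp add: compose_def V_lmap[OF U V e] V_lmap[OF U' V' e'] V_lmap[OF fr' isum_idems(1)[OF e e']]
            key lcomb_fcomp fr lcomb_fblend)
    qed (simp_all add: compose_def)
  next
    case False
    then show ?thesis
      by (simp add: compose_def lmap_def)
  qed
qed

section \<open>Automorphisms in block form\<close>

lemma lie_autD:
  assumes "f \<in> carrier (lie_aut R LA)"
  shows "x \<in> carrier LA \<Longrightarrow> f x \<in> carrier LA"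
    and "x \<in> carrier LA \<Longrightarrow> y \<in> carrier LA \<Longrightarrow> f (x \<oplus>\<^bsub>LA\<^esub> y) = f x \<oplus>\<^bsub>LA\<^esub> f y"
    and "a \<in> carrier R \<Longrightarrow> x \<in> carrier LA \<Longrightarrow> f (a \<odot>\<^bsub>LA\<^esub> x) = a \<odot>\<^bsub>LA\<^esub> f x"
    and "x \<in> carrier LA \<Longrightarrow> y \<in> carrier LA \<Longrightarrow> f (x \<otimes>\<^bsub>LA\<^esub> y) = f x \<otimes>\<^bsub>LA\<^esub> f y"
    and "bij_betw f (carrier LA) (carrier LA)" "f \<in> extensional (carrier LA)"
  using assms by (auto simp: lie_aut_def Bij_def bij_betw_def)

text \<open>The four blocks of an automorphism are homomorphisms of cross products, and blocks with
  the same target have commuting images because the two copies commute. Surjectivity makes the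
  supports complementary in each row, injectivity makes them disjoint in each column. All four are
  therefore determined by one idempotent \<open>e\<close>, the support of \<open>q\<close>.\<close>

lemma lmap_surj:
  assumes f: "f \<in> carrier (lie_aut R LA)"
  shows "\<exists>U\<in>frames R. \<exists>V\<in>frames R. \<exists>e\<in>idems R. f = LM U V e"
proof -
  note fD = lie_autD[OF f]
  note [simp] = fD(1)
  have i' [simp]: "\<ominus> i \<in> carrier R" by simp
  define p where "p a = V1 (f (W a (vzero R)))" for a
  define q where "q a = V1 (f (W (vzero R) a))" for a
  define r where "r a = V2 (f (W a (vzero R)))" for a
  define s where "s a = V2 (f (W (vzero R) a))" for a
  have Wadd: "W (vadd R a b) (vadd R c d) = W a c \<oplus>\<^bsub>LA\<^esub> W b d"
    if "a \<in> vec3s R" "b \<in> vec3s R" "c \<in> vec3s R" "d \<in> vec3s R" for a b c d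
    using that by (intro V_inject) (simp_all add: V_W lvec_add)
  have Wsmul: "W (smul R t a) (smul R t c) = t \<odot>\<^bsub>LA\<^esub> W a c"
    if "a \<in> vec3s R" "c \<in> vec3s R" "t \<in> carrier R" for a c t
    using that by (intro V_inject) (simp_all add: V_W lvec_smult lorentz_closed(2)[OF W_closed W_closed])
  have Wcross: "W (cross R a b) (cross R c d) = W a c \<otimes>\<^bsub>LA\<^esub> W b d"
    if "a \<in> vec3s R" "b \<in> vec3s R" "c \<in> vec3s R" "d \<in> vec3s R" for a b c d
    using that by (intro V_inject) (simp_all add: V_W V_bracket)
  have W1: "W (vadd R a b) (vzero R) = W a (vzero R) \<oplus>\<^bsub>LA\<^esub> W b (vzero R)"
    "W (vzero R) (vadd R a b) = W (vzero R) a \<oplus>\<^bsub>LA\<^esub> W (vzero R) b"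
    "W (cross R a b) (vzero R) = W a (vzero R) \<otimes>\<^bsub>LA\<^esub> W b (vzero R)"
    "W (vzero R) (cross R a b) = W (vzero R) a \<otimes>\<^bsub>LA\<^esub> W (vzero R) b"
    "W (vzero R) (vzero R) = W a (vzero R) \<otimes>\<^bsub>LA\<^esub> W (vzero R) b"
    "W a b = W a (vzero R) \<oplus>\<^bsub>LA\<^esub> W (vzero R) b"
    if "a \<in> vec3s R" "b \<in> vec3s R" for a b
    using that Wadd[of a b "vzero R" "vzero R"] Wadd[of "vzero R" "vzero R" a b]
      Wcross[of a b "vzero R" "vzero R"] Wcross[of "vzero R" "vzero R" a b]
      Wcross[of a "vzero R" "vzero R" b] Wadd[of a "vzero R" "vzero R" b] by simp_all
  have W2: "W (smul R t a) (vzero R) = t \<odot>\<^bsub>LA\<^esub> W a (vzero R)" "W (vzero R) (smul R t a) = t \<odot>\<^bsub>LA\<^esub> W (vzero R) a"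
    if "a \<in> vec3s R" "t \<in> carrier R" for a t
    using that Wsmul[of a "vzero R" t] Wsmul[of "vzero R" a t] by simp_all
  have hom: "p \<in> cross_hom R" "q \<in> cross_hom R" "r \<in> cross_hom R" "s \<in> cross_hom R"
    by (simp_all add: cross_hom_def p_def q_def r_def s_def W1(1-4) W2 fD(2,3,4) lvec_add lvec_smult V_bracket)
  \<comment> \<open>The zero element is \<open>\<zero>\<close> times itself, so homogeneity
    determines its image.\<close>
  have f0: "V1 (f (W (vzero R) (vzero R))) = vzero R" "V2 (f (W (vzero R) (vzero R))) = vzero R"
  proof -
    have "f (W (vzero R) (vzero R)) = f (\<zero> \<odot>\<^bsub>LA\<^esub> W (vzero R) (vzero R))"
      using W2(1)[of "vzero R" \<zero>] by simp
    also have "\<dots> = \<zero> \<odot>\<^bsub>LA\<^esub> f (W (vzero R) (vzero R))"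
      by (rule fD(3)) simp_all
    finally have f: "f (W (vzero R) (vzero R)) = \<zero> \<odot>\<^bsub>LA\<^esub> f (W (vzero R) (vzero R))" .
    show "V1 (f (W (vzero R) (vzero R))) = vzero R" "V2 (f (W (vzero R) (vzero R))) = vzero R"
      by (subst f, simp add: lvec_smult)+
  qed
  have orth: "cross R (p a) (q b) = vzero R" "cross R (r a) (s b) = vzero R"
    if "a \<in> vec3s R" "b \<in> vec3s R" for a b
    using that f0 fD(4)[of "W a (vzero R)" "W (vzero R) b"]
    by (simp_all add: p_def q_def r_def s_def flip: V_bracket W1(5)[OF that])
  have fW: "V1 (f (W a b)) = vadd R (p a) (q b)" "V2 (f (W a b)) = vadd R (r a) (s b)"
    if "a \<in> vec3s R" "b \<in> vec3s R" for a b
    using that by (simp_all add: p_def q_def r_def s_def W1(6)[OF that] fD(2) lvec_add)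
  \<comment> \<open>One preimage of the pair \<open>(e1, e1)\<close> serves both rows at
    once.\<close>
  have surj: "\<exists>a\<in>vec3s R. \<exists>b\<in>vec3s R. vadd R (p a) (q b) = e1 R \<and> vadd R (r a) (s b) = e1 R"
  proof -
    obtain x where x: "x \<in> carrier LA" "f x = W (e1 R) (e1 R)"
      using bij_betw_imp_surj_on[OF fD(5)] W_closed[of "e1 R" "e1 R"] by (metis imageE vec3_closed(6))
    then have "vadd R (p (V1 x)) (q (V2 x)) = e1 R \<and> vadd R (r (V1 x)) (s (V2 x)) = e1 R"
      by (simp add: W_V V_W flip: fW)
    moreover have "V1 x \<in> vec3s R" "V2 x \<in> vec3s R"
      using x(1) by simp_all
    ultimately show ?thesis
      by blast
  qed
  have ex: "\<exists>a\<in>vec3s R. \<exists>b\<in>vec3s R. vadd R (p a) (q b) = e1 R" "\<exists>a\<in>vec3s R. \<exists>b\<in>vec3s R. vadd R (r a) (s b) = e1 R"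
    using surj by blast+
  have orth': "\<forall>a\<in>vec3s R. \<forall>b\<in>vec3s R. cross R (p a) (q b) = vzero R"
    "\<forall>a\<in>vec3s R. \<forall>b\<in>vec3s R. cross R (r a) (s b) = vzero R"
    using orth by blast+
  note pq = cross_hom_pair[OF hom(1,2) orth'(1) ex(1)] and rs = cross_hom_pair[OF hom(3,4) orth'(2) ex(2)]
  note cs = csupp_closed[OF hom(1)] csupp_closed[OF hom(2)] csupp_closed[OF hom(3)] csupp_closed[OF hom(4)]
  note [simp] = cs
  note hcl [simp] = cross_homD(1)[OF hom(1)] cross_homD(1)[OF hom(2)] cross_homD(1)[OF hom(3)] cross_homD(1)[OF hom(4)]
  have inj: "a = vzero R \<and> b = vzero R"
    if "a \<in> vec3s R" "b \<in> vec3s R" "vadd R (p a) (q b) = vzero R" "vadd R (r a) (s b) = vzero R" for a b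
  proof -
    have "f (W a b) = f (W (vzero R) (vzero R))"
      using that f0 by (intro V_inject) (simp_all add: fW)
    then have "W a b = W (vzero R) (vzero R)"
      by (rule inj_onD[OF bij_betw_imp_inj_on[OF fD(5)]]) (simp_all add: that(1,2))
    then have "V1 (W a b) = V1 (W (vzero R) (vzero R))" "V2 (W a b) = V2 (W (vzero R) (vzero R))"
      by simp_all
    then show ?thesis
      using that(1,2) by (simp add: V_W)
  qed
  have z: "p (vzero R) = vzero R" "q (vzero R) = vzero R" "r (vzero R) = vzero R" "s (vzero R) = vzero R"
    using f0 by (simp_all add: p_def q_def r_def s_def)
  \<comment> \<open>\<open>csupp p\<close> annihilates the values of \<open>q\<close> and
    \<open>csupp r\<close> those of \<open>s\<close>. Hence this multiple of \<open>e1\<close>,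
    placed in the second copy, lies in the kernel of the automorphism.\<close>
  have "smul R (csupp p \<otimes> csupp r) (e1 R) = vzero R"
  proof -
    have "q (smul R (csupp p \<otimes> csupp r) (e1 R)) = smul R (csupp r) (smul R (csupp p) (q (e1 R)))"
      by (simp add: cross_homD(3)[OF hom(2)] smul_smul m_comm)
    moreover have "s (smul R (csupp p \<otimes> csupp r) (e1 R)) = smul R (csupp p) (smul R (csupp r) (s (e1 R)))"
      by (simp add: cross_homD(3)[OF hom(4)] smul_smul)
    ultimately show ?thesis
      using inj[of "vzero R" "smul R (csupp p \<otimes> csupp r) (e1 R)"] pq(2)[of "e1 R"] rs(2)[of "e1 R"] z by simp
  qed
  then have pr: "csupp p \<otimes> csupp r = \<zero>"
    by (simp add: e1_def vzero_def)
  have "smul R (csupp q \<otimes> csupp s) (e1 R) = vzero R"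
  proof -
    have "p (smul R (csupp q \<otimes> csupp s) (e1 R)) = smul R (csupp s) (smul R (csupp q) (p (e1 R)))"
      by (simp add: cross_homD(3)[OF hom(1)] smul_smul m_comm)
    moreover have "r (smul R (csupp q \<otimes> csupp s) (e1 R)) = smul R (csupp q) (smul R (csupp s) (r (e1 R)))"
      by (simp add: cross_homD(3)[OF hom(3)] smul_smul)
    ultimately show ?thesis
      using inj[of "smul R (csupp q \<otimes> csupp s) (e1 R)" "vzero R"] pq(1)[of "e1 R"] rs(1)[of "e1 R"] z by simp
  qed
  then have qs: "csupp q \<otimes> csupp s = \<zero>"
    by (simp add: e1_def vzero_def)
  \<comment> \<open>Both supports equal \<open>csupp q csupp r\<close>, because each row sums to
    \<open>1\<close> and the products within the columns vanish.\<close>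
  have "csupp r = csupp r \<otimes> (csupp p \<oplus> csupp q)"
    using pq(3) by simp
  also have "\<dots> = csupp q \<otimes> csupp r"
    using pr by (simp add: r_distr m_comm)
  also have "\<dots> = csupp q \<otimes> (csupp r \<oplus> csupp s)"
    using qs by (simp add: r_distr)
  also have "\<dots> = csupp q"
    using rs(3) by simp
  finally have rq: "csupp r = csupp q" .
  define e where "e = csupp q"
  have eR [simp]: "e \<in> carrier R"
    by (simp add: e_def)
  have pe: "csupp p = \<one> \<ominus> e"
    using pq(3) cs(1) unfolding e_def by (metis add.inv_solve_right cs(2) minus_eq one_closed)
  have se: "csupp s = \<one> \<ominus> e"
  proof -
    have "csupp s \<oplus> e = \<one>"
      using rs(3) rq unfolding e_def by (simp add: a_comm)
    then show ?thesis
      using cs(4) by (metis add.inv_solve_right eR minus_eq one_closed)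
  qed
  have e: "e \<in> idems R"
    using cross_triple_idem[OF cross_hom_triple[OF hom(2)]] by (simp add: idems_def e_def flip: csupp_def)
  define U where "U = Vec3 (vadd R (p (e1 R)) (q (e1 R))) (vadd R (p (e2 R)) (q (e2 R))) (vadd R (p (e3 R)) (q (e3 R)))"
  define V where "V = Vec3 (vadd R (r (e1 R)) (s (e1 R))) (vadd R (r (e2 R)) (s (e2 R))) (vadd R (r (e3 R)) (s (e3 R)))"
  have U: "U \<in> frames R" and V: "V \<in> frames R"
    unfolding U_def V_def by (rule pq(4) rs(4); simp)+
  have lc: "lcomb R (Vec3 (vadd R a a') (vadd R b b') (vadd R c c')) x =
      vadd R (lcomb R (Vec3 a b c) x) (lcomb R (Vec3 a' b' c') x)"
    if "a \<in> vec3s R" "a' \<in> vec3s R" "b \<in> vec3s R" "b' \<in> vec3s R" "c \<in> vec3s R" "c' \<in> vec3s R" "x \<in> vec3s R"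
    for a a' b b' c c' x
    using that by (cases x) (simp add: smul_add vadd_ac)
  have UV: "lcomb R U x = vadd R (p x) (q x)" "lcomb R V x = vadd R (r x) (s x)" if "x \<in> vec3s R" for x
    using that by (simp_all add: U_def V_def lc flip: cross_hom_lcomb[OF hom(1)] cross_hom_lcomb[OF hom(2)]
        cross_hom_lcomb[OF hom(3)] cross_hom_lcomb[OF hom(4)])
  have fix1: "smul R (\<one> \<ominus> e) (p x) = p x" "smul R e (p x) = vzero R" "smul R e (q x) = q x" "smul R (\<one> \<ominus> e) (q x) = vzero R"
    "smul R e (r x) = r x" "smul R (\<one> \<ominus> e) (r x) = vzero R" "smul R (\<one> \<ominus> e) (s x) = s x" "smul R e (s x) = vzero R"
    if "x \<in> vec3s R" for x
    using that csupp_fixes[OF hom(1) that] csupp_fixes[OF hom(2) that] csupp_fixes[OF hom(3) that] csupp_fixes[OF hom(4) that]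
      pq(1)[of x] pq(2)[of x] rs(1)[of x] rs(2)[of x] unfolding pe se rq e_def[symmetric] by simp_all
  \<comment> \<open>\<open>p\<close> and \<open>s\<close> live where \<open>e\<close> is
    \<open>0\<close> and see the first argument of a blend, \<open>q\<close> and \<open>r\<close>
    live where \<open>e\<close> is \<open>1\<close> and see the second. So
    \<open>p (V1 x) + q (V2 x)\<close> is \<open>U\<close> applied to the blend of the two
    components, and the second row is \<open>V\<close> applied to the blend in the opposite
    order.\<close>
  have ph: "p (vblend R e a b) = p a" "q (vblend R e a b) = q b" "r (vblend R e a b) = r b" "s (vblend R e a b) = s a"
    if "a \<in> vec3s R" "b \<in> vec3s R" for a b
    using that by (simp_all add: vblend_def cross_homD(2,3)[OF hom(1)] cross_homD(2,3)[OF hom(2)]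
        cross_homD(2,3)[OF hom(3)] cross_homD(2,3)[OF hom(4)] fix1)
  have "f x = LM U V e x" for x
  proof (cases "x \<in> carrier LA")
    case True
    have "V1 (f x) = vadd R (p (V1 x)) (q (V2 x))" "V2 (f x) = vadd R (r (V1 x)) (s (V2 x))"
      using fW[of "V1 x" "V2 x"] True by (simp_all add: W_V)
    then show ?thesis
      using True by (intro V_inject) (simp_all add: V_lmap U V e UV ph)
  next
    case False
    then show ?thesis
      using fD(6) by (simp add: lmap_def extensional_def)
  qed
  then show ?thesis
    using U V e by blast
qed

end

section \<open>Base change of automorphisms\<close>

context quat_hom
begin

lemma map_vadd:
  assumes "u \<in> vec3s R" "v \<in> vec3s R"
  shows "map_vec3 \<phi> (vadd R u v) = vadd S (map_vec3 \<phi> u) (map_vec3 \<phi> v)"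
  using assms by (cases u; cases v) simp

lemma map_smul:
  assumes "u \<in> vec3s R" "a \<in> carrier R"
  shows "map_vec3 \<phi> (smul R a u) = smul S (\<phi> a) (map_vec3 \<phi> u)"
  using assms by (cases u) simp

lemma map_vblend:
  assumes "u \<in> vec3s R" "v \<in> vec3s R" "a \<in> carrier R"
  shows "map_vec3 \<phi> (vblend R a u v) = vblend S (\<phi> a) (map_vec3 \<phi> u) (map_vec3 \<phi> v)"
  using assms by (simp add: vblend_def map_vadd map_smul R.minus_eq S.minus_eq)

lemmas map_vec3_linear = map_vadd map_smul map_vblend

lemma map_lcomb:
  assumes "U \<in> frames R" "x \<in> vec3s R"
  shows "map_vec3 \<phi> (lcomb R U x) = lcomb S (fmap \<phi> U) (map_vec3 \<phi> x)"
proof -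
  obtain u v w where U: "U = Vec3 u v w" by (cases U)
  obtain a b c where x: "x = Vec3 a b c" by (cases x)
  show ?thesis
    using assms(2) R.frame_closed[OF assms(1)[unfolded U]] by (simp add: U x map_vec3_linear)
qed

lemma map_fcomp:
  assumes "U \<in> frames R" "V \<in> frames R"
  shows "fmap \<phi> (fcomp R U V) = fcomp S (fmap \<phi> U) (fmap \<phi> V)"
proof -
  obtain u v w where V: "V = Vec3 u v w" by (cases V)
  show ?thesis
    using R.frame_closed[OF assms(2)[unfolded V]] assms(1) by (simp add: V map_lcomb)
qed

lemma map_fblend:
  assumes "U \<in> frames R" "V \<in> frames R" "e \<in> carrier R"
  shows "fmap \<phi> (fblend R e U V) = fblend S (\<phi> e) (fmap \<phi> U) (fmap \<phi> V)"
proof -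
  obtain u v w where U: "U = Vec3 u v w" by (cases U)
  obtain x y z where V: "V = Vec3 x y z" by (cases V)
  show ?thesis
    using R.frame_closed[OF assms(1)[unfolded U]] R.frame_closed[OF assms(2)[unfolded V]] assms(3)
    by (simp add: U V map_vec3_linear)
qed

lemma map_idems: "e \<in> idems R \<Longrightarrow> \<phi> e \<in> idems S"
  by (auto simp: idems_def simp flip: hom_mult)

lemma map_lvec:
  assumes "j \<in> carrier R" "x \<in> carrier (lorentz_alg R)"
  shows "lvec S (\<phi> j) (\<lambda>k\<in>{1..6}. \<phi> (x k)) = map_vec3 \<phi> (lvec R j x)"
  using assms by (simp add: lvec_def R.minus_eq S.minus_eq)

lemma map_lunvec:
  assumes "a \<in> vec3s R" "b \<in> vec3s R" "k \<in> {1..6}"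
  shows "lunvec S (\<phi> i) (\<phi> h) (map_vec3 \<phi> a) (map_vec3 \<phi> b) k = \<phi> (lunvec R i h a b k)"
  using assms by (cases a; cases b) (simp add: R.minus_eq S.minus_eq)

lemma map_lmap:
  assumes U: "U \<in> frames R" and V: "V \<in> frames R" and e: "e \<in> idems R"
    and x: "x \<in> carrier (lorentz_alg R)" and k: "k \<in> {1..6}"
  shows "lmap S (\<phi> i) (\<phi> h) (fmap \<phi> U) (fmap \<phi> V) (\<phi> e) (\<lambda>k\<in>{1..6}. \<phi> (x k)) k = \<phi> (lmap R i h U V e x k)"
proof -
  define y where "y = (\<lambda>k\<in>{1..6}. \<phi> (x k))"
  have y: "y \<in> carrier (lorentz_alg S)"
    using x by (auto simp: y_def carrier_lorentz)
  have V_y: "lvec S (\<phi> i) y = map_vec3 \<phi> (lvec R i x)" "lvec S (\<ominus>\<^bsub>S\<^esub> \<phi> i) y = map_vec3 \<phi> (lvec R (\<ominus> i) x)"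
    using map_lvec[OF R.i_closed x] map_lvec[OF R.a_inv_closed[OF R.i_closed] x] by (simp_all add: y_def)
  show ?thesis
    unfolding y_def[symmetric] using U V x y R.idemsD(1)[OF e]
    by (simp add: lmap_def V_y map_lunvec[OF _ _ k] flip: map_lcomb map_vec3_linear)
qed

end

text \<open>Base change in \<open>Aut_lorentz\<close> is defined through the values on the basis,
  and linearity recovers a map from them.\<close>

lemma (in cring) lorentz_expand:
  assumes g: "\<And>x y. x \<in> carrier LA \<Longrightarrow> y \<in> carrier LA \<Longrightarrow> g (x \<oplus>\<^bsub>LA\<^esub> y) = g x \<oplus>\<^bsub>LA\<^esub> g y"
      "\<And>a x. a \<in> carrier R \<Longrightarrow> x \<in> carrier LA \<Longrightarrow> g (a \<odot>\<^bsub>LA\<^esub> x) = a \<odot>\<^bsub>LA\<^esub> g x"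
      "\<And>x. x \<in> carrier LA \<Longrightarrow> g x \<in> carrier LA"
    and x: "x \<in> carrier LA" and k: "k \<in> {1..6}"
  shows "g x k = (\<Oplus>j\<in>{1..6}. x j \<otimes> g (lorentz_basis R j) k)"
proof -
  let ?b = "lorentz_basis R"
  have b [simp]: "?b j \<in> carrier LA" for j
    by (auto simp: lorentz_basis_def carrier_lorentz)
  have [simp]: "a \<odot>\<^bsub>LA\<^esub> y \<in> carrier LA" if "a \<in> carrier R" "y \<in> carrier LA" for a y
    using lorentz_closed(2)[OF that(2,2,1)] .
  note [simp] = lorentz_coord[OF x]
  let ?s = "x 1 \<odot>\<^bsub>LA\<^esub> ?b 1 \<oplus>\<^bsub>LA\<^esub> (x 2 \<odot>\<^bsub>LA\<^esub> ?b 2 \<oplus>\<^bsub>LA\<^esub> (x 3 \<odot>\<^bsub>LA\<^esub> ?b 3 \<oplus>\<^bsub>LA\<^esub>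
      (x 4 \<odot>\<^bsub>LA\<^esub> ?b 4 \<oplus>\<^bsub>LA\<^esub> (x 5 \<odot>\<^bsub>LA\<^esub> ?b 5 \<oplus>\<^bsub>LA\<^esub> x 6 \<odot>\<^bsub>LA\<^esub> ?b 6))))"
  have "x = ?s"
    by (rule lorentz_ext[OF x]) (simp_all add: lorentz_add lorentz_smult, simp_all add: lorentz_basis_def)
  then have "g x k = g ?s k"
    by simp
  also have "\<dots> = x 1 \<otimes> g (?b 1) k \<oplus> (x 2 \<otimes> g (?b 2) k \<oplus> (x 3 \<otimes> g (?b 3) k \<oplus>
      (x 4 \<otimes> g (?b 4) k \<oplus> (x 5 \<otimes> g (?b 5) k \<oplus> x 6 \<otimes> g (?b 6) k))))"
    using k by (simp add: g lorentz_add lorentz_smult)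
  also have "\<dots> = (\<Oplus>j\<in>{1..6}. x j \<otimes> g (?b j) k)"
  proof (rule finsum_1_6[symmetric])
    show "(\<lambda>j. x j \<otimes> g (?b j) k) \<in> {1..6} \<rightarrow> carrier R"
      using x k g(3)[OF b] unfolding carrier_lorentz by (blast intro: PiE_mem m_closed)
  qed
  finally show ?thesis .
qed

text \<open>Both sides are linear over \<open>S\<close>. They agree on the basis vectors, which come
  from \<open>R\<close>, by \<open>map_lmap\<close>.\<close>

lemma lmap_base_change:
  fixes R S :: "('k, 'r) module"
  assumes "quat_hom R S i h \<phi>" and U: "U \<in> frames R" and V: "V \<in> frames R" and e: "e \<in> idems R"
  shows "trans Aut_lorentz R S \<phi> (lmap R i h U V e) = lmap S (\<phi> i) (\<phi> h) (fmap \<phi> U) (fmap \<phi> V) (\<phi> e)"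
proof
  interpret quat_hom R S i h \<phi> by fact
  let ?g = "lmap S (\<phi> i) (\<phi> h) (fmap \<phi> U) (fmap \<phi> V) (\<phi> e)"
  have "?g \<in> carrier (lie_aut S (lorentz_alg S))"
    by (rule S.lmap_aut[OF map_frames[OF U] map_frames[OF V] map_idems[OF e]])
  note gD = S.lie_autD[OF this]
  fix x
  show "trans Aut_lorentz R S \<phi> (lmap R i h U V e) x = ?g x"
  proof (cases "x \<in> carrier (lorentz_alg S)")
    case True
    have b: "lorentz_basis R j \<in> carrier (lorentz_alg R)" for j
      by (auto simp: lorentz_basis_def carrier_lorentz)
    have bS: "lorentz_basis S j = (\<lambda>k\<in>{1..6}. \<phi> (lorentz_basis R j k))" for j
      unfolding lorentz_basis_def by (rule restrict_ext) simp
    have gb: "?g (lorentz_basis S j) k = \<phi> (lmap R i h U V e (lorentz_basis R j) k)" if "k \<in> {1..6}" for j k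
      unfolding bS by (rule map_lmap[OF U V e b that])
    have gx: "?g x k = (\<Oplus>\<^bsub>S\<^esub>j\<in>{1..6}. x j \<otimes>\<^bsub>S\<^esub> \<phi> (lmap R i h U V e (lorentz_basis R j) k))" if "k \<in> {1..6}" for k
      using S.lorentz_expand[where g = ?g, OF gD(2,3,1) True that] unfolding gb[OF that] .
    have "trans Aut_lorentz R S \<phi> (lmap R i h U V e) x =
        (\<lambda>k\<in>{1..6}. \<Oplus>\<^bsub>S\<^esub>j\<in>{1..6}. x j \<otimes>\<^bsub>S\<^esub> \<phi> (lmap R i h U V e (lorentz_basis R j) k))"
      using True by (simp add: Aut_lorentz_def)
    also have "\<dots> = restrict (?g x) {1..6}"
      by (rule restrict_ext) (rule gx[symmetric])
    also have "\<dots> = ?g x"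
      using gD(1)[OF True] unfolding carrier_lorentz PiE_def by (simp only: Int_iff extensional_restrict)
    finally show ?thesis .
  next
    case False
    then show ?thesis
      by (simp add: Aut_lorentz_def lmap_def)
  qed
qed

section \<open>Idempotents and the constant group scheme\<close>

text \<open>\<open>e\<close> becomes the value at \<open>(0, 1)\<close>, the function supported at
  the nontrivial element of the group. It is therefore \<open>1\<close> precisely where the factors
  are interchanged.\<close>

definition chi :: "('k, 'm) ring_scheme \<Rightarrow> ('k, 'r) module \<Rightarrow> 'r \<Rightarrow> 'k \<times> 'k \<Rightarrow> 'r" where
  "chi F R e = (\<lambda>(u, v)\<in>carrier (split_alg F). u \<odot>\<^bsub>R\<^esub> (\<one>\<^bsub>R\<^esub> \<ominus>\<^bsub>R\<^esub> e) \<oplus>\<^bsub>R\<^esub> v \<odot>\<^bsub>R\<^esub> e)"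

definition scal :: "('k, 'r) module \<Rightarrow> 'k \<Rightarrow> 'r" where
  "scal R a = a \<odot>\<^bsub>R\<^esub> \<one>\<^bsub>R\<^esub>"

lemma split_alg_simps [simp]:
  "carrier (split_alg F) = carrier F \<times> carrier F"
  "(u, v) \<otimes>\<^bsub>split_alg F\<^esub> (u', v') = (u \<otimes>\<^bsub>F\<^esub> u', v \<otimes>\<^bsub>F\<^esub> v')"
  "(u, v) \<oplus>\<^bsub>split_alg F\<^esub> (u', v') = (u \<oplus>\<^bsub>F\<^esub> u', v \<oplus>\<^bsub>F\<^esub> v')"
  "\<one>\<^bsub>split_alg F\<^esub> = (\<one>\<^bsub>F\<^esub>, \<one>\<^bsub>F\<^esub>)"
  "c \<odot>\<^bsub>split_alg F\<^esub> (u, v) = (c \<otimes>\<^bsub>F\<^esub> u, c \<otimes>\<^bsub>F\<^esub> v)"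
  by (simp_all add: split_alg_def RDirProd_def ring.defs monoid.defs DirProd_def)

text \<open>\<open>j\<close> and \<open>t\<close> are taken in \<open>F\<close> and fixed before
  \<open>R\<close> varies, and all constructions use their images in \<open>R\<close>. Algebra
  homomorphisms preserve these images, whereas unrelated square roots chosen in each
  \<open>R\<close> would destroy naturality.\<close>

locale split_algebra = algebra F R for F :: "'k ring" and R :: "('k, 'r) module" +
  fixes j t
  assumes j: "j \<in> carrier F" "j \<otimes>\<^bsub>F\<^esub> j = \<ominus>\<^bsub>F\<^esub> \<one>\<^bsub>F\<^esub>"
    and t: "t \<in> carrier F" "(\<one>\<^bsub>F\<^esub> \<oplus>\<^bsub>F\<^esub> \<one>\<^bsub>F\<^esub>) \<otimes>\<^bsub>F\<^esub> t = \<one>\<^bsub>F\<^esub>"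
begin

lemma scal_closed [simp]: "a \<in> carrier F \<Longrightarrow> scal R a \<in> carrier R"
  by (simp add: scal_def)

lemma smult_scal: "a \<in> carrier F \<Longrightarrow> x \<in> carrier R \<Longrightarrow> a \<odot>\<^bsub>R\<^esub> x = scal R a \<otimes>\<^bsub>R\<^esub> x"
  by (simp add: scal_def smult_assoc2)

lemma scal_simps:
  "a \<in> carrier F \<Longrightarrow> b \<in> carrier F \<Longrightarrow> scal R (a \<otimes>\<^bsub>F\<^esub> b) = scal R a \<otimes>\<^bsub>R\<^esub> scal R b"
  "a \<in> carrier F \<Longrightarrow> b \<in> carrier F \<Longrightarrow> scal R (a \<oplus>\<^bsub>F\<^esub> b) = scal R a \<oplus>\<^bsub>R\<^esub> scal R b"
  "scal R \<one>\<^bsub>F\<^esub> = \<one>\<^bsub>R\<^esub>" "scal R \<zero>\<^bsub>F\<^esub> = \<zero>\<^bsub>R\<^esub>"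
  "a \<in> carrier F \<Longrightarrow> scal R (\<ominus>\<^bsub>F\<^esub> a) = \<ominus>\<^bsub>R\<^esub> scal R a"
  by (simp_all add: scal_def smult_l_distr smult_l_minus smult_assoc1 smult_assoc2)

lemma quat_ring: "quat_ring R (scal R j) (scal R t)"
proof
  show "scal R j \<otimes>\<^bsub>R\<^esub> scal R j = \<ominus>\<^bsub>R\<^esub> \<one>\<^bsub>R\<^esub>"
    using j by (simp flip: scal_simps)
  show "(\<one>\<^bsub>R\<^esub> \<oplus>\<^bsub>R\<^esub> \<one>\<^bsub>R\<^esub>) \<otimes>\<^bsub>R\<^esub> scal R t = \<one>\<^bsub>R\<^esub>"
    using t by (simp flip: scal_simps)
qed (use j t in simp_all)

sublocale Q: quat_ring R "scal R j" "scal R t"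
  by (rule quat_ring)

lemma chi_apply:
  assumes "e \<in> carrier R" "u \<in> carrier F" "v \<in> carrier F"
  shows "chi F R e (u, v) = scal R u \<otimes>\<^bsub>R\<^esub> (\<one>\<^bsub>R\<^esub> \<ominus>\<^bsub>R\<^esub> e) \<oplus>\<^bsub>R\<^esub> scal R v \<otimes>\<^bsub>R\<^esub> e"
  using assms by (simp add: chi_def smult_scal)

lemma chi_basis:
  assumes "e \<in> carrier R"
  shows "chi F R e (\<one>\<^bsub>F\<^esub>, \<zero>\<^bsub>F\<^esub>) = \<one>\<^bsub>R\<^esub> \<ominus>\<^bsub>R\<^esub> e" "chi F R e (\<zero>\<^bsub>F\<^esub>, \<one>\<^bsub>F\<^esub>) = e"
  using assms by (simp_all add: chi_apply scal_simps)

lemma chi_closed: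
  assumes e: "e \<in> idems R"
  shows "chi F R e \<in> carrier (points (Z2 F) R)"
proof -
  note eR [simp] = Q.idemsD(1)[OF e] and ee = Q.idemsD(2)[OF e]
  note idc = idem_complement[OF eR ee]
  have "chi F R e \<in> ring_hom (split_alg F) R"
  proof (rule ring_hom_memI)
    fix x y assume "x \<in> carrier (split_alg F)" "y \<in> carrier (split_alg F)"
    then obtain u v u' v' where xy: "x = (u, v)" "y = (u', v')"
      and cl [simp]: "u \<in> carrier F" "v \<in> carrier F" "u' \<in> carrier F" "v' \<in> carrier F"
      by auto
    define a b a' b' d where abd: "a = scal R u" "b = scal R v" "a' = scal R u'" "b' = scal R v'" "d = \<one>\<^bsub>R\<^esub> \<ominus>\<^bsub>R\<^esub> e"
    have c: "a \<in> carrier R" "b \<in> carrier R" "a' \<in> carrier R" "b' \<in> carrier R" "d \<in> carrier R"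
      by (simp_all add: abd)
    show "chi F R e x \<in> carrier R"
      by (simp add: xy chi_apply)
    show "chi F R e (x \<oplus>\<^bsub>split_alg F\<^esub> y) = chi F R e x \<oplus>\<^bsub>R\<^esub> chi F R e y"
      using c by (simp add: xy chi_apply scal_simps flip: abd) (simp add: l_distr a_ac)
    have "chi F R e x \<otimes>\<^bsub>R\<^esub> chi F R e y = a \<otimes>\<^bsub>R\<^esub> a' \<otimes>\<^bsub>R\<^esub> (d \<otimes>\<^bsub>R\<^esub> d) \<oplus>\<^bsub>R\<^esub> (a \<otimes>\<^bsub>R\<^esub> b' \<oplus>\<^bsub>R\<^esub> b \<otimes>\<^bsub>R\<^esub> a') \<otimes>\<^bsub>R\<^esub> (d \<otimes>\<^bsub>R\<^esub> e) \<oplus>\<^bsub>R\<^esub> b \<otimes>\<^bsub>R\<^esub> b' \<otimes>\<^bsub>R\<^esub> (e \<otimes>\<^bsub>R\<^esub> e)"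
      unfolding xy chi_apply[OF eR cl(1,2)] chi_apply[OF eR cl(3,4)] abd[symmetric] using c eR by algebra
    then show "chi F R e (x \<otimes>\<^bsub>split_alg F\<^esub> y) = chi F R e x \<otimes>\<^bsub>R\<^esub> chi F R e y"
      using c by (simp add: xy chi_apply scal_simps idc ee abd)
  next
    have "\<one>\<^bsub>R\<^esub> \<ominus>\<^bsub>R\<^esub> e \<oplus>\<^bsub>R\<^esub> e = \<one>\<^bsub>R\<^esub>"
      using eR by algebra
    then show "chi F R e \<one>\<^bsub>split_alg F\<^esub> = \<one>\<^bsub>R\<^esub>"
      by (simp add: chi_apply scal_simps)
  qed
  moreover have "chi F R e (c \<otimes>\<^bsub>F\<^esub> u, c \<otimes>\<^bsub>F\<^esub> v) = c \<odot>\<^bsub>R\<^esub> chi F R e (u, v)"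
    if "c \<in> carrier F" "u \<in> carrier F" "v \<in> carrier F" for c u v
    using that by (simp add: chi_apply smult_scal scal_simps r_distr m_assoc)
  moreover have "chi F R e \<in> extensional (carrier (split_alg F))"
    by (simp add: chi_def)
  ultimately show ?thesis
    by (simp add: Z2_def alg_hom_def)
qed

lemma chi_surj:
  assumes "\<chi> \<in> carrier (points (Z2 F) R)"
  shows "\<exists>e\<in>idems R. \<chi> = chi F R e"
proof -
  have hom: "\<chi> \<in> ring_hom (split_alg F) R" and ext: "\<chi> \<in> extensional (carrier F \<times> carrier F)"
    and lin: "\<And>c x. c \<in> carrier F \<Longrightarrow> x \<in> carrier F \<times> carrier F \<Longrightarrow> \<chi> (c \<odot>\<^bsub>split_alg F\<^esub> x) = c \<odot>\<^bsub>R\<^esub> \<chi> x"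
    using assms by (auto simp: Z2_def alg_hom_def)
  let ?e = "\<chi> (\<zero>\<^bsub>F\<^esub>, \<one>\<^bsub>F\<^esub>)" and ?d = "\<chi> (\<one>\<^bsub>F\<^esub>, \<zero>\<^bsub>F\<^esub>)"
  have cl [simp]: "?e \<in> carrier R" "?d \<in> carrier R"
    using ring_hom_closed[OF hom] by simp_all
  have "?e \<otimes>\<^bsub>R\<^esub> ?e = ?e"
    using ring_hom_mult[OF hom, of "(\<zero>\<^bsub>F\<^esub>, \<one>\<^bsub>F\<^esub>)" "(\<zero>\<^bsub>F\<^esub>, \<one>\<^bsub>F\<^esub>)"] by simp
  then have e: "?e \<in> idems R"
    by (simp add: idems_def)
  have "?d \<oplus>\<^bsub>R\<^esub> ?e = \<one>\<^bsub>R\<^esub>"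
    using ring_hom_add[OF hom, of "(\<one>\<^bsub>F\<^esub>, \<zero>\<^bsub>F\<^esub>)" "(\<zero>\<^bsub>F\<^esub>, \<one>\<^bsub>F\<^esub>)"] ring_hom_one[OF hom] by simp
  then have d: "?d = \<one>\<^bsub>R\<^esub> \<ominus>\<^bsub>R\<^esub> ?e"
    using cl by (metis add.inv_solve_right minus_eq one_closed)
  have "\<chi> x = chi F R ?e x" for x
  proof (cases "x \<in> carrier F \<times> carrier F")
    case True
    then obtain u v where x: "x = (u, v)" and [simp]: "u \<in> carrier F" "v \<in> carrier F"
      by auto
    have "\<chi> x = \<chi> (u \<odot>\<^bsub>split_alg F\<^esub> (\<one>\<^bsub>F\<^esub>, \<zero>\<^bsub>F\<^esub>) \<oplus>\<^bsub>split_alg F\<^esub> v \<odot>\<^bsub>split_alg F\<^esub> (\<zero>\<^bsub>F\<^esub>, \<one>\<^bsub>F\<^esub>))"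
      by (simp add: x)
    also have "\<dots> = u \<odot>\<^bsub>R\<^esub> ?d \<oplus>\<^bsub>R\<^esub> v \<odot>\<^bsub>R\<^esub> ?e"
      using ring_hom_add[OF hom, of "u \<odot>\<^bsub>split_alg F\<^esub> (\<one>\<^bsub>F\<^esub>, \<zero>\<^bsub>F\<^esub>)" "v \<odot>\<^bsub>split_alg F\<^esub> (\<zero>\<^bsub>F\<^esub>, \<one>\<^bsub>F\<^esub>)"]
        lin[of u "(\<one>\<^bsub>F\<^esub>, \<zero>\<^bsub>F\<^esub>)"] lin[of v "(\<zero>\<^bsub>F\<^esub>, \<one>\<^bsub>F\<^esub>)"] by simp
    also have "\<dots> = chi F R ?e x"
      unfolding d by (simp add: x chi_def)
    finally show ?thesis .
  next
    case False
    then show ?thesis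
      using ext by (cases x) (auto simp: chi_def extensional_def)
  qed
  then have "\<chi> = chi F R ?e"
    by blast
  then show ?thesis
    using e by (rule bexI)
qed

lemma chi_mult:
  assumes e: "e \<in> idems R" and e': "e' \<in> idems R"
  shows "chi F R e \<otimes>\<^bsub>points (Z2 F) R\<^esub> chi F R e' = chi F R (isum R e e')"
proof -
  note eR [simp] = Q.idemsD(1)[OF e] Q.idemsD(1)[OF e'] Q.idemsD(1)[OF Q.isum_idems(1)[OF e e']]
  have "chi F R e (\<one>\<^bsub>F\<^esub>, \<zero>\<^bsub>F\<^esub>) \<otimes>\<^bsub>R\<^esub> chi F R e' (u, v) \<oplus>\<^bsub>R\<^esub> chi F R e (\<zero>\<^bsub>F\<^esub>, \<one>\<^bsub>F\<^esub>) \<otimes>\<^bsub>R\<^esub> chi F R e' (v, u) =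
      u \<odot>\<^bsub>R\<^esub> (\<one>\<^bsub>R\<^esub> \<ominus>\<^bsub>R\<^esub> isum R e e') \<oplus>\<^bsub>R\<^esub> v \<odot>\<^bsub>R\<^esub> isum R e e'"
    if uv [simp]: "u \<in> carrier F" "v \<in> carrier F" for u v
  proof -
    define a b where ab: "a = scal R u" "b = scal R v"
    have c: "a \<in> carrier R" "b \<in> carrier R"
      by (simp_all add: ab)
    have "(\<one>\<^bsub>R\<^esub> \<ominus>\<^bsub>R\<^esub> e) \<otimes>\<^bsub>R\<^esub> (a \<otimes>\<^bsub>R\<^esub> (\<one>\<^bsub>R\<^esub> \<ominus>\<^bsub>R\<^esub> e') \<oplus>\<^bsub>R\<^esub> b \<otimes>\<^bsub>R\<^esub> e') \<oplus>\<^bsub>R\<^esub> e \<otimes>\<^bsub>R\<^esub> (b \<otimes>\<^bsub>R\<^esub> (\<one>\<^bsub>R\<^esub> \<ominus>\<^bsub>R\<^esub> e') \<oplus>\<^bsub>R\<^esub> a \<otimes>\<^bsub>R\<^esub> e') =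
        a \<otimes>\<^bsub>R\<^esub> (\<one>\<^bsub>R\<^esub> \<ominus>\<^bsub>R\<^esub> ((\<one>\<^bsub>R\<^esub> \<ominus>\<^bsub>R\<^esub> e) \<otimes>\<^bsub>R\<^esub> e' \<oplus>\<^bsub>R\<^esub> e \<otimes>\<^bsub>R\<^esub> (\<one>\<^bsub>R\<^esub> \<ominus>\<^bsub>R\<^esub> e'))) \<oplus>\<^bsub>R\<^esub>
        b \<otimes>\<^bsub>R\<^esub> ((\<one>\<^bsub>R\<^esub> \<ominus>\<^bsub>R\<^esub> e) \<otimes>\<^bsub>R\<^esub> e' \<oplus>\<^bsub>R\<^esub> e \<otimes>\<^bsub>R\<^esub> (\<one>\<^bsub>R\<^esub> \<ominus>\<^bsub>R\<^esub> e'))"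
      using c eR by algebra
    then show ?thesis
      by (simp add: chi_apply scal_simps smult_scal ab isum_def)
  qed
  then show ?thesis
    by (auto simp: Z2_def chi_def[of F R "isum R e e'"] intro!: restrict_ext)
qed

end

section \<open>The isomorphism\<close>

text \<open>One of \<open>e\<close> and \<open>1 - e\<close> lies outside the prime and becomes a
  unit in the local ring. Being idempotent it becomes \<open>1\<close>, and since the product of the
  two is zero, the other becomes \<open>0\<close>.\<close>

lemma (in cring) germ_idem:
  assumes e: "e \<in> carrier R" "e \<otimes> e = e" and p: "p \<in> Spec R"
  shows "germ R p e = germ R p \<zero> \<and> germ R p (\<one> \<ominus> e) = germ R p \<one> \<or>
    germ R p e = germ R p \<one> \<and> germ R p (\<one> \<ominus> e) = germ R p \<zero>"
proof -
  interpret mult_set "carrier R - p" R by (rule mult_set_prime[OF p])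
  note idc = idem_complement[OF e]
  show ?thesis
  proof (cases "e \<in> p")
    case True
    have "\<one> \<ominus> e \<oplus> e = \<one>"
      using e(1) by algebra
    then have u: "\<one> \<ominus> e \<in> carrier R - p"
      using Spec_add[OF p _ True, of "\<one> \<ominus> e"] Spec_one[OF p] e(1) by auto
    have "germ R p e = germ R p \<zero>" "germ R p (\<one> \<ominus> e) = germ R p \<one>"
      using e(1) idc by (simp_all add: to_loc_eq_iff) (use u in \<open>auto intro!: bexI[OF _ u]\<close>)
    then show ?thesis by blast
  next
    case False
    then have u: "e \<in> carrier R - p"
      using e(1) by blast
    have "germ R p e = germ R p \<one>" "germ R p (\<one> \<ominus> e) = germ R p \<zero>"
      using e idc by (simp_all add: to_loc_eq_iff) (use u e idc in \<open>auto intro!: bexI[OF _ u]\<close>)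
    then show ?thesis by blast
  qed
qed

context cring
begin

text \<open>The action on cosets is read off from the projections of \<open>C \<times> D\<close>; as
  neither factor is empty, these return the cosets themselves.\<close>

lemma coset_pair_act_id:
  assumes "C \<subseteq> carrier M2" "D \<subseteq> carrier M2" "C \<noteq> {}" "D \<noteq> {}"
    and "\<psi> (\<one>\<^bsub>F\<^esub>, \<zero>\<^bsub>F\<^esub>) = \<one>" "\<psi> (\<zero>\<^bsub>F\<^esub>, \<one>\<^bsub>F\<^esub>) = \<zero>"
  shows "coset_pair_act (prod_aut F R \<psi>) (C, D) = (C, D)"
proof -
  have "mat2_pair_act (prod_aut F R \<psi>) x = x" if x: "x \<in> C \<times> D" for x
  proof -
    obtain a b c d a' b' c' d' where xd: "x = (Mat2 a b c d, Mat2 a' b' c' d')"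
      by (metis mat2.exhaust prod.exhaust)
    then have "Mat2 a b c d \<in> carrier M2" "Mat2 a' b' c' d' \<in> carrier M2"
      using x assms(1,2) by auto
    then show ?thesis
      using assms(5,6) by (simp add: xd mat2_pair_act_def prod_aut_def Let_def)
  qed
  then have "mat2_pair_act (prod_aut F R \<psi>) ` (C \<times> D) = C \<times> D"
    by force
  then show ?thesis
    using assms(3,4) by (simp add: coset_pair_act_def)
qed

lemma coset_pair_act_swap:
  assumes "C \<subseteq> carrier M2" "D \<subseteq> carrier M2" "C \<noteq> {}" "D \<noteq> {}"
    and "\<psi> (\<one>\<^bsub>F\<^esub>, \<zero>\<^bsub>F\<^esub>) = \<zero>" "\<psi> (\<zero>\<^bsub>F\<^esub>, \<one>\<^bsub>F\<^esub>) = \<one>"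
  shows "coset_pair_act (prod_aut F R \<psi>) (C, D) = (D, C)"
proof -
  have "mat2_pair_act (prod_aut F R \<psi>) x = prod.swap x" if x: "x \<in> C \<times> D" for x
  proof -
    obtain a b c d a' b' c' d' where xd: "x = (Mat2 a b c d, Mat2 a' b' c' d')"
      by (metis mat2.exhaust prod.exhaust)
    then have "Mat2 a b c d \<in> carrier M2" "Mat2 a' b' c' d' \<in> carrier M2"
      using x assms(1,2) by auto
    then show ?thesis
      using assms(5,6) by (simp add: xd mat2_pair_act_def prod_aut_def Let_def)
  qed
  then have "mat2_pair_act (prod_aut F R \<psi>) ` (C \<times> D) = prod.swap ` (C \<times> D)"
    by (rule image_cong[OF refl])
  then show ?thesis
    using assms(3,4) by (simp add: coset_pair_act_def product_swap)
qed

lemma fblend_zero_one: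
  assumes "U \<in> frames R" "V \<in> frames R"
  shows "fblend R \<zero> U V = U" "fblend R \<one> U V = V"
proof -
  obtain u v w where U: "U = Vec3 u v w" by (cases U)
  obtain x y z where V: "V = Vec3 x y z" by (cases V)
  have "vblend R \<zero> a b = a" "vblend R \<one> a b = b" if "a \<in> vec3s R" "b \<in> vec3s R" for a b
    using that by (simp_all add: vblend_def minus_eq r_neg)
  then show "fblend R \<zero> U V = U" "fblend R \<one> U V = V"
    using frame_closed[OF assms(1)[unfolded U]] frame_closed[OF assms(2)[unfolded V]]
    by (simp_all add: U V)
qed

end

context split_algebra
begin

abbreviation "fsec U \<equiv> frame_section R (scal R j) U"

text \<open>In a local ring the idempotent is \<open>0\<close> or \<open>1\<close>. The action is
  then trivial or interchanges the two cosets, while \<open>fblend\<close> reduces to its first or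
  its second argument accordingly.\<close>

lemma section_mult:
  assumes U: "U \<in> frames R" and V: "V \<in> frames R" and U': "U' \<in> frames R" and V': "V' \<in> frames R"
    and e: "e \<in> idems R" and p: "p \<in> Spec R"
  defines "act \<equiv> coset_pair_act (prod_aut F (local_ring_at R p) (\<lambda>x. germ R p (chi F R e x)))
      (fsec U' p, fsec V' p)"
  shows "fsec U p \<otimes>\<^bsub>GL2_mod_Gm (local_ring_at R p)\<^esub> fst act = fsec (fcomp R U (fblend R e U' V')) p"
    and "fsec V p \<otimes>\<^bsub>GL2_mod_Gm (local_ring_at R p)\<^esub> snd act = fsec (fcomp R V (fblend R e V' U')) p"
proof -
  interpret G: quat_hom R "local_ring_at R p" "scal R j" "scal R t" "germ R p"
    by (rule Q.germ_hom[OF p])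
  let ?S = "local_ring_at R p"
  let ?tw = "\<lambda>W. twist ?S (germ R p (scal R j)) (fmap (germ R p) W)"
  note eR = Q.idemsD(1)[OF e] and ee = Q.idemsD(2)[OF e]
  have sec: "fsec W p = ?tw W" for W
    using p by (simp add: frame_section_def)
  have ne: "?tw W \<noteq> {}" if "W \<in> frames R" for W
    using Q.twist_germ_nonempty[OF that p] by blast
  have sub: "?tw W \<subseteq> carrier G.S.M2" for W
    using G.S.twist_GL2 G.S.GL2_closed by blast
  have fb: "fblend R e U' V' \<in> frames R" "fblend R e V' U' \<in> frames R"
    using fblend_frames U' V' eR ee by blast+
  have mult: "?tw A \<otimes>\<^bsub>GL2_mod_Gm ?S\<^esub> ?tw B = ?tw (fcomp R A B)" if "A \<in> frames R" "B \<in> frames R" for A B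
    using G.S.germ_twist_mult[OF G.map_frames[OF that(1)] G.map_frames[OF that(2)] ne[OF that(1)] ne[OF that(2)]]
    by (simp only: G.map_fcomp[OF that])
  have "fst act = ?tw (fblend R e U' V') \<and> snd act = ?tw (fblend R e V' U')"
  proof (rule disjE[OF germ_idem[OF eR ee p]])
    assume g: "germ R p e = germ R p \<zero>\<^bsub>R\<^esub> \<and> germ R p (\<one>\<^bsub>R\<^esub> \<ominus>\<^bsub>R\<^esub> e) = germ R p \<one>\<^bsub>R\<^esub>"
    then have g0: "germ R p e = \<zero>\<^bsub>?S\<^esub>" and g1: "germ R p (\<one>\<^bsub>R\<^esub> \<ominus>\<^bsub>R\<^esub> e) = \<one>\<^bsub>?S\<^esub>"
      by (simp_all only: G.hom_zero G.hom_one)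
    have "act = (?tw U', ?tw V')"
      unfolding act_def sec by (rule G.S.coset_pair_act_id[OF sub sub ne[OF U'] ne[OF V']])
        (simp_all only: chi_basis[OF eR] g0 g1)
    then have "fst act = ?tw U'" "snd act = ?tw V'"
      by simp_all
    then show ?thesis
      by (simp only: G.map_fblend[OF U' V' eR] G.map_fblend[OF V' U' eR] g0 fst_conv snd_conv
          G.S.fblend_zero_one[OF G.map_frames[OF U'] G.map_frames[OF V']]
          G.S.fblend_zero_one[OF G.map_frames[OF V'] G.map_frames[OF U']] simp_thms)
  next
    assume g: "germ R p e = germ R p \<one>\<^bsub>R\<^esub> \<and> germ R p (\<one>\<^bsub>R\<^esub> \<ominus>\<^bsub>R\<^esub> e) = germ R p \<zero>\<^bsub>R\<^esub>"
    then have g0: "germ R p e = \<one>\<^bsub>?S\<^esub>" and g1: "germ R p (\<one>\<^bsub>R\<^esub> \<ominus>\<^bsub>R\<^esub> e) = \<zero>\<^bsub>?S\<^esub>"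
      by (simp_all only: G.hom_zero G.hom_one)
    have "act = (?tw V', ?tw U')"
      unfolding act_def sec by (rule G.S.coset_pair_act_swap[OF sub sub ne[OF U'] ne[OF V']])
        (simp_all only: chi_basis[OF eR] g0 g1)
    then have "fst act = ?tw V'" "snd act = ?tw U'"
      by simp_all
    then show ?thesis
      by (simp only: G.map_fblend[OF U' V' eR] G.map_fblend[OF V' U' eR] g0 fst_conv snd_conv
          G.S.fblend_zero_one[OF G.map_frames[OF U'] G.map_frames[OF V']]
          G.S.fblend_zero_one[OF G.map_frames[OF V'] G.map_frames[OF U']] simp_thms)
  qed
  then show "fsec U p \<otimes>\<^bsub>GL2_mod_Gm ?S\<^esub> fst act = fsec (fcomp R U (fblend R e U' V')) p"
    "fsec V p \<otimes>\<^bsub>GL2_mod_Gm ?S\<^esub> snd act = fsec (fcomp R V (fblend R e V' U')) p"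
    using mult[OF U fb(1)] mult[OF V fb(2)] by (simp_all only: sec)
qed

text \<open>On automorphisms a triple exists by \<open>lmap_surj\<close> and is unique by
  \<open>lmap_inject\<close>, so the choice only inverts the parametrisation by
  \<open>lmap\<close>.\<close>

definition params :: "((nat \<Rightarrow> 'r) \<Rightarrow> (nat \<Rightarrow> 'r)) \<Rightarrow>
    (('r set \<Rightarrow> ('r \<times> 'r) set mat2 set) \<times> ('r set \<Rightarrow> ('r \<times> 'r) set mat2 set)) \<times> ('k \<times> 'k \<Rightarrow> 'r)" where
  "params f = (SOME z. \<exists>U\<in>frames R. \<exists>V\<in>frames R. \<exists>e\<in>idems R.
     f = Q.LM U V e \<and> z = ((fsec U, fsec V), chi F R e))"

lemma params_lmap:
  assumes "U \<in> frames R" "V \<in> frames R" "e \<in> idems R"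
  shows "params (Q.LM U V e) = ((fsec U, fsec V), chi F R e)"
  unfolding params_def
proof (rule some_equality)
  show "\<exists>U'\<in>frames R. \<exists>V'\<in>frames R. \<exists>e'\<in>idems R. Q.LM U V e = Q.LM U' V' e' \<and>
      ((fsec U, fsec V), chi F R e) = ((fsec U', fsec V'), chi F R e')"
    using assms by blast
  fix z
  assume "\<exists>U'\<in>frames R. \<exists>V'\<in>frames R. \<exists>e'\<in>idems R. Q.LM U V e = Q.LM U' V' e' \<and>
      z = ((fsec U', fsec V'), chi F R e')"
  then show "z = ((fsec U, fsec V), chi F R e)"
    using Q.lmap_inject[OF assms] by blast
qed

section \<open>Comparison of the group laws\<close>

lemma carrier_target:
  "carrier (points (PGL2sq_Z2 F) R) =
     (carrier (PGL2_points R) \<times> carrier (PGL2_points R)) \<times> carrier (points (Z2 F) R)"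
  by (simp add: PGL2sq_Z2_def semidirect_functor_def semidirect_def prod_functor_def PGL2_def DirProd_def)

lemma mult_target:
  "((x, x'), a) \<otimes>\<^bsub>points (PGL2sq_Z2 F) R\<^esub> ((y, y'), b) =
     (case Z2_act F R a (y, y') of (z, z') \<Rightarrow>
       ((x \<otimes>\<^bsub>PGL2_points R\<^esub> z, x' \<otimes>\<^bsub>PGL2_points R\<^esub> z'), a \<otimes>\<^bsub>points (Z2 F) R\<^esub> b))"
  by (simp add: PGL2sq_Z2_def semidirect_functor_def semidirect_def prod_functor_def PGL2_def DirProd_def
      split: prod.split)

lemma mult_PGL2_points:
  "x \<otimes>\<^bsub>PGL2_points R\<^esub> y = (\<lambda>p\<in>Spec R. x p \<otimes>\<^bsub>GL2_mod_Gm (local_ring_at R p)\<^esub> y p)"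
  by (simp add: PGL2_points_def)

lemma section_extensional: "restrict (fsec U) (Spec R) = fsec U"
  by (simp add: frame_section_def)

lemma mult_params:
  assumes U: "U \<in> frames R" and V: "V \<in> frames R" and e: "e \<in> idems R"
    and U': "U' \<in> frames R" and V': "V' \<in> frames R" and e': "e' \<in> idems R"
  shows "((fsec U, fsec V), chi F R e) \<otimes>\<^bsub>points (PGL2sq_Z2 F) R\<^esub> ((fsec U', fsec V'), chi F R e') =
    ((fsec (fcomp R U (fblend R e U' V')), fsec (fcomp R V (fblend R e V' U'))), chi F R (isum R e e'))"
proof -
  let ?act = "\<lambda>p. coset_pair_act (prod_aut F (local_ring_at R p) (\<lambda>x. germ R p (chi F R e x))) (fsec U' p, fsec V' p)"
  have "fsec U \<otimes>\<^bsub>PGL2_points R\<^esub> (\<lambda>p\<in>Spec R. fst (?act p)) = fsec (fcomp R U (fblend R e U' V'))"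
    unfolding mult_PGL2_points
    by (subst section_extensional[symmetric], rule restrict_ext) (simp add: section_mult(1)[OF U V U' V' e])
  moreover have "fsec V \<otimes>\<^bsub>PGL2_points R\<^esub> (\<lambda>p\<in>Spec R. snd (?act p)) = fsec (fcomp R V (fblend R e V' U'))"
    unfolding mult_PGL2_points
    by (subst section_extensional[symmetric], rule restrict_ext) (simp add: section_mult(2)[OF U V U' V' e])
  ultimately show ?thesis
    unfolding mult_target Z2_act_def Let_def prod.case chi_mult[OF e e'] by simp
qed

lemma mult_lie_aut:
  assumes "f \<in> carrier (lie_aut R (lorentz_alg R))" "g \<in> carrier (lie_aut R (lorentz_alg R))"
  shows "f \<otimes>\<^bsub>lie_aut R (lorentz_alg R)\<^esub> g = compose (carrier (lorentz_alg R)) f g"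
  using assms by (simp add: lie_aut_def BijGroup_def)

lemma points_Aut_lorentz: "points Aut_lorentz R = lie_aut R (lorentz_alg R)"
  by (simp add: Aut_lorentz_def)

lemma params_iso: "params \<in> iso (points Aut_lorentz R) (points (PGL2sq_Z2 F) R)"
proof (rule isoI)
  have par: "\<exists>U\<in>frames R. \<exists>V\<in>frames R. \<exists>e\<in>idems R. f = Q.LM U V e \<and> params f = ((fsec U, fsec V), chi F R e)"
    if "f \<in> carrier (lie_aut R (lorentz_alg R))" for f
    using Q.lmap_surj[OF that] params_lmap by blast
  show "params \<in> hom (points Aut_lorentz R) (points (PGL2sq_Z2 F) R)"
  proof (rule homI)
    fix f assume "f \<in> carrier (points Aut_lorentz R)"
    then obtain U V e where "U \<in> frames R" "V \<in> frames R" "e \<in> idems R" "params f = ((fsec U, fsec V), chi F R e)"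
      using par unfolding points_Aut_lorentz by blast
    then show "params f \<in> carrier (points (PGL2sq_Z2 F) R)"
      by (simp add: carrier_target Q.frame_section_closed chi_closed)
  next
    fix f g assume fg: "f \<in> carrier (points Aut_lorentz R)" "g \<in> carrier (points Aut_lorentz R)"
    then obtain U V e where U: "U \<in> frames R" "V \<in> frames R" "e \<in> idems R"
      and f: "f = Q.LM U V e" "params f = ((fsec U, fsec V), chi F R e)"
      using par unfolding points_Aut_lorentz by blast
    obtain U' V' e' where U': "U' \<in> frames R" "V' \<in> frames R" "e' \<in> idems R"
      and g: "g = Q.LM U' V' e'" "params g = ((fsec U', fsec V'), chi F R e')"
      using fg(2) par unfolding points_Aut_lorentz by blast
    note eR = Q.idemsD[OF U(3)]
    have fr: "fcomp R U (fblend R e U' V') \<in> frames R" "fcomp R V (fblend R e V' U') \<in> frames R"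
      using fcomp_frames fblend_frames U U' eR by blast+
    have "f \<otimes>\<^bsub>points Aut_lorentz R\<^esub> g = Q.LM (fcomp R U (fblend R e U' V')) (fcomp R V (fblend R e V' U')) (isum R e e')"
      using mult_lie_aut[OF fg[unfolded points_Aut_lorentz]] Q.lmap_comp[OF U U']
      unfolding points_Aut_lorentz f(1) g(1) by simp
    then show "params (f \<otimes>\<^bsub>points Aut_lorentz R\<^esub> g) = params f \<otimes>\<^bsub>points (PGL2sq_Z2 F) R\<^esub> params g"
      unfolding f(2) g(2) mult_params[OF U U'] using params_lmap[OF fr Q.isum_idems(1)[OF U(3) U'(3)]] by simp
  qed
  show "bij_betw params (carrier (points Aut_lorentz R)) (carrier (points (PGL2sq_Z2 F) R))"
    unfolding points_Aut_lorentz
  proof (rule bij_betw_imageI)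
    show "inj_on params (carrier (lie_aut R (lorentz_alg R)))"
    proof (rule inj_onI)
      fix f g assume "f \<in> carrier (lie_aut R (lorentz_alg R))" "g \<in> carrier (lie_aut R (lorentz_alg R))"
        and eq: "params f = params g"
      then obtain U V e U' V' e' where U: "U \<in> frames R" "V \<in> frames R" "e \<in> idems R"
        and U': "U' \<in> frames R" "V' \<in> frames R" "e' \<in> idems R"
        and f: "f = Q.LM U V e" "params f = ((fsec U, fsec V), chi F R e)"
        and g: "g = Q.LM U' V' e'" "params g = ((fsec U', fsec V'), chi F R e')"
        using par by meson
      have "fsec U = fsec U'" "fsec V = fsec V'" and c: "chi F R e = chi F R e'"
        using eq f(2) g(2) by simp_all
      then have "U = U'" "V = V'"
        using Q.frame_section_inject U U' by blast+
      moreover have "e = e'"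
        using arg_cong[OF c, of "\<lambda>x. x (\<zero>\<^bsub>F\<^esub>, \<one>\<^bsub>F\<^esub>)"] Q.idemsD(1)[OF U(3)] Q.idemsD(1)[OF U'(3)]
        by (simp only: chi_basis)
      ultimately show "f = g"
        by (simp add: f(1) g(1))
    qed
    show "params ` carrier (lie_aut R (lorentz_alg R)) = carrier (points (PGL2sq_Z2 F) R)"
    proof
      show "params ` carrier (lie_aut R (lorentz_alg R)) \<subseteq> carrier (points (PGL2sq_Z2 F) R)"
      proof (rule image_subsetI)
        fix f assume "f \<in> carrier (lie_aut R (lorentz_alg R))"
        then obtain U V e where "U \<in> frames R" "V \<in> frames R" "e \<in> idems R" "params f = ((fsec U, fsec V), chi F R e)"
          using par by blast
        then show "params f \<in> carrier (points (PGL2sq_Z2 F) R)"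
          by (simp add: carrier_target Q.frame_section_closed chi_closed)
      qed
      show "carrier (points (PGL2sq_Z2 F) R) \<subseteq> params ` carrier (lie_aut R (lorentz_alg R))"
      proof
        fix z assume "z \<in> carrier (points (PGL2sq_Z2 F) R)"
        then obtain x y a where z: "z = ((x, y), a)" "x \<in> carrier (PGL2_points R)"
            "y \<in> carrier (PGL2_points R)" "a \<in> carrier (points (Z2 F) R)"
          unfolding carrier_target by blast
        obtain U V e where U: "U \<in> frames R" "V \<in> frames R" "e \<in> idems R"
          and xya: "x = fsec U" "y = fsec V" "a = chi F R e"
          using Q.frame_section_surj[OF z(2)] Q.frame_section_surj[OF z(3)] chi_surj[OF z(4)] by blast
        have "z = ((fsec U, fsec V), chi F R e)"
          by (simp only: z(1) xya)
        then have "z = params (Q.LM U V e)"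
          using params_lmap[OF U] by simp
        then show "z \<in> params ` carrier (lie_aut R (lorentz_alg R))"
          using Q.lmap_aut[OF U] by blast
      qed
    qed
  qed
qed

end

text \<open>Written as \<open>lmap\<close>, an automorphism is base changed by applying the
  homomorphism to its frames and its idempotent. The sections and the point of \<open>Z2\<close>
  attached to them change in the same way.\<close>

lemma params_natural:
  assumes "split_algebra F R j t" "split_algebra F S j t" and \<phi>: "\<phi> \<in> alg_hom F R S"
    and f: "f \<in> carrier (points Aut_lorentz R)"
  shows "split_algebra.params F S j t (trans Aut_lorentz R S \<phi> f) =
    trans (PGL2sq_Z2 F) R S \<phi> (split_algebra.params F R j t f)"
proof -
  interpret R: split_algebra F R j t by fact
  interpret S: split_algebra F S j t by fact
  have hom: "\<phi> \<in> ring_hom R S" and lin: "\<And>c x. c \<in> carrier F \<Longrightarrow> x \<in> carrier R \<Longrightarrow> \<phi> (c \<odot>\<^bsub>R\<^esub> x) = c \<odot>\<^bsub>S\<^esub> \<phi> x"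
    using \<phi> by (auto simp: alg_hom_def)
  interpret H: quat_hom R S "scal R j" "scal R t" \<phi>
    by (rule quat_homI[OF R.quat_ring S.is_cring hom])
  have sc: "\<phi> (scal R c) = scal S c" if "c \<in> carrier F" for c
    using that by (simp add: scal_def lin)
  obtain U V e where U: "U \<in> frames R" "V \<in> frames R" "e \<in> idems R" and f': "f = R.Q.LM U V e"
    using R.Q.lmap_surj f unfolding R.points_Aut_lorentz by blast
  have tf: "trans Aut_lorentz R S \<phi> f = S.Q.LM (fmap \<phi> U) (fmap \<phi> V) (\<phi> e)"
    using lmap_base_change[OF H.quat_hom_axioms U] S.j S.t by (simp add: f' sc)
  have ts: "trans PGL2 R S \<phi> (R.fsec W) = S.fsec (fmap \<phi> W)" if "W \<in> frames R" for W
    using frame_section_natural[OF R.quat_ring S.is_cring hom that] S.j by (simp add: sc)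
  have eR: "e \<in> carrier R"
    by (rule R.Q.idemsD(1)[OF U(3)])
  have tc: "trans (Z2 F) R S \<phi> (chi F R e) = chi F S (\<phi> e)"
  proof -
    have "\<phi> (chi F R e (u, v)) = chi F S (\<phi> e) (u, v)" if "u \<in> carrier F" "v \<in> carrier F" for u v
      using that eR by (simp add: R.chi_apply S.chi_apply sc R.minus_eq S.minus_eq)
    then have "compose (carrier (split_alg F)) \<phi> (chi F R e) = restrict (chi F S (\<phi> e)) (carrier (split_alg F))"
      unfolding compose_def by (intro restrict_ext) auto
    then show ?thesis
      by (simp add: Z2_def) (simp add: chi_def)
  qed
  have "trans (PGL2sq_Z2 F) R S \<phi> ((R.fsec U, R.fsec V), chi F R e) =
      ((S.fsec (fmap \<phi> U), S.fsec (fmap \<phi> V)), chi F S (\<phi> e))"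
    by (simp add: PGL2sq_Z2_def semidirect_functor_def prod_functor_def ts[OF U(1)] ts[OF U(2)] tc)
  then show ?thesis
    unfolding tf S.params_lmap[OF H.map_frames[OF U(1)] H.map_frames[OF U(2)] H.map_idems[OF U(3)]]
    unfolding f' R.params_lmap[OF U] by simp
qed

theorem theorem7:
  fixes \<Phi> :: "'k ring"
  assumes "field \<Phi>"
    and "\<one>\<^bsub>\<Phi>\<^esub> \<oplus>\<^bsub>\<Phi>\<^esub> \<one>\<^bsub>\<Phi>\<^esub> \<noteq> \<zero>\<^bsub>\<Phi>\<^esub>"
    and "\<exists>i\<in>carrier \<Phi>. i \<otimes>\<^bsub>\<Phi>\<^esub> i = \<ominus>\<^bsub>\<Phi>\<^esub> \<one>\<^bsub>\<Phi>\<^esub>"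
  shows "iso_group_functors \<Phi>
           (Aut_lorentz :: ('k, 'r, (nat \<Rightarrow> 'r) \<Rightarrow> (nat \<Rightarrow> 'r)) group_functor)
           (PGL2sq_Z2 \<Phi>)"
proof -
  interpret F: field \<Phi> by fact
  obtain j where j: "j \<in> carrier \<Phi>" "j \<otimes>\<^bsub>\<Phi>\<^esub> j = \<ominus>\<^bsub>\<Phi>\<^esub> \<one>\<^bsub>\<Phi>\<^esub>"
    using assms(3) by blast
  have "\<one>\<^bsub>\<Phi>\<^esub> \<oplus>\<^bsub>\<Phi>\<^esub> \<one>\<^bsub>\<Phi>\<^esub> \<in> Units \<Phi>"
    using assms(2) by (simp add: F.field_Units)
  then obtain t where t: "t \<in> carrier \<Phi>" "(\<one>\<^bsub>\<Phi>\<^esub> \<oplus>\<^bsub>\<Phi>\<^esub> \<one>\<^bsub>\<Phi>\<^esub>) \<otimes>\<^bsub>\<Phi>\<^esub> t = \<one>\<^bsub>\<Phi>\<^esub>"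
    using F.Units_r_inv_ex by blast
  have alg: "split_algebra \<Phi> R j t" if "algebra \<Phi> R" for R :: "('k, 'r) module"
    using that j t by (simp add: split_algebra_def split_algebra_axioms_def)
  show ?thesis
    unfolding iso_group_functors_def
    by (intro exI[of _ "\<lambda>R. split_algebra.params \<Phi> R j t"] conjI allI impI ballI)
      (rule split_algebra.params_iso[OF alg] params_natural[OF alg alg]; assumption)+
qed

end
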